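(* Let $d_1,d_2,\alpha,\beta$ be integers with $0\le\alpha<d_1$ and $0\le\beta<d_2$. Let $N^h$ be the least integer $\ge \frac{d_1+1}{d_1-\alpha}$ and $N^v$ the least integer $\ge\frac{d_2+1}{d_2-\beta}$. Let $\mathcal{T}$ be a regular T-mesh without holes such that each horizontal interior l-edge has at least $N^h-1$ mono-vertices other than its two end vertices, and each vertical interior l-edge has at least $N^v-1$ mono-vertices other than its two end vertices. Then $$\dim\mathcal{S}(d_{1}, d_{2}, \alpha, \beta, \mathcal{T}) = (d_{1}+1)(d_{2}+1) + (C^{h}-T^{h})(d_{1}+1)(d_{2}-\beta) + (C^{v}-T^{v})(d_{2}+1)(d_{1}-\alpha) + V(d_{1}-\alpha)(d_{2}-\beta),$$ where $C^h, C^v$ are the numbers of horizontal and vertical cross-cuts, $T^h,T^v$ the numbers of horizontal and vertical interior l-edges, and $V$ the number of interior vertices of $\mathcal{T}$.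
   Context: **T-meshes.** A T-mesh $\mathcal{T}$ is a finite collection of axis-aligned closed rectangles $F_i$ (faces, cells) in $\mathbb{R}^2$ with union the domain $\Omega$, such that distinct rectangles intersect only at points on their edges. The vertices of the rectangles are the vertices of $\mathcal{T}$; the line segment connecting two adjacent vertices on a grid line is an edge of $\mathcal{T}$. A T-junction is a vertex of one rectangle lying in the interior of a side of another rectangle. $\Omega$ need not be rectangular. $\mathcal{T}$ is regular if for each vertex the set of all rectangles containing it has connected interior. $\mathcal{T}$ is without holes if the (connected) domain $\Omega$ has no holes. A vertex is a boundary vertex if it lies on the boundary of $\Omega$, and an interior vertex otherwise. An edge lying on the boundary of $\Omega$ is a boundary edge; other edges are interior edges. **l-edges.** An l-edge is a maximal line segment composed of connected (collinear) interior edges; its two end points are T-junctions or boundary vertices. It is an interior l-edge if both end points are interior vertices, a cross-cut if both end points are boundary vertices, and a ray if exactly one end point is a boundary vertex. Each interior vertex lies on exactly one horizontal and one vertical l-edge. A mono-vertex is a vertex that is the intersection of an interior l-edge with a cross-cut or a ray. **Spline space.** $\mathcal{S}(d_1,d_2,\alpha,\beta,\mathcal{T})$ is the real vector space of functions $f\in C^{\alpha,\beta}(\Omega)$ whose restriction to each cell of $\mathcal{T}$ is a polynomial of bi-degree $(d_1,d_2)$ (degree at most $d_1$ in $x$ and at most $d_2$ in $y$). Here $C^{\alpha,\beta}(\Omega)$ is the space of bivariate functions continuous of order $\alpha$ in the $x$ direction and of order $\beta$ in the $y$ direction; that is, the difference of the two polynomial pieces on the two sides of an interior edge is divisible by $(x-x_0)^{\alpha+1}$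 if the edge lies on $x=x_0$, and by $(y-y_0)^{\beta+1}$ if it lies on $y=y_0$. *)

theory Defs
  imports
    "HOL-Analysis.Analysis"
    "HOL-Computational_Algebra.Polynomial"
    "HOL-Library.Function_Algebras"
begin

section \<open>T-meshes\<close>

text \<open>A cell is the closed point set of a nondegenerate axis-aligned rectangle; a mesh is the
  set of its cells.\<close>

type_synonym cell = "(real \<times> real) set"

definition corners :: "cell \<Rightarrow> (real \<times> real) set" where
  "corners F = {v. \<exists>a b c d. a < b \<and> c < d \<and> F = {a..b} \<times> {c..d} \<and> v \<in> {a, b} \<times> {c, d}}"

definition mesh_domain :: "cell set \<Rightarrow> (real \<times> real) set" where
  "mesh_domain T = \<Union>T"

definition t_mesh :: "cell set \<Rightarrow> bool" where
  "t_mesh T \<longleftrightarrow> finite T \<and> T \<noteq> {} \<and>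
     (\<forall>F\<in>T. \<exists>a b c d. a < b \<and> c < d \<and> F = {a..b} \<times> {c..d}) \<and>
     (\<forall>F\<in>T. \<forall>G\<in>T. F \<noteq> G \<longrightarrow> F \<inter> G \<subseteq> frontier F \<inter> frontier G)"

definition vertices :: "cell set \<Rightarrow> (real \<times> real) set" where
  "vertices T = (\<Union>F\<in>T. corners F)"

definition boundary_vertices :: "cell set \<Rightarrow> (real \<times> real) set" where
  "boundary_vertices T = {v \<in> vertices T. v \<in> frontier (mesh_domain T)}"

definition interior_vertices :: "cell set \<Rightarrow> (real \<times> real) set" where
  "interior_vertices T = {v \<in> vertices T. v \<notin> frontier (mesh_domain T)}"

definition regular_mesh :: "cell set \<Rightarrow> bool" where
  "regular_mesh T \<longleftrightarrow> (\<forall>v\<in>vertices T. connected (interior (\<Union>{F\<in>T. v \<in> F})))"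

text \<open>A hole is a bounded connected component of the complement of the domain.\<close>

definition without_holes :: "cell set \<Rightarrow> bool" where
  "without_holes T \<longleftrightarrow> connected (mesh_domain T) \<and>
     (\<forall>C \<in> components (- mesh_domain T). \<not> bounded C)"

section \<open>Edges and l-edges\<close>

text \<open>A segment is encoded by its orientation, the endpoints \<open>a < b\<close> of its range in the varying
  coordinate, and the value \<open>c\<close> of the fixed coordinate: \<open>y = c\<close> if it is horizontal, \<open>x = c\<close> if it
  is vertical. For \<open>a < b\<close> this encoding is injective, so counting triples \<open>(a, b, c)\<close> of a fixed
  orientation counts segments.\<close>

datatype orientation = Horizontal | Vertical

fun pt :: "orientation \<Rightarrow> real \<Rightarrow> real \<Rightarrow> real \<times> real" where
  "pt Horizontal t c = (t, c)"
| "pt Vertical t c = (c, t)"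

definition seg :: "orientation \<Rightarrow> real \<Rightarrow> real \<Rightarrow> real \<Rightarrow> (real \<times> real) set" where
  "seg k a b c = (\<lambda>t. pt k t c) ` {a..b}"

text \<open>The last condition excludes segments that join consecutive vertices on a line but are not
  part of the side of a cell.\<close>

definition mesh_edge :: "cell set \<Rightarrow> orientation \<Rightarrow> real \<Rightarrow> real \<Rightarrow> real \<Rightarrow> bool" where
  "mesh_edge T k a b c \<longleftrightarrow> a < b \<and> pt k a c \<in> vertices T \<and> pt k b c \<in> vertices T \<and>
     (\<forall>t. a < t \<and> t < b \<longrightarrow> pt k t c \<notin> vertices T) \<and>
     (\<exists>F\<in>T. seg k a b c \<subseteq> frontier F)"

definition interior_edge :: "cell set \<Rightarrow> orientation \<Rightarrow> real \<Rightarrow> real \<Rightarrow> real \<Rightarrow> bool" where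
  "interior_edge T k a b c \<longleftrightarrow> mesh_edge T k a b c \<and> \<not> seg k a b c \<subseteq> frontier (mesh_domain T)"

definition composed_segment :: "cell set \<Rightarrow> orientation \<Rightarrow> real \<Rightarrow> real \<Rightarrow> real \<Rightarrow> bool" where
  "composed_segment T k a b c \<longleftrightarrow> a < b \<and>
     (\<exists>E \<subseteq> {(s, t). interior_edge T k s t c}. seg k a b c = (\<Union>(s, t)\<in>E. seg k s t c))"

definition l_edge :: "cell set \<Rightarrow> orientation \<Rightarrow> real \<Rightarrow> real \<Rightarrow> real \<Rightarrow> bool" where
  "l_edge T k a b c \<longleftrightarrow> composed_segment T k a b c \<and>
     (\<forall>a' b'. composed_segment T k a' b' c \<and> seg k a b c \<subseteq> seg k a' b' c \<longrightarrow> a' = a \<and> b' = b)"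

definition interior_l_edge :: "cell set \<Rightarrow> orientation \<Rightarrow> real \<Rightarrow> real \<Rightarrow> real \<Rightarrow> bool" where
  "interior_l_edge T k a b c \<longleftrightarrow> l_edge T k a b c \<and>
     pt k a c \<in> interior_vertices T \<and> pt k b c \<in> interior_vertices T"

definition cross_cut :: "cell set \<Rightarrow> orientation \<Rightarrow> real \<Rightarrow> real \<Rightarrow> real \<Rightarrow> bool" where
  "cross_cut T k a b c \<longleftrightarrow> l_edge T k a b c \<and>
     pt k a c \<in> boundary_vertices T \<and> pt k b c \<in> boundary_vertices T"

definition ray_edge :: "cell set \<Rightarrow> orientation \<Rightarrow> real \<Rightarrow> real \<Rightarrow> real \<Rightarrow> bool" where
  "ray_edge T k a b c \<longleftrightarrow> l_edge T k a b c \<and>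
     (pt k a c \<in> boundary_vertices T) \<noteq> (pt k b c \<in> boundary_vertices T)"

definition mono_vertex :: "cell set \<Rightarrow> real \<times> real \<Rightarrow> bool" where
  "mono_vertex T v \<longleftrightarrow> v \<in> vertices T \<and>
     (\<exists>k a b c k' a' b' c'. interior_l_edge T k a b c \<and>
        (cross_cut T k' a' b' c' \<or> ray_edge T k' a' b' c') \<and>
        seg k a b c \<inter> seg k' a' b' c' = {v})"

definition inner_mono_vertices ::
    "cell set \<Rightarrow> orientation \<Rightarrow> real \<Rightarrow> real \<Rightarrow> real \<Rightarrow> (real \<times> real) set" where
  "inner_mono_vertices T k a b c =
     {v \<in> seg k a b c. mono_vertex T v \<and> v \<noteq> pt k a c \<and> v \<noteq> pt k b c}"

definition num_cross_cuts :: "cell set \<Rightarrow> orientation \<Rightarrow> nat" where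
  "num_cross_cuts T k = card {(a, b, c). cross_cut T k a b c}"

definition num_interior_l_edges :: "cell set \<Rightarrow> orientation \<Rightarrow> nat" where
  "num_interior_l_edges T k = card {(a, b, c). interior_l_edge T k a b c}"

section \<open>The spline space\<close>

text \<open>Bivariate polynomials are elements of \<open>(\<real>[x])[y]\<close>: the outer variable is \<open>y\<close>.\<close>

definition eval2 :: "real poly poly \<Rightarrow> real \<Rightarrow> real \<Rightarrow> real" where
  "eval2 P x y = poly (poly P [:y:]) x"

definition bidegree_le :: "nat \<Rightarrow> nat \<Rightarrow> real poly poly \<Rightarrow> bool" where
  "bidegree_le d1 d2 P \<longleftrightarrow> degree P \<le> d2 \<and> (\<forall>j. degree (coeff P j) \<le> d1)"

text \<open>\<open>(y - c)\<^sup>\<beta>\<^sup>+\<^sup>1\<close> for a horizontal edge on \<open>y = c\<close> and \<open>(x - c)\<^sup>\<alpha>\<^sup>+\<^sup>1\<close> for a vertical edge on \<open>x = c\<close>.\<close>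

fun smoothness_factor :: "nat \<Rightarrow> nat \<Rightarrow> orientation \<Rightarrow> real \<Rightarrow> real poly poly" where
  "smoothness_factor \<alpha> \<beta> Horizontal c = [:[:- c:], 1:] ^ (\<beta> + 1)"
| "smoothness_factor \<alpha> \<beta> Vertical c = [:[:- c, 1:]:] ^ (\<alpha> + 1)"

definition spline_pieces ::
    "nat \<Rightarrow> nat \<Rightarrow> nat \<Rightarrow> nat \<Rightarrow> cell set \<Rightarrow> (cell \<Rightarrow> real poly poly) \<Rightarrow> bool" where
  "spline_pieces d1 d2 \<alpha> \<beta> T P \<longleftrightarrow>
     (\<forall>F\<in>T. bidegree_le d1 d2 (P F)) \<and>
     (\<forall>k a b c. \<forall>F\<in>T. \<forall>G\<in>T.
        interior_edge T k a b c \<and> F \<noteq> G \<and> seg k a b c \<subseteq> F \<inter> G \<longrightarrow>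
        smoothness_factor \<alpha> \<beta> k c dvd P F - P G)"

text \<open>Functions on the domain are represented by their extensions by \<open>0\<close> to the plane.\<close>

definition spline_space ::
    "nat \<Rightarrow> nat \<Rightarrow> nat \<Rightarrow> nat \<Rightarrow> cell set \<Rightarrow> (real \<times> real \<Rightarrow> real) set" where
  "spline_space d1 d2 \<alpha> \<beta> T = {f.
     (\<forall>z. z \<notin> mesh_domain T \<longrightarrow> f z = 0) \<and>
     (\<exists>P. spline_pieces d1 d2 \<alpha> \<beta> T P \<and>
        (\<forall>F\<in>T. \<forall>x y. (x, y) \<in> F \<longrightarrow> f (x, y) = eval2 (P F) x y))}"

interpretation fun_vs: vector_space "\<lambda>(r :: real) (f :: real \<times> real \<Rightarrow> real) z. r * f z"
  by unfold_locales (simp_all add: fun_eq_iff distrib_left distrib_right)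

lemma spline_pieces_bidegree:
  "spline_pieces d1 d2 \<alpha> \<beta> T P \<Longrightarrow> F \<in> T \<Longrightarrow> bidegree_le d1 d2 (P F)"
  unfolding spline_pieces_def by blast

lemma spline_pieces_smooth:
  assumes "spline_pieces d1 d2 \<alpha> \<beta> T P" "F \<in> T" "G \<in> T"
    "interior_edge T k a b c \<and> F \<noteq> G \<and> seg k a b c \<subseteq> F \<inter> G"
  shows "smoothness_factor \<alpha> \<beta> k c dvd P F - P G"
  using assms unfolding spline_pieces_def by blast

lemma spline_pieces_zero: "spline_pieces d1 d2 \<alpha> \<beta> T (\<lambda>_. 0)"
  by (simp add: spline_pieces_def bidegree_le_def)

lemma bidegree_le_add:
  assumes "bidegree_le d1 d2 P" "bidegree_le d1 d2 Q"
  shows "bidegree_le d1 d2 (P + Q)"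
  using assms unfolding bidegree_le_def by (simp add: degree_add_le)

lemma spline_pieces_add:
  assumes P: "spline_pieces d1 d2 \<alpha> \<beta> T P" and Q: "spline_pieces d1 d2 \<alpha> \<beta> T Q"
  shows "spline_pieces d1 d2 \<alpha> \<beta> T (\<lambda>F. P F + Q F)"
  unfolding spline_pieces_def
proof (intro conjI ballI allI impI)
  fix F assume F: "F \<in> T"
  show "bidegree_le d1 d2 (P F + Q F)"
    by (rule bidegree_le_add[OF spline_pieces_bidegree[OF P F] spline_pieces_bidegree[OF Q F]])
next
  fix k a b c F G
  assume h: "F \<in> T" "G \<in> T" "interior_edge T k a b c \<and> F \<noteq> G \<and> seg k a b c \<subseteq> F \<inter> G"
  show "smoothness_factor \<alpha> \<beta> k c dvd P F + Q F - (P G + Q G)"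
    unfolding add_diff_add
    by (rule dvd_add[OF spline_pieces_smooth[OF P h] spline_pieces_smooth[OF Q h]])
qed

lemma spline_pieces_smult:
  assumes P: "spline_pieces d1 d2 \<alpha> \<beta> T P"
  shows "spline_pieces d1 d2 \<alpha> \<beta> T (\<lambda>F. smult [:r:] (P F))"
  unfolding spline_pieces_def
proof (intro conjI ballI allI impI)
  fix F assume F: "F \<in> T"
  show "bidegree_le d1 d2 (smult [:r:] (P F))"
    using spline_pieces_bidegree[OF P F] by (simp add: bidegree_le_def)
next
  fix k a b c F G
  assume h: "F \<in> T" "G \<in> T" "interior_edge T k a b c \<and> F \<noteq> G \<and> seg k a b c \<subseteq> F \<inter> G"
  show "smoothness_factor \<alpha> \<beta> k c dvd smult [:r:] (P F) - smult [:r:] (P G)"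
    unfolding smult_diff_right[symmetric] by (rule dvd_smult[OF spline_pieces_smooth[OF P h]])
qed

lemma spline_spaceI:
  assumes "\<And>z. z \<notin> mesh_domain T \<Longrightarrow> f z = 0" "spline_pieces d1 d2 \<alpha> \<beta> T P"
    "\<And>F x y. F \<in> T \<Longrightarrow> (x, y) \<in> F \<Longrightarrow> f (x, y) = eval2 (P F) x y"
  shows "f \<in> spline_space d1 d2 \<alpha> \<beta> T"
  unfolding spline_space_def mem_Collect_eq using assms by blast

lemma spline_spaceE:
  assumes "f \<in> spline_space d1 d2 \<alpha> \<beta> T"
  obtains P where "\<And>z. z \<notin> mesh_domain T \<Longrightarrow> f z = 0" "spline_pieces d1 d2 \<alpha> \<beta> T P"
    "\<And>F x y. F \<in> T \<Longrightarrow> (x, y) \<in> F \<Longrightarrow> f (x, y) = eval2 (P F) x y"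
  using assms unfolding spline_space_def mem_Collect_eq by metis

lemma subspace_spline_space: "fun_vs.subspace (spline_space d1 d2 \<alpha> \<beta> T)"
proof (rule fun_vs.subspaceI)
  show "0 \<in> spline_space d1 d2 \<alpha> \<beta> T"
    by (rule spline_spaceI[OF _ spline_pieces_zero]) (simp_all add: eval2_def)
next
  fix f g assume f: "f \<in> spline_space d1 d2 \<alpha> \<beta> T" and g: "g \<in> spline_space d1 d2 \<alpha> \<beta> T"
  obtain P where P: "\<And>z. z \<notin> mesh_domain T \<Longrightarrow> f z = 0" "spline_pieces d1 d2 \<alpha> \<beta> T P"
    "\<And>F x y. F \<in> T \<Longrightarrow> (x, y) \<in> F \<Longrightarrow> f (x, y) = eval2 (P F) x y"
    using f by (rule spline_spaceE) blast
  obtain Q where Q: "\<And>z. z \<notin> mesh_domain T \<Longrightarrow> g z = 0" "spline_pieces d1 d2 \<alpha> \<beta> T Q"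
    "\<And>F x y. F \<in> T \<Longrightarrow> (x, y) \<in> F \<Longrightarrow> g (x, y) = eval2 (Q F) x y"
    using g by (rule spline_spaceE) blast
  show "f + g \<in> spline_space d1 d2 \<alpha> \<beta> T"
  proof (rule spline_spaceI[OF _ spline_pieces_add[OF P(2) Q(2)]])
    show "(f + g) z = 0" if "z \<notin> mesh_domain T" for z
      using P(1)[OF that] Q(1)[OF that] by simp
    show "(f + g) (x, y) = eval2 (P F + Q F) x y" if "F \<in> T" "(x, y) \<in> F" for F x y
      using P(3)[OF that] Q(3)[OF that] by (simp add: eval2_def)
  qed
next
  fix r f assume f: "f \<in> spline_space d1 d2 \<alpha> \<beta> T"
  obtain P where P: "\<And>z. z \<notin> mesh_domain T \<Longrightarrow> f z = 0" "spline_pieces d1 d2 \<alpha> \<beta> T P"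
    "\<And>F x y. F \<in> T \<Longrightarrow> (x, y) \<in> F \<Longrightarrow> f (x, y) = eval2 (P F) x y"
    using f by (rule spline_spaceE) blast
  show "(\<lambda>z. r * f z) \<in> spline_space d1 d2 \<alpha> \<beta> T"
  proof (rule spline_spaceI[OF _ spline_pieces_smult[OF P(2)]])
    show "r * f z = 0" if "z \<notin> mesh_domain T" for z
      using P(1)[OF that] by simp
    show "r * f (x, y) = eval2 (smult [:r:] (P F)) x y" if "F \<in> T" "(x, y) \<in> F" for F x y
      using P(3)[OF that] by (simp add: eval2_def)
  qed
qed

end

theory Submission
  imports Defs
begin

text \<open>A spline is determined by its piece on one cell together with its jumps across the interior
  edges. Along an l-edge the jump changes only at interior vertices, by an element of the space of
  polynomials divisible by the smoothness factors of both lines through the vertex. Hence a spline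
  amounts to a polynomial, an initial jump for every cross-cut, and a vertex jump for every interior
  vertex, subject to one condition per interior l-edge: the vertex jumps on it sum to zero. Every such
  datum comes from a spline, because the domain has no holes: the defect of a locally closed system of
  jumps at boundary vertices can be routed through the complement to infinity, and on a rectangular
  grid closed systems are exact. It remains to see that the conditions are independent. The vertex jumps
  at the mono-vertices and the upper end of an interior l-edge already span all jumps along its line;
  mono-vertices lie on no other interior l-edge, and the upper end lies only on one whose own upper
  end has a larger coordinate sum, so the conditions can be solved one after another.\<close>

section \<open>Linear algebra\<close>

text \<open>One datum per vertex serves both lines through it, because the change of the jump along
  either line is the same alternating sum of the four surrounding pieces; it is divisible by both
  line factors, hence by their product. A vertex of a horizontal line thus supplies d1 - \<alpha>
  dimensions in the variable x, and N^h vertices are what it takes to span all d1 + 1: N^h - 1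
  mono-vertices and one end. The obstacle is that the end may lie on a second interior l-edge. As
  the first one stops there in a T-junction, the crossing one runs strictly past it, which makes the
  order by coordinate sums strict. The domain may have any shape, so jumps cannot simply be
  integrated along rows and columns: the bounding box is cut along all side coordinates, missing
  grid cells receive values too, and the jumps next to them may be altered freely. Regularity enters
  where cells meet at a point: they must be linked by edges through it, for the pieces to agree
  there and for the whole domain to be connected through edges.\<close>

lemma (in vector_space) dim_eq_card_family:
  assumes J: "finite J"
    and V: "V = range (\<lambda>c. \<Sum>j\<in>J. scale (c j) (e j))"
    and ind: "\<And>c. (\<Sum>j\<in>J. scale (c j) (e j)) = 0 \<Longrightarrow> \<forall>j\<in>J. c j = 0"
  shows "dim V = card J"
proof -
  have inj: "inj_on e J"
  proof (rule inj_onI)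
    fix i j assume ij: "i \<in> J" "j \<in> J" "e i = e j"
    show "i = j"
    proof (rule ccontr)
      assume ne: "i \<noteq> j"
      \<comment> \<open>Coefficient 1 at \<open>i\<close> and -1 at \<open>j\<close>: a nontrivial
        relation if the two vectors coincide. Hence indices can be counted instead of
        vectors.\<close>
      let ?c = "\<lambda>k. (if k = i then 1 else 0) - (if k = j then 1 else (0::'a))"
      have "(\<Sum>k\<in>J. scale (?c k) (e k)) = 
          (\<Sum>k\<in>J. if k = i then e k else 0) - (\<Sum>k\<in>J. if k = j then e k else 0)"
        unfolding sum_subtractf[symmetric]
        by (intro sum.cong) (auto simp: scale_left_diff_distrib)
      also have "\<dots> = 0" using ij J by (simp add: sum.delta)
      finally have "\<forall>k\<in>J. ?c k = 0" by (rule ind)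
      from bspec[OF this ij(1)] ne show False by simp
    qed
  qed
  have indep: "independent (e ` J)"
  proof
    assume "dependent (e ` J)"
    then obtain u where u: "\<exists>v\<in>e ` J. u v \<noteq> 0" "(\<Sum>v\<in>e ` J. scale (u v) v) = 0"
      using dependent_finite[of "e ` J"] J by auto
    have "(\<Sum>j\<in>J. scale (u (e j)) (e j)) = 0" using u(2) by (simp add: sum.reindex[OF inj])
    from ind[OF this] u(1) show False by blast
  qed
  have "span (e ` J) = V"
    unfolding V span_finite[OF finite_imageI[OF J]]
  proof (rule set_eqI, rule iffI)
    fix x assume "x \<in> range (\<lambda>u. \<Sum>v\<in>e ` J. scale (u v) v)"
    then show "x \<in> range (\<lambda>c. \<Sum>j\<in>J. scale (c j) (e j))"
      by (auto simp: sum.reindex[OF inj])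
  next
    fix x assume "x \<in> range (\<lambda>c. \<Sum>j\<in>J. scale (c j) (e j))"
    then obtain c where c: "x = (\<Sum>j\<in>J. scale (c j) (e j))" by auto
    have "x = (\<Sum>v\<in>e ` J. scale (c (the_inv_into J e v)) v)"
      unfolding c sum.reindex[OF inj] by (intro sum.cong) (auto simp: the_inv_into_f_f[OF inj])
    thus "x \<in> range (\<lambda>u. \<Sum>v\<in>e ` J. scale (u v) v)"
      by (rule range_eqI[where x = "\<lambda>v. c (the_inv_into J e v)"])
  qed
  hence "dim V = card (e ` J)" using dim_span_eq_card_independent[OF indep] by simp
  thus ?thesis by (simp add: card_image[OF inj])
qed

lemma (in vector_space_pair) dim_image_eq_inj_on:
  assumes f: "Vector_Spaces.linear s1 s2 f" and V: "vs1.subspace V" and inj: "inj_on f V"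
  shows "vs2.dim (f ` V) = vs1.dim V"
proof -
  interpret f: Vector_Spaces.linear s1 s2 f by fact
  obtain B where B: "B \<subseteq> V" "vs1.independent B" "V \<subseteq> vs1.span B"
    using vs1.maximal_independent_subset by blast
  have sp: "vs1.span B = V" using B V by (simp add: vs1.span_subspace)
  have "vs2.independent (f ` B)"
    using linear_independent_injective_image[OF f B(2)] inj sp by simp
  moreover have "vs2.span (f ` B) = f ` V" using f.span_image[of B] sp by simp
  moreover have "card (f ` B) = card B" using B inj by (meson card_image inj_on_subset)
  ultimately show ?thesis
    using vs2.dim_span_eq_card_independent vs1.dim_span_eq_card_independent[OF B(2)] sp by metis
qed

text \<open>A basis \<open>B0\<close> of the kernel is extended to a basis \<open>B\<close> of
  \<open>V\<close>; \<open>f\<close> is injective on the span of the rest \<open>C\<close> and maps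
  it onto the image of \<open>V\<close>. Finite dimension is required of \<open>V\<close> only,
  since the ambient function spaces are too large.\<close>

lemma (in vector_space_pair) rank_nullity:
  assumes f: "Vector_Spaces.linear s1 s2 f" and V: "vs1.subspace V" and A: "finite A"
    "V \<subseteq> vs1.span A"
  shows "vs1.dim V = vs1.dim {x \<in> V. f x = 0} + vs2.dim (f ` V)"
proof -
  interpret f: Vector_Spaces.linear s1 s2 f by fact
  let ?K = "{x \<in> V. f x = 0}"
  have K: "vs1.subspace ?K"
    using V by (auto simp: vs1.subspace_def f.add f.scale)
  obtain B0 where B0: "B0 \<subseteq> ?K" "vs1.independent B0" "?K \<subseteq> vs1.span B0"
    using vs1.maximal_independent_subset by blast
  obtain B where B: "B0 \<subseteq> B" "B \<subseteq> V" "vs1.independent B" "V \<subseteq> vs1.span B"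
    using vs1.maximal_independent_subset_extend[of B0 V] B0 by blast
  have finB: "finite B" using vs1.independent_span_bound[OF A(1) B(3)] B(2) A(2) by blast
  have spB: "vs1.span B = V" using B V by (simp add: vs1.span_subspace)
  have spK: "vs1.span B0 = ?K" using B0 K by (simp add: vs1.span_subspace)
  define C where "C = B - B0"
  have finC: "finite C" and finB0: "finite B0" using finB B(1)
    by (auto simp: C_def intro: finite_subset)
  have BC: "B = B0 \<union> C" "B0 \<inter> C = {}" using B(1) by (auto simp: C_def)
  have ker: "x = 0" if x: "x \<in> vs1.span C" "f x = 0" for x
  proof -
    obtain u where u: "x = (\<Sum>v\<in>C. s1 (u v) v)" using x(1) by (auto simp: vs1.span_finite[OF finC])
    have "vs1.span C \<subseteq> V" using vs1.span_mono[of C B] spB BC by auto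
    hence "x \<in> vs1.span B0" using x spK by auto
    then obtain w where w: "x = (\<Sum>v\<in>B0. s1 (w v) v)" by (auto simp: vs1.span_finite[OF finB0])
    \<comment> \<open>\<open>x\<close> is expanded in \<open>C\<close> by \<open>u\<close> and in
      \<open>B0\<close> by \<open>w\<close>; the difference of the two expansions is a relation on
      the basis \<open>B\<close>.\<close>
    define g where "g v = (if v \<in> C then u v else - w v)" for v
    have "(\<Sum>v\<in>B. s1 (g v) v) = (\<Sum>v\<in>B0. s1 (g v) v) + (\<Sum>v\<in>C. s1 (g v) v)"
      unfolding BC(1) by (rule sum.union_disjoint[OF finB0 finC BC(2)])
    also have "(\<Sum>v\<in>C. s1 (g v) v) = x" unfolding u by (intro sum.cong) (auto simp: g_def)
    also have "(\<Sum>v\<in>B0. s1 (g v) v) = (\<Sum>v\<in>B0. - s1 (w v) v)"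
      using BC(2) by (intro sum.cong) (auto simp: g_def)
    also have "\<dots> = - x" by (simp add: w sum_negf)
    finally have "(\<Sum>v\<in>B. s1 (g v) v) = 0" by simp
    hence g0: "g v = 0" if "v \<in> B" for v
      using that B(3) vs1.dependent_finite[OF finB] by blast
    have "u v = 0" if "v \<in> C" for v using that g0[of v] by (simp add: g_def C_def)
    thus ?thesis unfolding u by simp
  qed
  have inj: "inj_on f (vs1.span C)"
  proof (rule inj_onI)
    fix x y assume xy: "x \<in> vs1.span C" "y \<in> vs1.span C" "f x = f y"
    have "x - y = 0" by (rule ker) (use xy in \<open>auto simp: f.diff intro: vs1.span_diff\<close>)
    thus "x = y" by simp
  qed
  have indC: "vs1.independent C" by (rule vs1.independent_mono[OF B(3)]) (auto simp: C_def)
  have indfC: "vs2.independent (f ` C)" using linear_independent_injective_image[OF f indC inj] .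
  have "f ` V = vs2.span (f ` C)"
  proof -
    have "f ` V = vs2.span (f ` B)" using f.span_image[of B] spB by simp
    also have "\<dots> = vs2.span (f ` C)"
    proof (rule antisym)
      have "f ` B \<subseteq> vs2.span (f ` C)"
      proof
        fix y assume "y \<in> f ` B"
        then obtain x where x: "x \<in> B0 \<or> x \<in> C" "y = f x" using BC by auto
        then have "y = 0 \<or> y \<in> f ` C" using B0(1) by auto
        thus "y \<in> vs2.span (f ` C)" using vs2.span_base[of y "f ` C"] vs2.span_zero[of "f ` C"]
          by auto
      qed
      thus "vs2.span (f ` B) \<subseteq> vs2.span (f ` C)" by (simp add: vs2.span_minimal)
      show "vs2.span (f ` C) \<subseteq> vs2.span (f ` B)" using BC by (intro vs2.span_mono) auto
    qed
    finally show ?thesis .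
  qed
  hence "vs2.dim (f ` V) = card (f ` C)" using vs2.dim_span_eq_card_independent[OF indfC] by simp
  also have "\<dots> = card C"
    using inj vs1.span_superset by (meson card_image inj_on_subset)
  finally have 1: "vs2.dim (f ` V) = card C" .
  have "vs1.dim V = card B" using vs1.dim_span_eq_card_independent[OF B(3)] spB by simp
  moreover have "vs1.dim ?K = card B0" using vs1.dim_span_eq_card_independent[OF B0(2)] spK by simp
  moreover have "card B = card B0 + card C" unfolding BC(1)
    by (rule card_Un_disjoint[OF finB0 finC BC(2)])
  ultimately show ?thesis using 1 by simp
qed

text \<open>A functional \<open>lam\<close> annihilating the left-hand sides yields the polynomial
  \<open>t \<mapsto> lam ((x - t)\<^sup>d)\<close> of degree at most \<open>d\<close>, which vanishes to order \<open>d + 1 - e\<close> at every \<open>r \<in> S\<close>.\<close>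

lemma span_shifted_powers:
  fixes S :: "real set" and d e :: nat
  assumes fin: "finite S" and e: "e \<le> d" and card: "d + 1 \<le> card S * (d + 1 - e)"
    and p: "degree p \<le> d"
  shows "\<exists>q. (\<forall>r\<in>S. degree (q r) \<le> d - e) \<and> p = (\<Sum>r\<in>S. [:- r, 1:] ^ e * q r)"
proof (rule ccontr)
  assume neg: "\<not> ?thesis"
  interpret P: vector_space_pair "smult :: real \<Rightarrow> _" "(*) :: real \<Rightarrow> _"
    by unfold_locales (simp_all add: smult_add_left smult_add_right distrib_left distrib_right)
  define U where "U = {(\<Sum>r\<in>S. [:- r, 1:] ^ e * q r) | q. \<forall>r\<in>S. degree (q r :: real poly) \<le> d - e}"
  have "P.vs1.subspace U"
  proof (rule P.vs1.subspaceI)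
    show "0 \<in> U" unfolding U_def by (intro CollectI exI[of _ "\<lambda>_. 0"]) auto
  next
    fix x y assume "x \<in> U" "y \<in> U"
    then obtain q q' where "x = (\<Sum>r\<in>S. [:- r, 1:] ^ e * q r)" "\<forall>r\<in>S. degree (q r) \<le> d - e"
       "y = (\<Sum>r\<in>S. [:- r, 1:] ^ e * q' r)" "\<forall>r\<in>S. degree (q' r) \<le> d - e" unfolding U_def by auto
    then show "x + y \<in> U" unfolding U_def
      by (intro CollectI exI[of _ "\<lambda>r. q r + q' r"])
         (simp add: sum.distrib distrib_left degree_add_le)
  next
    fix c x assume "x \<in> U"
    then obtain q where "x = (\<Sum>r\<in>S. [:- r, 1:] ^ e * q r)" "\<forall>r\<in>S. degree (q r) \<le> d - e"
       unfolding U_def by auto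
    then show "smult c x \<in> U" unfolding U_def
      by (intro CollectI exI[of _ "\<lambda>r. smult c (q r)"])
         (simp add: P.vs1.scale_sum_right)
  qed
  obtain B where B: "B \<subseteq> U" "P.vs1.independent B" "U \<subseteq> P.vs1.span B"
    using P.vs1.maximal_independent_subset by blast
  have spB: "P.vs1.span B = U" using B \<open>P.vs1.subspace U\<close> by (simp add: P.vs1.span_subspace)
  have pU: "p \<notin> U" using neg unfolding U_def by blast
  hence "P.vs1.independent (insert p B)" using B spB by (intro P.vs1.independent_insertI) auto
  then obtain lam where lam: "Vector_Spaces.linear smult (*) lam" "\<forall>x\<in>insert p B. lam x
    = (if x = p then 1 else 0)"
    using P.linear_independent_extend[of "insert p B" "\<lambda>x. if x = p then 1 else 0"] by blast
  interpret lam: Vector_Spaces.linear smult "(*)" lam by fact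
  have lamU: "lam x = 0" if "x \<in> U" for x
  proof -
    have "P.vs1.subspace {x. lam x = 0}"
      by (auto intro!: P.vs1.subspaceI simp: lam.add lam.scale)
    moreover have "B \<subseteq> {x. lam x = 0}" using lam(2) B(1) pU by auto
    ultimately show ?thesis using that P.vs1.span_minimal spB by blast
  qed
  \<comment> \<open>\<open>x - t\<close> is written as \<open>(x - a) - (t - a)\<close> and expanded
    binomially, so \<open>G a\<close> is one polynomial in \<open>t\<close> presented in powers of
    \<open>t - a\<close>. As it does not depend on \<open>a\<close>, each node may serve as the
    centre.\<close>
  define G where "G a = (\<Sum>k\<le>d. smult (of_nat (d choose k) * (-1) ^ k * lam ([:- a, 1:] ^ (d - k)))
    ([:- a, 1:] ^ k))"
    for a :: real
  have polyG: "poly (G a) t = lam ([:- t, 1:] ^ d)" for a t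
  proof -
    have "[:- t, 1:] ^ d = (smult (-1) [:t - a:] + [:- a, 1:]) ^ d" by simp
    also have "\<dots> = (\<Sum>k\<le>d. of_nat (d choose k) * (smult (-1) [:t - a:]) ^ k * [:- a, 1:] ^ (d - k))"
      by (rule binomial_ring)
    also have "\<dots> = (\<Sum>k\<le>d. smult (of_nat (d choose k) * (-1) ^ k * (t - a) ^ k)
      ([:- a, 1:] ^ (d - k)))"
    proof (intro sum.cong refl)
      fix k
      have 1: "[:t - a:] ^ k = [:(t - a) ^ k:]" by (simp add: poly_const_pow)
      show "of_nat (d choose k) * (smult (-1) [:t - a:]) ^ k * [:- a, 1:] ^ (d - k) = 
        smult (of_nat (d choose k) * (-1) ^ k * (t - a) ^ k) ([:- a, 1:] ^ (d - k))"
        unfolding smult_power 1 of_nat_poly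
        by simp
    qed
    finally have "lam ([:- t, 1:] ^ d)
      = (\<Sum>k\<le>d. of_nat (d choose k) * (-1) ^ k * (t - a) ^ k * lam ([:- a, 1:] ^ (d - k)))"
      by (simp add: lam.sum lam.scale)
    also have "\<dots> = poly (G a) t" unfolding G_def poly_sum
      by (intro sum.cong) (auto simp: algebra_simps)
    finally show ?thesis by simp
  qed
  have Geq: "G a = G 0" for a
    by (rule iffD1[OF poly_eq_poly_eq_iff]) (rule ext, simp only: polyG)
  have dvdG: "[:- r, 1:] ^ (d + 1 - e) dvd G 0" if r: "r \<in> S" for r
  proof -
    have "[:- r, 1:] ^ (d + 1 - e) dvd G r"
      unfolding G_def
    proof (rule dvd_sum)
      fix k assume k: "k \<in> {..d}"
      show "[:- r, 1:] ^ (d + 1 - e) dvd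
         smult (of_nat (d choose k) * (-1) ^ k * lam ([:- r, 1:] ^ (d - k))) ([:- r, 1:] ^ k)"
      proof (cases "d + 1 - e \<le> k")
        case True thus ?thesis by (intro dvd_smult le_imp_power_dvd)
      next
        case False
        \<comment> \<open>For \<open>k < d + 1 - e\<close> the factor \<open>[:- r, 1:] ^ e\<close>
          splits off with a cofactor of degree at most \<open>d - e\<close>, so this power lies in
          \<open>U\<close> and \<open>lam\<close> kills its coefficient in
          \<open>G r\<close>.\<close>
        have "[:- r, 1:] ^ (d - k) = [:- r, 1:] ^ e * [:- r, 1:] ^ (d - k - e)"
          using False e by (simp flip: power_add)
        also have "\<dots> = (\<Sum>r'\<in>S. [:- r', 1:] ^ e * (if r' = r then [:- r, 1:] ^ (d - k - e) else 0))"
          using r fin by (subst sum.remove[of S r]) auto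
        also have "\<dots> \<in> U" unfolding U_def
          using False by (intro CollectI exI conjI refl) (auto simp: degree_linear_power)
        finally show ?thesis using lamU by simp
      qed
    qed
    thus ?thesis by (simp only: Geq[of r])
  qed
  have "G 0 = 0"
  proof (rule ccontr)
    assume nz: "G 0 \<noteq> 0"
    have ord: "d + 1 - e \<le> order r (G 0)" if "r \<in> S" for r
      using dvdG[OF that] nz by (simp add: order_divides)
    have sub: "S \<subseteq> set_mset (proots (G 0))"
      proof
      fix r assume "r \<in> S"
      then have "order r (G 0) \<noteq> 0" using ord[of r] e by linarith
      then show "r \<in> set_mset (proots (G 0))" using nz by (simp add: order_root)
    qed
    \<comment> \<open>More roots, counted with multiplicity, than a nonzero polynomial of degree at
      most \<open>d\<close> can have.\<close>
    have "d + 1 \<le> (\<Sum>r\<in>S. d + 1 - e)" using card by simp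
    also have "\<dots> \<le> (\<Sum>r\<in>S. order r (G 0))" by (intro sum_mono ord)
    also have "\<dots> \<le> (\<Sum>r\<in>set_mset (proots (G 0)). order r (G 0))"
      by (intro sum_mono2 sub) auto
    also have "\<dots> = size (proots (G 0))" using nz by (simp add: size_multiset_overloaded_eq)
    also have "\<dots> \<le> degree (G 0)" by (rule size_proots_le)
    also have "\<dots> \<le> d" unfolding G_def
      by (intro degree_sum_le) (auto simp: degree_linear_power intro:
        order.trans[OF degree_smult_le])
    finally show False by simp
  qed
  \<comment> \<open>The coefficients of \<open>G 0\<close> are signed binomials times the values of
    \<open>lam\<close> at the monomials up to degree \<open>d\<close>, so \<open>lam\<close>
    vanishes at these and hence at \<open>p\<close>.\<close>
  have lam0: "lam (monom 1 (d - k)) = 0" if k: "k \<le> d" for k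
  proof -
    have lin: "[:- 0, 1:] ^ i = monom (1::real) i" for i by (simp add: monom_altdef)
    have "coeff (G 0) k = of_nat (d choose k) * (-1) ^ k * lam (monom 1 (d - k))"
      using k unfolding G_def lin by (subst sum.remove[of _ k]) (auto simp: coeff_sum)
    with \<open>G 0 = 0\<close> k show ?thesis by simp
  qed
  have "lam p = lam (\<Sum>i\<le>d. smult (coeff p i) (monom 1 i))"
    using poly_as_sum_of_monoms'[OF p] by (simp add: smult_monom)
  also have "\<dots> = (\<Sum>i\<le>d. coeff p i * lam (monom 1 i))" by (simp add: lam.sum lam.scale)
  also have "\<dots> = 0" 
  proof (intro sum.neutral ballI)
    fix i assume "i \<in> {..d}"
    then show "coeff p i * lam (monom 1 i) = 0" using lam0[of "d - i"] by simp
  qed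
  finally show False using lam(2) by simp
qed

section \<open>Polynomials divisible by smoothness factors\<close>

text \<open>The factor is monic in \<open>y\<close>, so the coefficients of \<open>q\<close> are
  recovered from the top down. \<open>Q\<close> is instantiated both by divisibility by a power of
  \<open>x - x0\<close> and by a degree bound in \<open>x\<close>.\<close>

lemma coeffs_hfac_closed:
  fixes q :: "real poly poly"
  assumes Q: "\<And>p r. Q p \<Longrightarrow> Q r \<Longrightarrow> Q (p + r)" "\<And>c p. Q p \<Longrightarrow> Q (smult c p)" "Q 0"
  shows "(\<forall>j. Q (coeff ([:[:- y:], 1:] * q) j)) \<longleftrightarrow> (\<forall>j. Q (coeff q j))" (is "?l \<longleftrightarrow> ?r")
proof
  assume l: ?l
  have "Q (coeff q j)" for j
  proof (cases "j \<le> degree q")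
    case True
    then show ?thesis
    proof (induction rule: inc_induct)
      case base
      show ?case using l[rule_format, of "Suc (degree q)"] by (simp add: coeff_eq_0)
    next
      case (step n)
      have "coeff q n = coeff ([:[:- y:], 1:] * q) (Suc n) + smult y (coeff q (Suc n))" by simp
      then show ?case using l step.IH Q by metis
    qed
  qed (use Q in \<open>simp add: coeff_eq_0\<close>)
  thus ?r by blast
next
  assume r: ?r
  show ?l
  proof
    fix j
    have "coeff ([:[:- y:], 1:] * q) j
      = smult (- y) (coeff q j) + (case j of 0 \<Rightarrow> 0 | Suc i \<Rightarrow> coeff q i)"
      by (cases j) auto
    moreover have "Q (case j of 0 \<Rightarrow> 0 | Suc i \<Rightarrow> coeff q i)" using r Q by (auto split: nat.split)
    ultimately show "Q (coeff ([:[:- y:], 1:] * q) j)" using r Q by metis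
  qed
qed

abbreviation hfac :: "nat \<Rightarrow> real \<Rightarrow> real poly poly" where "hfac f y \<equiv> [:[:- y:], 1:] ^ f"
abbreviation vfac :: "nat \<Rightarrow> real \<Rightarrow> real poly poly" where "vfac e x \<equiv> [:[:- x, 1:]:] ^ e"

lemma coeffs_hfac_power_closed:
  fixes q :: "real poly poly"
  assumes Q: "\<And>p r. Q p \<Longrightarrow> Q r \<Longrightarrow> Q (p + r)" "\<And>c p. Q p \<Longrightarrow> Q (smult c p)" "Q 0"
  shows "(\<forall>j. Q (coeff (hfac f y * q) j)) \<longleftrightarrow> (\<forall>j. Q (coeff q j))"
proof (induction f)
  case (Suc f)
  show ?case unfolding power_Suc mult.assoc
    using coeffs_hfac_closed[of Q, OF Q] Suc by blast
qed simp

lemma vfac_eq: "vfac e x = [:[:- x, 1:] ^ e:]"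
  by (simp add: poly_const_pow)

text \<open>Coprimality of the two coordinate factors, without gcds: a power of
  \<open>x - x0\<close> divides a polynomial iff it divides every coefficient, and this property
  passes to the quotient by \<open>hfac f y\<close>.\<close>

lemma hfac_vfac_dvd:
  assumes "hfac f y dvd p" "vfac e x dvd p"
  shows "vfac e x * hfac f y dvd p"
proof -
  obtain q where q: "p = hfac f y * q" using assms(1) by (elim dvdE)
  have "\<forall>j. [:- x, 1:] ^ e dvd coeff (hfac f y * q) j"
    using assms(2) unfolding q vfac_eq by (simp add: const_poly_dvd_iff)
  hence "\<forall>j. [:- x, 1:] ^ e dvd coeff q j"
    by (subst (asm) coeffs_hfac_power_closed) (auto intro: dvd_smult)
  hence "vfac e x dvd q" unfolding vfac_eq by (simp add: const_poly_dvd_iff)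
  thus ?thesis unfolding q by (metis mult.commute mult_dvd_mono dvd_refl)
qed

lemma bidegree_le_vfac_hfac:
  assumes "e \<le> d1" "f \<le> d2"
  shows "bidegree_le d1 d2 (vfac e x * hfac f y * q) \<longleftrightarrow> bidegree_le (d1 - e) (d2 - f) q"
proof (cases "q = 0")
  case False
  have 1: "degree (hfac f y * q) = f + degree q" using False
    by (subst degree_mult_eq) (auto simp: degree_power_eq)
  have 2: "degree (coeff (vfac e x * r) j) \<le> d1 \<longleftrightarrow> degree (coeff r j) \<le> d1 - e" for r j
  proof (cases "coeff r j = 0")
    case False
    then have "degree (coeff (vfac e x * r) j) = e + degree (coeff r j)"
      unfolding vfac_eq by (simp add: degree_mult_eq degree_linear_power)
    thus ?thesis using assms(1) by auto
  qed (simp add: vfac_eq)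
  have "degree (vfac e x * hfac f y * q) = f + degree q"
    unfolding mult.assoc 1[symmetric] vfac_eq by simp
  moreover have "(\<forall>j. degree (coeff (hfac f y * q) j) \<le> d1 - e) \<longleftrightarrow> (\<forall>j. degree (coeff q j) \<le> d1 - e)"
    by (rule coeffs_hfac_power_closed) (auto intro: degree_add_le order.trans[OF degree_smult_le])
  ultimately show ?thesis
    unfolding bidegree_le_def mult.assoc 2 using assms(2) by auto
qed (simp add: bidegree_le_def)

text \<open>With exponent 0 a factor disappears, so all polynomials of the bidegree, the jumps along
  a line and the jumps at a vertex are instances of one family with one dimension formula.\<close>

definition fac_space :: "nat \<Rightarrow> nat \<Rightarrow> nat \<Rightarrow> real \<Rightarrow> nat \<Rightarrow> real \<Rightarrow> real poly poly set" where
  "fac_space d1 d2 e x f y = {p. bidegree_le d1 d2 p \<and> vfac e x * hfac f y dvd p}"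

lemma fac_space_iff:
  assumes "e \<le> d1" "f \<le> d2"
  shows "p \<in> fac_space d1 d2 e x f y \<longleftrightarrow>
    (\<exists>q. bidegree_le (d1 - e) (d2 - f) q \<and> p = vfac e x * hfac f y * q)"
  unfolding fac_space_def mem_Collect_eq dvd_def using bidegree_le_vfac_hfac[OF assms] by metis

lemma bidegree_le_expand:
  assumes "bidegree_le m n q"
  shows "q = (\<Sum>(i, j)\<in>{..m} \<times> {..n}. smult [:coeff (coeff q j) i:] (monom (monom 1 i) j))"
proof -
  have "q = (\<Sum>j\<le>n. monom (coeff q j) j)"
    using poly_as_sum_of_monoms'[of q n] assms by (simp add: bidegree_le_def)
  also have "\<dots> = (\<Sum>j\<le>n. \<Sum>i\<le>m. smult [:coeff (coeff q j) i:] (monom (monom 1 i) j))"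
  proof (intro sum.cong refl)
    fix j
    have "coeff q j = (\<Sum>i\<le>m. monom (coeff (coeff q j) i) i)"
      using poly_as_sum_of_monoms'[of "coeff q j" m] assms by (simp add: bidegree_le_def)
    hence "monom (coeff q j) j = monom (\<Sum>i\<le>m. monom (coeff (coeff q j) i) i) j" by simp
    also have "\<dots> = (\<Sum>i\<le>m. monom (monom (coeff (coeff q j) i) i) j)"
      by (rule poly_eqI) (simp add: coeff_sum)
    finally have "monom (coeff q j) j = (\<Sum>i\<le>m. monom (monom (coeff (coeff q j) i) i) j)" .
    thus "monom (coeff q j) j = (\<Sum>i\<le>m. smult [:coeff (coeff q j) i:] (monom (monom 1 i) j))"
      by (simp add: smult_monom)
  qed
  also have "\<dots> = (\<Sum>i\<le>m. \<Sum>j\<le>n. smult [:coeff (coeff q j) i:] (monom (monom 1 i) j))"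
    by (rule sum.swap)
  finally show ?thesis by (simp add: sum.cartesian_product)
qed

lemma bidegree_le_sum:
  "(\<And>i. i \<in> A \<Longrightarrow> bidegree_le m n (q i)) \<Longrightarrow> bidegree_le m n (\<Sum>i\<in>A. q i)"
  by (induction A rule: infinite_finite_induct) (auto simp: bidegree_le_def intro: degree_add_le)

lemma bidegree_le_monom:
  "i \<le> m \<Longrightarrow> j \<le> n \<Longrightarrow> bidegree_le m n (smult [:c:] (monom (monom 1 i) j))"
  by (auto simp: bidegree_le_def smult_monom degree_monom_eq intro: order.trans[OF degree_monom_le])

section \<open>Splitting a polynomial over the nodes of a line\<close>

text \<open>Embeds real polynomials as polynomials in the outer variable \<open>y\<close> alone, so
  that univariate identities can be used in that direction as well.\<close>

definition const_coeffs :: "real poly \<Rightarrow> real poly poly" where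
  "const_coeffs p = map_poly (\<lambda>c. [:c:]) p"

lemma coeff_const_coeffs [simp]: "coeff (const_coeffs p) n = [:coeff p n:]"
  by (simp add: const_coeffs_def coeff_map_poly)

lemma const_poly_sum: "[:\<Sum>i\<in>A. f i:] = (\<Sum>i\<in>A. [:f i :: real:])"
  by (rule poly_eqI) (simp add: coeff_sum coeff_pCons split: nat.split)

lemma const_coeffs_mult: "const_coeffs (p * q) = const_coeffs p * const_coeffs q"
  by (rule poly_eqI) (simp add: coeff_mult const_poly_sum mult.commute)

lemma const_coeffs_sum: "const_coeffs (\<Sum>i\<in>A. p i) = (\<Sum>i\<in>A. const_coeffs (p i))"
  by (rule poly_eqI) (simp add: coeff_sum const_poly_sum)

lemma const_coeffs_hfac: "const_coeffs ([:- y, 1:] ^ f) = hfac f y"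
proof (induction f)
  case 0 show ?case by (rule poly_eqI) (auto simp: coeff_pCons one_pCons split: nat.split)
next
  case (Suc f)
  have "const_coeffs [:- y, 1:] = [:[:- y:], 1:]"
    by (rule poly_eqI) (auto simp: coeff_pCons one_pCons split: nat.split)
  thus ?case by (simp only: power_Suc const_coeffs_mult Suc)
qed

text \<open>After removal of the factor in \<open>y\<close>, the univariate splitting is applied to
  every coefficient, these being polynomials in \<open>x\<close>.\<close>

lemma fac_space_split_x:
  assumes S: "finite S" "d1 + 1 \<le> card S * (d1 + 1 - e)" and e: "e \<le> d1" "f \<le> d2"
    and p: "p \<in> fac_space d1 d2 0 x f y"
  shows "\<exists>r. (\<forall>s\<in>S. r s \<in> fac_space d1 d2 e s f y) \<and> p = (\<Sum>s\<in>S. r s)"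
proof -
  obtain q where q: "bidegree_le d1 (d2 - f) q" "p = hfac f y * q"
    using p fac_space_iff[of 0 d1 f d2] e by auto
  have "\<forall>j. \<exists>g. (\<forall>s\<in>S. degree (g s) \<le> d1 - e) \<and> coeff q j = (\<Sum>s\<in>S. [:- s, 1:] ^ e * g s)"
    by (intro allI span_shifted_powers[OF S(1) e(1) S(2)]) (use q(1) in \<open>simp add: bidegree_le_def\<close>)
  then have "\<exists>g. \<forall>j. (\<forall>s\<in>S. degree (g j s) \<le> d1 - e) \<and> coeff q j = (\<Sum>s\<in>S. [:- s, 1:] ^ e * g j s)"
    by (rule choice)
  then obtain g where "\<forall>j. (\<forall>s\<in>S. degree (g j s) \<le> d1 - e) \<and> coeff q j
    = (\<Sum>s\<in>S. [:- s, 1:] ^ e * g j s)"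
    by (elim exE)
  then have g: "\<And>j s. s \<in> S \<Longrightarrow> degree (g j s) \<le> d1 - e"
    "\<And>j. coeff q j = (\<Sum>s\<in>S. [:- s, 1:] ^ e * g j s)" by simp_all
  let ?r = "\<lambda>s. vfac e s * hfac f y * (\<Sum>j\<le>d2 - f. monom (g j s) j)"
  have "q = (\<Sum>j\<le>d2 - f. monom (coeff q j) j)"
    using poly_as_sum_of_monoms'[of q "d2 - f"] q(1) by (simp add: bidegree_le_def)
  also have "\<dots> = (\<Sum>j\<le>d2 - f. \<Sum>s\<in>S. vfac e s * monom (g j s) j)"
  proof (intro sum.cong refl)
    fix j show "monom (coeff q j) j = (\<Sum>s\<in>S. vfac e s * monom (g j s) j)"
      unfolding vfac_eq g(2)[of j] by (rule poly_eqI) (simp add: coeff_sum)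
  qed
  also have "\<dots> = (\<Sum>s\<in>S. vfac e s * (\<Sum>j\<le>d2 - f. monom (g j s) j))"
    by (subst sum.swap) (simp add: sum_distrib_left)
  finally have "p = (\<Sum>s\<in>S. hfac f y * (vfac e s * (\<Sum>j\<le>d2 - f. monom (g j s) j)))"
    unfolding q(2) by (simp only: sum_distrib_left)
  hence "p = (\<Sum>s\<in>S. ?r s)" by (simp only: ac_simps)
  moreover have "?r s \<in> fac_space d1 d2 e s f y" if s: "s \<in> S" for s
  proof -
    have "bidegree_le (d1 - e) (d2 - f) (\<Sum>j\<le>d2 - f. monom (g j s) j)"
      using g(1)[OF s] by (intro bidegree_le_sum)
        (auto simp: bidegree_le_def intro: order.trans[OF degree_monom_le])
    thus ?thesis unfolding fac_space_iff[OF e] by blast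
  qed
  ultimately show ?thesis by (intro exI[of _ ?r] conjI ballI) assumption+
qed

text \<open>The coefficients are polynomials in the other variable here. Instead each monomial
  \<open>monom 1 j\<close> is split as a real polynomial, lifted by \<open>const_coeffs\<close> and
  multiplied by the coefficient of \<open>q\<close> at \<open>j\<close>.\<close>

lemma fac_space_split_y:
  assumes S: "finite S" "d2 + 1 \<le> card S * (d2 + 1 - f)" and e: "e \<le> d1" "f \<le> d2"
    and p: "p \<in> fac_space d1 d2 e x 0 y"
  shows "\<exists>r. (\<forall>s\<in>S. r s \<in> fac_space d1 d2 e x f s) \<and> p = (\<Sum>s\<in>S. r s)"
proof -
  obtain q where q: "bidegree_le (d1 - e) d2 q" "p = vfac e x * q"
    using p fac_space_iff[of e d1 0 d2] e by auto
  have "\<forall>j. \<exists>g. j \<le> d2 \<longrightarrow> (\<forall>s\<in>S. degree (g s) \<le> d2 - f) \<and> monom 1 j = (\<Sum>s\<in>S. [:- s, 1:] ^ f * g s)"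
    using span_shifted_powers[OF S(1) e(2) S(2)] by (simp add: degree_monom_eq)
  then have "\<exists>g. \<forall>j. j \<le> d2 \<longrightarrow> (\<forall>s\<in>S. degree (g j s) \<le> d2 - f) \<and> monom 1 j
    = (\<Sum>s\<in>S. [:- s, 1:] ^ f * g j s)"
    by (rule choice)
  then obtain g where "\<forall>j. j \<le> d2 \<longrightarrow> (\<forall>s\<in>S. degree (g j s) \<le> d2 - f) \<and> monom 1 j
    = (\<Sum>s\<in>S. [:- s, 1:] ^ f * g j s)"
    by (elim exE)
  then have g: "\<And>j s. j \<le> d2 \<Longrightarrow> s \<in> S \<Longrightarrow> degree (g j s) \<le> d2 - f"
    "\<And>j. j \<le> d2 \<Longrightarrow> monom 1 j = (\<Sum>s\<in>S. [:- s, 1:] ^ f * g j s)" by simp_all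
  let ?q = "\<lambda>s. \<Sum>j\<le>d2. smult (coeff q j) (const_coeffs (g j s))"
  let ?r = "\<lambda>s. vfac e x * hfac f s * ?q s"
  have "q = (\<Sum>j\<le>d2. monom (coeff q j) j)"
    using poly_as_sum_of_monoms'[of q "d2"] q(1) by (simp add: bidegree_le_def)
  also have "\<dots> = (\<Sum>j\<le>d2. \<Sum>s\<in>S. hfac f s * smult (coeff q j) (const_coeffs (g j s)))"
  proof (intro sum.cong refl)
    fix j assume j: "j \<in> {..d2}"
    have "monom (coeff q j) j = smult (coeff q j) (const_coeffs (monom 1 j))"
      by (rule poly_eqI) (auto simp: one_pCons)
    also have "\<dots> = smult (coeff q j) (\<Sum>s\<in>S. hfac f s * const_coeffs (g j s))"
      using j g(2)[of j] by (simp add: const_coeffs_sum const_coeffs_mult const_coeffs_hfac)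
    also have "\<dots> = (\<Sum>s\<in>S. hfac f s * smult (coeff q j) (const_coeffs (g j s)))"
      by (rule poly_eqI) (simp add: coeff_sum sum_distrib_left)
    finally show "monom (coeff q j) j = \<dots>" .
  qed
  also have "\<dots> = (\<Sum>s\<in>S. hfac f s * ?q s)"
    by (subst sum.swap) (simp only: sum_distrib_left)
  finally have qq: "q = (\<Sum>s\<in>S. hfac f s * ?q s)" .
  have "p = vfac e x * (\<Sum>s\<in>S. hfac f s * ?q s)" unfolding q(2) by (rule arg_cong[OF qq])
  also have "\<dots> = (\<Sum>s\<in>S. vfac e x * (hfac f s * ?q s))" by (rule sum_distrib_left)
  finally have "p = (\<Sum>s\<in>S. vfac e x * (hfac f s * ?q s))" .
  hence "p = (\<Sum>s\<in>S. ?r s)" by (simp only: ac_simps)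
  moreover have "?r s \<in> fac_space d1 d2 e x f s" if s: "s \<in> S" for s
  proof -
    have "bidegree_le (d1 - e) (d2 - f) (?q s)"
    proof (intro bidegree_le_sum)
      fix j assume "j \<in> {..d2}"
      then have "degree (g j s) \<le> d2 - f" using g(1) s by auto
      then have "degree (const_coeffs (g j s)) \<le> d2 - f"
        by (intro degree_le) (auto simp: coeff_eq_0)
      moreover have "degree (coeff q j * [:c:]) \<le> d1 - e" for c
        using q(1) by (auto simp: bidegree_le_def intro: order.trans[OF degree_mult_le])
      ultimately show "bidegree_le (d1 - e) (d2 - f) (smult (coeff q j) (const_coeffs (g j s)))"
        by (auto simp: bidegree_le_def intro: order.trans[OF degree_smult_le])
    qed
    thus ?thesis unfolding fac_space_iff[OF e] by blast
  qed
  ultimately show ?thesis by (intro exI[of _ ?r] conjI ballI) assumption+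
qed

section \<open>Dimensions of spaces of families of polynomials\<close>

text \<open>Reals act through constant polynomials \<open>[:r:]\<close>, as \<open>smult\<close>
  itself takes scalars in the polynomials in \<open>x\<close>. The index type stays free: cells,
  jump data and conditions all use it.\<close>

interpretation pf: vector_space "\<lambda>(r :: real) (\<phi> :: 'i \<Rightarrow> real poly poly) i. smult [:r:] (\<phi> i)"
  by unfold_locales (auto simp: fun_eq_iff poly_eq_iff algebra_simps)

lemma subspace_fac_space:
  assumes "p \<in> fac_space d1 d2 e x f y" "q \<in> fac_space d1 d2 e x f y"
  shows "p + q \<in> fac_space d1 d2 e x f y" "p - q \<in> fac_space d1 d2 e x f y"
  using assms unfolding fac_space_def bidegree_le_def
  by (auto intro: degree_add_le degree_diff_le)

lemma smult_in_fac_space: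
  "p \<in> fac_space d1 d2 e x f y \<Longrightarrow> smult [:r:] p \<in> fac_space d1 d2 e x f y"
  unfolding fac_space_def bidegree_le_def
  by (auto intro: dvd_smult order.trans[OF degree_smult_le])

lemma zero_in_fac_space [simp]: "0 \<in> fac_space d1 d2 e x f y"
  by (simp add: fac_space_def bidegree_le_def)

lemma sum_in_fac_space:
  "(\<And>i. i \<in> A \<Longrightarrow> p i \<in> fac_space d1 d2 e x f y) \<Longrightarrow> (\<Sum>i\<in>A. p i) \<in> fac_space d1 d2 e x f y"
  by (induction A rule: infinite_finite_induct) (auto intro: subspace_fac_space)

text \<open>Extension by 0 outside \<open>I\<close> makes these families a subspace of a full
  function space.\<close>

definition fam_space :: "'i set \<Rightarrow> ('i \<Rightarrow> real poly poly set) \<Rightarrow> ('i \<Rightarrow> real poly poly) set" where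
  "fam_space I B = {\<phi>. (\<forall>i\<in>I. \<phi> i \<in> B i) \<and> (\<forall>i. i \<notin> I \<longrightarrow> \<phi> i = 0)}"

lemma subspace_fam_space:
  "pf.subspace (fam_space I (\<lambda>i. fac_space d1 d2 (e i) (x i) (f i) (y i)))"
  by (rule pf.subspaceI) (simp_all add: fam_space_def subspace_fac_space smult_in_fac_space)

text \<open>The basis consists, for each index, of the monomials of the reduced bidegree times the
  factors of that index. The finite spanning set is what rank-nullity asks for.\<close>

lemma dim_fam_space:
  assumes I: "finite I" and ef: "\<And>i. i \<in> I \<Longrightarrow> e i \<le> d1" "\<And>i. i \<in> I \<Longrightarrow> f i \<le> d2"
  shows "pf.dim (fam_space I (\<lambda>i. fac_space d1 d2 (e i) (x i) (f i) (y i))) =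
     (\<Sum>i\<in>I. (d1 + 1 - e i) * (d2 + 1 - f i))" (is "pf.dim ?V = _")
    and "\<exists>A. finite A \<and> fam_space I (\<lambda>i. fac_space d1 d2 (e i) (x i) (f i) (y i)) \<subseteq> pf.span A"
proof -
  define J where "J = (SIGMA i:I. {..d1 - e i} \<times> {..d2 - f i})"
  define b where "b j i = (if i = fst j then vfac (e i) (x i) * hfac (f i) (y i) * monom
    (monom 1 (fst (snd j))) (snd (snd j)) else 0)"
    for j :: "'a \<times> nat \<times> nat" and i
  have J: "finite J" using I by (auto simp: J_def)
  define comb where "comb c = (\<Sum>j\<in>J. (\<lambda>i. smult [:c j:] (b j i)))" for c :: "'a \<times> nat \<times> nat \<Rightarrow> real"
  have comb: "comb c i = (if i \<in> I then vfac (e i) (x i) * hfac (f i) (y i) *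
      (\<Sum>(m, n)\<in>{..d1 - e i} \<times> {..d2 - f i}. smult [:c (i, m, n):] (monom (monom 1 m) n)) else 0)"
        for c i
  proof -
    have "comb c i = (\<Sum>j\<in>J. smult [:c j:] (b j i))" unfolding comb_def
      by (induction J rule: infinite_finite_induct) auto
    also have "\<dots> = (\<Sum>i'\<in>I. \<Sum>(m, n)\<in>{..d1 - e i'} \<times> {..d2 - f i'}. smult [:c (i', m, n):]
      (b (i', m, n) i))"
      unfolding J_def by (subst sum.Sigma) (auto simp: I case_prod_unfold)
    also have "\<dots> = (\<Sum>i'\<in>I. if i = i' then
      (\<Sum>(m, n)\<in>{..d1 - e i} \<times> {..d2 - f i}. smult [:c (i, m, n):] (b (i, m, n) i)) else 0)"
    proof (intro sum.cong refl)
      fix i' show "(\<Sum>(m, n)\<in>{..d1 - e i'} \<times> {..d2 - f i'}. smult [:c (i', m, n):]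
        (b (i', m, n) i)) =
        (if i = i' then (\<Sum>(m, n)\<in>{..d1 - e i} \<times> {..d2 - f i}. smult [:c (i, m, n):]
          (b (i, m, n) i)) else 0)"
        by (cases "i = i'") (simp_all add: b_def case_prod_unfold)
    qed
    also have "\<dots> = (if i \<in> I then (\<Sum>(m, n)\<in>{..d1 - e i} \<times> {..d2 - f i}. smult [:c (i, m, n):]
      (b (i, m, n) i)) else 0)"
      using I by simp
    also have "\<dots> = (if i \<in> I then vfac (e i) (x i) * hfac (f i) (y i) *
      (\<Sum>(m, n)\<in>{..d1 - e i} \<times> {..d2 - f i}. smult [:c (i, m, n):] (monom (monom 1 m) n)) else 0)"
      unfolding sum_distrib_left by (rule if_cong[OF refl sum.cong[OF refl] refl])
        (auto simp: b_def)
    finally show ?thesis .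
  qed
  have V: "?V = range comb"
  proof (intro set_eqI iffI)
    fix \<phi> assume "\<phi> \<in> ?V"
    then have \<phi>: "\<And>i. i \<in> I \<Longrightarrow> \<exists>q. bidegree_le (d1 - e i) (d2 - f i) q \<and> \<phi> i
      = vfac (e i) (x i) * hfac (f i) (y i) * q"
       "\<And>i. i \<notin> I \<Longrightarrow> \<phi> i = 0" using ef by (auto simp: fam_space_def fac_space_iff)
    then have "\<forall>i. \<exists>q. i \<in> I \<longrightarrow> bidegree_le (d1 - e i) (d2 - f i) q \<and> \<phi> i
      = vfac (e i) (x i) * hfac (f i) (y i) * q"
      by blast
    from choice[OF this] obtain q where "\<forall>i. i \<in> I \<longrightarrow> bidegree_le (d1 - e i) (d2 - f i) (q i) \<and>
        \<phi> i = vfac (e i) (x i) * hfac (f i) (y i) * q i"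
      by (elim exE)
    then have q: "\<And>i. i \<in> I \<Longrightarrow> bidegree_le (d1 - e i) (d2 - f i) (q i)"
       "\<And>i. i \<in> I \<Longrightarrow> \<phi> i = vfac (e i) (x i) * hfac (f i) (y i) * q i" by simp_all
    have "\<phi> = comb (\<lambda>(i, m, n). coeff (coeff (q i) n) m)"
      using \<phi>(2) q(2) bidegree_le_expand[OF q(1)] by (auto simp: comb fun_eq_iff)
    thus "\<phi> \<in> range comb" by blast
  next
    fix \<phi> assume "\<phi> \<in> range comb"
    then obtain c where c: "\<phi> = comb c" by blast
    have "bidegree_le (d1 - e i) (d2 - f i)
      (\<Sum>(m, n)\<in>{..d1 - e i} \<times> {..d2 - f i}. smult [:c (i, m, n):] (monom (monom 1 m) n))" for i
      by (intro bidegree_le_sum) (auto intro: bidegree_le_monom)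
    thus "\<phi> \<in> ?V" using ef unfolding c fam_space_def by (auto simp: comb fac_space_iff)
  qed
  have "pf.dim ?V = card J"
  proof (rule pf.dim_eq_card_family[OF J, of _ b])
    show "?V = range (\<lambda>c. \<Sum>j\<in>J. (\<lambda>i. smult [:c j:] (b j i)))" using V unfolding comb_def .
  next
    fix c assume "(\<Sum>j\<in>J. (\<lambda>i. smult [:c j:] (b j i))) = 0"
    then have 0: "comb c i = 0" for i unfolding comb_def by simp
    show "\<forall>j\<in>J. c j = 0"
    proof
      fix j assume "j \<in> J"
      then obtain i m n where j: "j = (i, m, n)" "i \<in> I" "m \<le> d1 - e i" "n \<le> d2 - f i"
        by (auto simp: J_def)
      let ?s = "\<Sum>(m, n)\<in>{..d1 - e i} \<times> {..d2 - f i}. smult [:c (i, m, n):] (monom (monom 1 m) n)"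
      have "?s = 0" using 0[of i] j(2) by (simp add: comb)
      hence "coeff (coeff ?s n) m = 0" by simp
      moreover have "coeff (coeff ?s n) m
        = (\<Sum>p\<in>{..d1 - e i} \<times> {..d2 - f i}. if p = (m, n) then c (i, m, n) else 0)"
        unfolding coeff_sum by (intro sum.cong) (auto split: if_splits)
      ultimately show "c j = 0" using j by simp
    qed
  qed
  also have "card J = (\<Sum>i\<in>I. card ({..d1 - e i} \<times> {..d2 - f i}))" unfolding J_def
    by (rule card_SigmaI) (auto simp: I)
  also have "\<dots> = (\<Sum>i\<in>I. (d1 + 1 - e i) * (d2 + 1 - f i))"
    using ef by (intro sum.cong) (auto simp: card_cartesian_product Suc_diff_le)
  finally show "pf.dim ?V = (\<Sum>i\<in>I. (d1 + 1 - e i) * (d2 + 1 - f i))" .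
  have "?V \<subseteq> pf.span (b ` J)"
    unfolding V comb_def by (intro image_subsetI)
      (rule pf.span_sum, rule pf.span_scale, rule pf.span_base, simp)
  thus "\<exists>A. finite A \<and> ?V \<subseteq> pf.span A" using J by blast
qed

section \<open>Cells, edges and l-edges\<close>

fun flip :: "orientation \<Rightarrow> orientation" where
  "flip Horizontal = Vertical"
| "flip Vertical = Horizontal"

lemma flip_flip [simp]: "flip (flip k) = k" by (cases k) auto

lemma flip_neq [simp]: "flip k \<noteq> k" "k \<noteq> flip k" by (cases k; simp)+

lemma neq_iff_flip: "k' \<noteq> k \<longleftrightarrow> k' = flip k" by (cases k; cases k') auto

lemma pt_flip [simp]: "pt (flip k) t c = pt k c t" by (cases k) auto

lemma pt_eq_iff [simp]: "pt k t c = pt k t' c' \<longleftrightarrow> t = t' \<and> c = c'" by (cases k) auto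

lemma pt_exhaust: obtains t c where "z = pt k t c"
proof (cases k)
  case Horizontal thus ?thesis using that[of "fst z" "snd z"] by simp
next
  case Vertical thus ?thesis using that[of "snd z" "fst z"] by simp
qed

lemma pt_in_seg [simp]: "pt k t c \<in> seg k a b c' \<longleftrightarrow> c = c' \<and> a \<le> t \<and> t \<le> b"
  by (auto simp: seg_def)

lemma seg_subset_iff: "a \<le> b \<Longrightarrow> seg k a b c \<subseteq> seg k a' b' c \<longleftrightarrow> a' \<le> a \<and> b \<le> b'"
  by (auto simp: seg_def image_subset_iff)

text \<open>A cell is a bare point set, so its sides are recovered from its projections. The
  orientation names the coordinate that varies along it: x for \<open>Horizontal\<close>, y for
  \<open>Vertical\<close>.\<close>

fun lo :: "orientation \<Rightarrow> cell \<Rightarrow> real" where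
  "lo Horizontal F = Inf (fst ` F)"
| "lo Vertical F = Inf (snd ` F)"

fun hi :: "orientation \<Rightarrow> cell \<Rightarrow> real" where
  "hi Horizontal F = Sup (fst ` F)"
| "hi Vertical F = Sup (snd ` F)"

declare lo.simps [simp del] hi.simps [simp del]

text \<open>For small positive \<open>h\<close>, the point \<open>t + h\<close> (or
  \<open>t - h\<close> if \<open>s\<close> is false) lies strictly between \<open>a\<close> and
  \<open>b\<close>. The half-open form selects at most one of two abutting intervals.\<close>

definition side :: "bool \<Rightarrow> real \<Rightarrow> real \<Rightarrow> real \<Rightarrow> bool" where
  "side s a b t \<longleftrightarrow> (if s then a \<le> t \<and> t < b else a < t \<and> t \<le> b)"

lemma side_simps [simp]: "side True a b t \<longleftrightarrow> a \<le> t \<and> t < b" "side False a b t \<longleftrightarrow> a < t \<and> t \<le> b"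
  by (auto simp: side_def)

text \<open>\<open>F\<close> contains the germ at \<open>pt k t c\<close> of one of the four quadrants: \<open>s\<close> and \<open>r\<close> are its signs (\<open>True\<close>
  is positive) in the direction of \<open>k\<close> and in the orthogonal direction.\<close>

definition germ :: "orientation \<Rightarrow> bool \<Rightarrow> bool \<Rightarrow> real \<Rightarrow> real \<Rightarrow> cell \<Rightarrow> bool" where
  "germ k s r t c F \<longleftrightarrow> side s (lo k F) (hi k F) t \<and> side r (lo (flip k) F) (hi (flip k) F) c"

lemma germ_flip [simp]: "germ (flip k) s r t c F \<longleftrightarrow> germ k r s c t F"
  by (auto simp: germ_def)

section \<open>Cells as boxes and the quadrants at a point\<close>

locale mesh =
  fixes T :: "cell set"
  assumes t_mesh: "t_mesh T"
begin

lemma finite_T: "finite T" and T_nonempty: "T \<noteq> {}"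
  using t_mesh by (auto simp: t_mesh_def)

lemma cell_box:
  assumes "F \<in> T"
  shows "F = {lo Horizontal F..hi Horizontal F} \<times> {lo Vertical F..hi Vertical F}" "lo k F < hi k F"
proof -
  obtain a b c d where F: "a < b" "c < d" "F = {a..b} \<times> {c..d}"
    using t_mesh assms unfolding t_mesh_def by meson
  have "fst ` F = {a..b}" "snd ` F = {c..d}" using F by auto
  hence *: "lo Horizontal F = a" "hi Horizontal F = b" "lo Vertical F = c" "hi Vertical F = d"
    using F by (auto simp: lo.simps hi.simps)
  show "F = {lo Horizontal F..hi Horizontal F} \<times> {lo Vertical F..hi Vertical F}"
    unfolding * by (rule F(3))
  show "lo k F < hi k F" using * F by (cases k) auto
qed

lemma pt_in_cell:
  "F \<in> T \<Longrightarrow> pt k t c \<in> F \<longleftrightarrow> lo k F \<le> t \<and> t \<le> hi k F \<and> lo (flip k) F \<le> c \<and> c \<le> hi (flip k) F"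
  using cell_box(1)[of F] by (cases k) (auto simp: set_eq_iff)

lemma pt_in_corners:
  assumes F: "F \<in> T"
  shows "pt k t c \<in> corners F \<longleftrightarrow> t \<in> {lo k F, hi k F} \<and> c \<in> {lo (flip k) F, hi (flip k) F}"
proof -
  have "corners F = {lo Horizontal F, hi Horizontal F} \<times> {lo Vertical F, hi Vertical F}"
  proof (intro set_eqI iffI)
    fix v assume "v \<in> corners F"
    then obtain a b c d where abcd: "a < b" "c < d" "F = {a..b} \<times> {c..d}" "v \<in> {a, b} \<times> {c, d}"
      unfolding corners_def by blast
    have "fst ` F = {a..b}" "snd ` F = {c..d}" using abcd by auto
    thus "v \<in> {lo Horizontal F, hi Horizontal F} \<times> {lo Vertical F, hi Vertical F}"
      using abcd by (auto simp: lo.simps hi.simps)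
  next
    fix v assume "v \<in> {lo Horizontal F, hi Horizontal F} \<times> {lo Vertical F, hi Vertical F}"
    thus "v \<in> corners F" unfolding corners_def mem_Collect_eq
      using cell_box[OF F] by blast
  qed
  thus ?thesis by (cases k) auto
qed

lemma frontier_cell:
  assumes F: "F \<in> T"
  shows "pt k t c \<in> frontier F \<longleftrightarrow> pt k t c \<in> F
    \<and> \<not> (lo k F < t \<and> t < hi k F \<and> lo (flip k) F < c \<and> c < hi (flip k) F)"
proof -
  have "closed ({lo Horizontal F..hi Horizontal F} \<times> {lo Vertical F..hi Vertical F})"
    by (intro closed_Times) auto
  hence "frontier F = F - {lo Horizontal F<..<hi Horizontal F} \<times> {lo Vertical F<..<hi Vertical F}"
    unfolding frontier_def
    by (subst (1 2 3) cell_box(1)[OF F]) (simp add: interior_Times)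
  thus ?thesis by (cases k) auto
qed

lemma germ_exists: "F \<in> T \<Longrightarrow> pt k t c \<in> F \<Longrightarrow> \<exists>s r. germ k s r t c F"
  using cell_box(2)[of F k] cell_box(2)[of F "flip k"]
  by (auto simp: germ_def pt_in_cell ex_bool_eq)

text \<open>Overlapping open extents give a point in the interior of both cells, while distinct
  cells meet only in their frontiers.\<close>

lemma cell_overlap_eq:
  assumes "F \<in> T" "G \<in> T" "max (lo k F) (lo k G) < min (hi k F) (hi k G)"
    "max (lo (flip k) F) (lo (flip k) G) < min (hi (flip k) F) (hi (flip k) G)"
  shows "F = G"
proof (rule ccontr)
  assume ne: "F \<noteq> G"
  obtain t where t: "max (lo k F) (lo k G) < t" "t < min (hi k F) (hi k G)"
    using dense assms(3) by blast
  obtain c where c: "max (lo (flip k) F) (lo (flip k) G) < c"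
    "c < min (hi (flip k) F) (hi (flip k) G)"
    using dense assms(4) by blast
  have "pt k t c \<in> F \<inter> G" using t c assms(1,2) by (auto simp: pt_in_cell)
  hence "pt k t c \<in> frontier F" using t_mesh ne assms(1,2) unfolding t_mesh_def by blast
  thus False using t c assms(1) by (auto simp: frontier_cell)
qed

lemma side_overlap: "side s a b t \<Longrightarrow> side s a' b' t \<Longrightarrow> max a a' < min b b'"
  by (cases s) auto

lemma germ_unique:
  assumes "F \<in> T" "G \<in> T" "germ k s r t c F" "germ k s r t c G"
  shows "F = G"
  using assms cell_overlap_eq[of F G k] side_overlap unfolding germ_def by blast

definition coords :: "orientation \<Rightarrow> real set" where
  "coords k = lo k ` T \<union> hi k ` T"

lemma finite_coords [simp]: "finite (coords k)"
  using finite_T by (simp add: coords_def)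

lemma coordsI: "F \<in> T \<Longrightarrow> lo k F \<in> coords k" "F \<in> T \<Longrightarrow> hi k F \<in> coords k"
  by (auto simp: coords_def)

text \<open>Replaces topology by combinatorics: interior points are recognised by their four
  quadrants, each of which is covered by at most one cell.\<close>

lemma interior_iff_germs:
  "pt k t c \<in> interior (mesh_domain T) \<longleftrightarrow> (\<forall>s r. \<exists>F\<in>T. germ k s r t c F)"
proof
  assume int: "pt k t c \<in> interior (mesh_domain T)"
  obtain e0 where e0: "e0 > 0" "ball (pt k t c) e0 \<subseteq> mesh_domain T"
    using int mem_interior by blast
  obtain e1 where e1: "e1 > 0" "\<forall>x\<in>coords k. x \<noteq> t \<longrightarrow> e1 \<le> dist t x"
    using finite_set_avoid[OF finite_coords] by blast
  obtain e2 where e2: "e2 > 0" "\<forall>x\<in>coords (flip k). x \<noteq> c \<longrightarrow> e2 \<le> dist c x"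
    using finite_set_avoid[OF finite_coords] by blast
  \<comment> \<open>The shift is short enough for both coordinates together to stay in the ball and
    to stop before the next side coordinate, so the cell found at the shifted point contains the
    whole quadrant germ.\<close>
  define e where "e = min (min e0 e1) e2 / 3"
  have e: "e > 0" "2 * e < e0" "e < e1" "e < e2" using e0 e1 e2 by (auto simp: e_def min_def)
  show "\<forall>s r. \<exists>F\<in>T. germ k s r t c F"
  proof (intro allI)
    fix s r
    define t' where "t' = (if s then t + e else t - e)"
    define c' where "c' = (if r then c + e else c - e)"
    have "dist (pt k t c) (pt k t' c') \<le> dist t t' + dist c c'"
      by (cases k) (auto simp: dist_Pair_Pair add.commute intro:
        order.trans[OF sqrt_sum_squares_le_sum_abs])
    also have "\<dots> < e0" using e by (auto simp: t'_def c'_def dist_real_def)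
    finally have "pt k t' c' \<in> mesh_domain T" using e0 by auto
    then obtain F where F: "F \<in> T" "pt k t' c' \<in> F" by (auto simp: mesh_domain_def)
    have "lo k F = t \<or> e1 \<le> \<bar>t - lo k F\<bar>" "hi k F = t \<or> e1 \<le> \<bar>t - hi k F\<bar>"
      "lo (flip k) F = c \<or> e2 \<le> \<bar>c - lo (flip k) F\<bar>" "hi (flip k) F = c \<or> e2 \<le> \<bar>c - hi (flip k) F\<bar>"
      using e1(2) e2(2) coordsI[OF F(1)] by (auto simp: dist_real_def)
    moreover have "lo k F \<le> t' \<and> t' \<le> hi k F \<and> lo (flip k) F \<le> c' \<and> c' \<le> hi (flip k) F"
      using F pt_in_cell by blast
    ultimately have "germ k s r t c F"
      unfolding germ_def t'_def c'_def using e by (cases s; cases r) auto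
    thus "\<exists>F\<in>T. germ k s r t c F" using F by blast
  qed
next
  assume g: "\<forall>s r. \<exists>F\<in>T. germ k s r t c F"
  obtain F where F: "\<And>s r. F s r \<in> T" "\<And>s r. germ k s r t c (F s r)" using g by metis
  \<comment> \<open>The innermost bounds of the four cells; the open box between them is covered by
    these cells.\<close>
  define a where "a = Max ((\<lambda>r. lo k (F False r)) ` UNIV)"
  define b where "b = Min ((\<lambda>r. hi k (F True r)) ` UNIV)"
  define a' where "a' = Max ((\<lambda>s. lo (flip k) (F s False)) ` UNIV)"
  define b' where "b' = Min ((\<lambda>s. hi (flip k) (F s True)) ` UNIV)"
  let ?U = "case k of Horizontal \<Rightarrow> {a<..<b} \<times> {a'<..<b'} | Vertical \<Rightarrow> {a'<..<b'} \<times> {a<..<b}"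
  have pU: "pt k x y \<in> ?U \<longleftrightarrow> a < x \<and> x < b \<and> a' < y \<and> y < b'" for x y
    by (cases k) auto
  have "open ?U" by (cases k) (auto intro: open_Times)
  moreover have "pt k t c \<in> ?U"
  proof -
    have "lo k (F False r) < t" "t < hi k (F True r)" for r
      using F(2)[of False r] F(2)[of True r] by (auto simp: germ_def)
    moreover have "lo (flip k) (F s False) < c" "c < hi (flip k) (F s True)" for s
      using F(2)[of s False] F(2)[of s True] by (auto simp: germ_def)
    ultimately show ?thesis unfolding pU unfolding a_def b_def a'_def b'_def
      by (simp add: UNIV_bool)
  qed
  moreover have "?U \<subseteq> mesh_domain T"
  proof
    fix z assume z: "z \<in> ?U"
    obtain x y where xy: "z = pt k x y" by (rule pt_exhaust)
    have *: "a < x" "x < b" "a' < y" "y < b'" using z unfolding xy pU by auto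
    define s where "s \<longleftrightarrow> t \<le> x"
    define r where "r \<longleftrightarrow> c \<le> y"
    have "lo k (F False r) < x" "x < hi k (F True r)" "lo (flip k) (F s False) < y"
      "y < hi (flip k) (F s True)"
      using * unfolding a_def b_def a'_def b'_def by auto
    hence "z \<in> F s r"
      using F(2)[of s r] unfolding xy pt_in_cell[OF F(1)] germ_def
      by (cases s; cases r) (auto simp: s_def r_def)
    thus "z \<in> mesh_domain T" using F(1) by (auto simp: mesh_domain_def)
  qed
  ultimately show "pt k t c \<in> interior (mesh_domain T)" by (rule interiorI)
qed

lemma closed_cell: "F \<in> T \<Longrightarrow> closed F"
  by (subst cell_box(1)) (auto intro: closed_Times)

lemma closed_domain: "closed (mesh_domain T)"
  unfolding mesh_domain_def using finite_T closed_cell by (intro closed_Union) auto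

lemma vertices_iff: "pt k t c \<in> vertices T \<longleftrightarrow>
    (\<exists>F\<in>T. t \<in> {lo k F, hi k F} \<and> c \<in> {lo (flip k) F, hi (flip k) F})"
  unfolding vertices_def using pt_in_corners by blast

lemma finite_vertices: "finite (vertices T)"
proof (rule finite_subset)
  show "vertices T \<subseteq> coords Horizontal \<times> coords Vertical"
  proof
    fix v assume "v \<in> vertices T"
    moreover obtain x y where "v = pt Horizontal x y" by (rule pt_exhaust)
    ultimately show "v \<in> coords Horizontal \<times> coords Vertical"
      using vertices_iff[of Horizontal x y] by (auto simp: coords_def)
  qed
qed simp

lemma vertex_in_domain: "v \<in> vertices T \<Longrightarrow> v \<in> mesh_domain T"
proof -
  assume v: "v \<in> vertices T"
  obtain x y where v': "v = pt Horizontal x y" by (rule pt_exhaust)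
  obtain F where "F \<in> T" "x \<in> {lo Horizontal F, hi Horizontal F}"
    "y \<in> {lo Vertical F, hi Vertical F}"
    using v unfolding v' vertices_iff by auto
  hence "v \<in> F" unfolding v' using cell_box(2)[of F Horizontal] cell_box(2)[of F Vertical]
    pt_in_cell[of F Horizontal]
    by auto
  thus ?thesis using \<open>F \<in> T\<close> by (auto simp: mesh_domain_def)
qed

lemma interior_vertices_iff:
  "pt k t c \<in> interior_vertices T \<longleftrightarrow> pt k t c \<in> vertices T \<and> (\<forall>s r. \<exists>F\<in>T. germ k s r t c F)"
  unfolding interior_iff_germs[symmetric] interior_vertices_def frontier_def
  using vertex_in_domain[of "pt k t c"] by (auto simp: closure_closed[OF closed_domain])

lemma not_interior_vertex_iff:
  "v \<in> vertices T \<Longrightarrow> v \<in> boundary_vertices T \<longleftrightarrow> v \<notin> interior_vertices T"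
  by (auto simp: boundary_vertices_def interior_vertices_def)

end

section \<open>Interior edges as common sides of two cells\<close>

context mesh begin

text \<open>The order is fixed: \<open>F\<close> lies above a horizontal and to the right of a
  vertical line, so that \<open>P F - P G\<close> is a signed jump. \<open>a\<close> and
  \<open>b\<close> bound the entire common side.\<close>

definition adj :: "orientation \<Rightarrow> cell \<Rightarrow> cell \<Rightarrow> real \<Rightarrow> real \<Rightarrow> real \<Rightarrow> bool" where
  "adj k F G a b c \<longleftrightarrow> F \<in> T \<and> G \<in> T \<and> lo (flip k) F = c \<and> hi (flip k) G = c \<and>
     a = max (lo k F) (lo k G) \<and> b = min (hi k F) (hi k G) \<and> a < b"

lemma adjD: "adj k F G a b c \<Longrightarrow> F \<in> T" "adj k F G a b c \<Longrightarrow> G \<in> T" "adj k F G a b c \<Longrightarrow> a < b"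
  by (auto simp: adj_def)

lemma adj_neq: "adj k F G a b c \<Longrightarrow> F \<noteq> G"
  unfolding adj_def using cell_box(2)[of F "flip k"] by auto

lemma adj_germ:
  assumes "adj k F G a b c" "side s a b t"
  shows "germ k s True t c F" "germ k s False t c G"
  using assms cell_box(2)[of F "flip k"] cell_box(2)[of G "flip k"] unfolding adj_def germ_def
  by (cases s; auto)+

lemma germ_adj:
  assumes "F \<in> T" "G \<in> T" "germ k s True t c F" "germ k s False t c G" "F \<noteq> G"
  shows "\<exists>a b. adj k F G a b c \<and> side s a b t"
proof -
  have "lo (flip k) F = c"
  proof (rule ccontr)
    assume "lo (flip k) F \<noteq> c"
    then have "germ k s False t c F" using assms(3) by (auto simp: germ_def)
    thus False using germ_unique assms by blast
  qed
  moreover have "hi (flip k) G = c"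
  proof (rule ccontr)
    assume "hi (flip k) G \<noteq> c"
    then have "germ k s True t c G" using assms(4) by (auto simp: germ_def)
    thus False using germ_unique assms by blast
  qed
  moreover have "max (lo k F) (lo k G) < min (hi k F) (hi k G)"
    using assms(3,4) side_overlap unfolding germ_def by blast
  moreover have "side s (max (lo k F) (lo k G)) (min (hi k F) (hi k G)) t"
    using assms(3,4) unfolding germ_def by (cases s) auto
  ultimately show ?thesis using assms(1,2) unfolding adj_def by blast
qed

lemma adj_germ_cell:
  assumes adj: "adj k F G a b c" and s: "side s a b t" and H: "H \<in> T" "germ k s r t c H"
  shows "H = (if r then F else G)"
proof (cases r)
  case True
  with germ_unique[OF H(1) adjD(1)[OF adj] _ adj_germ(1)[OF adj s]] H show ?thesis by simp
next
  case False
  with germ_unique[OF H(1) adjD(2)[OF adj] _ adj_germ(2)[OF adj s]] H show ?thesis by simp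
qed

lemma adj_seg_subset: "adj k F G a b c \<Longrightarrow> seg k a b c \<subseteq> F \<inter> G"
  using cell_box(2)[of F "flip k"] cell_box(2)[of G "flip k"]
  by (auto simp: seg_def adj_def pt_in_cell)

text \<open>A vertex strictly inside would be a corner of a cell with a quadrant there; that
  quadrant belongs to \<open>F\<close> or \<open>G\<close>, and neither has a corner strictly
  between \<open>a\<close> and \<open>b\<close>.\<close>

lemma adj_no_vertex:
  assumes adj: "adj k F G a b c" and t: "a < t" "t < b"
  shows "pt k t c \<notin> vertices T"
proof
  assume "pt k t c \<in> vertices T"
  then obtain H where H: "H \<in> T" "t \<in> {lo k H, hi k H}" "c \<in> {lo (flip k) H, hi (flip k) H}"
    unfolding vertices_iff by blast
  obtain s r where sr: "germ k s r t c H"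
    using H cell_box(2)[OF H(1), of k] cell_box(2)[OF H(1), of "flip k"] germ_exists[of H k t c]
    by (auto simp: pt_in_cell)
  have "side s a b t" using t by (cases s) auto
  from adj_germ_cell[OF adj this H(1) sr] have "H = F \<or> H = G" by (auto split: if_splits)
  thus False using H t adj unfolding adj_def by auto
qed

lemma adj_vertices:
  assumes adj: "adj k F G a b c"
  shows "pt k a c \<in> vertices T" "pt k b c \<in> vertices T"
  using assms unfolding vertices_iff adj_def by (auto simp: max_def min_def)

lemma adj_interior:
  assumes "adj k F G a b c" "a < t" "t < b"
  shows "pt k t c \<in> interior (mesh_domain T)"
  unfolding interior_iff_germs
proof (intro allI)
  fix s r
  have "side s a b t" using assms by (cases s) auto
  from adj_germ[OF assms(1) this] show "\<exists>F\<in>T. germ k s r t c F"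
    using adjD[OF assms(1)] by (cases r) auto
qed

text \<open>Bridge from the topological definition to pairs of cells. The hard direction needs a
  second cell across the edge, found at a point of the edge that is interior to the domain.\<close>

lemma interior_edge_iff: "interior_edge T k a b c \<longleftrightarrow> (\<exists>F G. adj k F G a b c)"
proof
  assume "\<exists>F G. adj k F G a b c"
  then obtain F G where adj: "adj k F G a b c" by blast
  have "seg k a b c \<subseteq> frontier F"
  proof
    fix z assume z: "z \<in> seg k a b c"
    then obtain t where t: "z = pt k t c" by (auto simp: seg_def)
    show "z \<in> frontier F"
      using adj_seg_subset[OF adj] z adj unfolding t
        by (auto simp: frontier_cell[OF adjD(1)[OF adj]] adj_def)
  qed
  moreover obtain t where t: "a < t" "t < b" using adjD(3)[OF adj] dense by blast
  have "pt k t c \<in> seg k a b c - frontier (mesh_domain T)"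
    using t adj_interior[OF adj t] by (auto simp: frontier_def)
  ultimately show "interior_edge T k a b c"
    unfolding interior_edge_def mesh_edge_def
    using adjD[OF adj] adj_vertices[OF adj] adj_no_vertex[OF adj] by blast
next
  assume "interior_edge T k a b c"
  then have ab: "a < b" and va: "pt k a c \<in> vertices T" and vb: "pt k b c \<in> vertices T"
    and nov: "\<And>t. a < t \<Longrightarrow> t < b \<Longrightarrow> pt k t c \<notin> vertices T"
    and ex: "\<exists>F\<in>T. seg k a b c \<subseteq> frontier F"
    and nf: "\<not> seg k a b c \<subseteq> frontier (mesh_domain T)"
    unfolding interior_edge_def mesh_edge_def by auto
  obtain F where F: "F \<in> T" "seg k a b c \<subseteq> frontier F" using ex by blast
  have fr: "pt k t c \<in> F \<and> \<not> (lo k F < t \<and> t < hi k F \<and> lo (flip k) F < c \<and> c < hi (flip k) F)"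
    if "a \<le> t" "t \<le> b" for t
    using subsetD[OF F(2), of "pt k t c"] that frontier_cell[OF F(1), of k t c] by simp
  have Fab: "lo k F \<le> a" "b \<le> hi k F" "lo (flip k) F \<le> c" "c \<le> hi (flip k) F"
    using fr[of a] fr[of b] ab by (auto simp: pt_in_cell[OF F(1)])
  have "c = lo (flip k) F \<or> c = hi (flip k) F"
    using fr[of "(a + b) / 2"] Fab ab by (auto simp: pt_in_cell[OF F(1)])
  then obtain r where r: "if r then c = lo (flip k) F else c = hi (flip k) F" by metis
  obtain z where z: "z \<in> seg k a b c" "z \<notin> frontier (mesh_domain T)" using nf by blast
  obtain t where t: "z = pt k t c" "a \<le> t" "t \<le> b" using z(1) by (auto simp: seg_def)
  have "z \<in> interior (mesh_domain T)"
    using z(2) fr[OF t(2,3)] F(1) closure_subset[of "mesh_domain T"]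
      unfolding t frontier_def mesh_domain_def by auto
  then have germs: "\<forall>s r. \<exists>F\<in>T. germ k s r t c F" unfolding t interior_iff_germs .
  \<comment> \<open>The interior point may be an end of the edge; \<open>s\<close> points from it
    into the edge.\<close>
  define s where "s \<longleftrightarrow> t < b"
  have s: "side s a b t" using t ab by (auto simp: s_def side_def)
  have gF: "germ k s r t c F"
    using r s Fab ab cell_box(2)[OF F(1), of "flip k"] unfolding germ_def
      by (cases s; cases r; auto)
  obtain G where G: "G \<in> T" "germ k s (\<not> r) t c G" using germs by blast
  have "F \<noteq> G" using G(2) r by (cases r) (auto simp: germ_def)
  have key: "\<exists>a' b'. adj k F' G' a' b' c \<and> side s a' b' t" if "{F', G'} = {F, G}"
    "germ k s True t c F'" "germ k s False t c G'" for F' G'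
    using germ_adj[of F' G' k s t c] that \<open>F \<noteq> G\<close> F(1) G(1)
      by (metis insertE insertI1 insert_commute singletonD)
  have "\<exists>F' G' a' b'. adj k F' G' a' b' c \<and> side s a' b' t \<and> (F = F' \<or> F = G')"
  proof (cases r)
    case True thus ?thesis using key[of F G] gF G(2) by auto
  next
    case False thus ?thesis using key[of G F] gF G(2) by auto
  qed
  then obtain F' G' a' b' where adj: "adj k F' G' a' b' c" "side s a' b' t" "F = F' \<or> F = G'"
    by blast
  \<comment> \<open>Neither interval has an end of the other strictly inside, since these ends are
    vertices.\<close>
  have "a' = a"
  proof (rule antisym)
    show "a' \<le> a"
      using nov[of a'] adj_vertices(1)[OF adj(1)] adj(2) s
        by (cases s) (auto simp: not_less intro: leI)
    show "a \<le> a'"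
      using adj_no_vertex[OF adj(1), of a] va adj(2) s by (cases s) (auto intro: leI)
  qed
  moreover have "b' = b"
  proof (rule antisym)
    show "b \<le> b'"
      using nov[of b'] adj_vertices(2)[OF adj(1)] adj(2) s
        by (cases s) (auto simp: not_less intro: leI)
    show "b' \<le> b"
      using adj_no_vertex[OF adj(1), of b] vb adj(2) s by (cases s) (auto intro: leI)
  qed
  ultimately show "\<exists>F G. adj k F G a b c" using adj(1) by blast
qed

lemma adj_cells:
  assumes adj: "adj k F G a b c" and H: "H \<in> T" "seg k a b c \<subseteq> H"
  shows "H = F \<or> H = G"
proof -
  obtain t where t: "a < t" "t < b" using adjD(3)[OF adj] dense by blast
  have "pt k t c \<in> H" using H(2) t by fastforce
  then obtain s r where sr: "germ k s r t c H" using germ_exists[OF H(1)] by blast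
  have "side s a b t" using t by (cases s) auto
  from adj_germ_cell[OF adj this H(1) sr] show "H = F \<or> H = G" by (auto split: if_splits)
qed

text \<open>Each pair of cells in the smoothness condition can be brought into the order of
  \<open>adj\<close>; the reversed difference changes only by a sign.\<close>

lemma spline_pieces_iff:
  "spline_pieces d1 d2 \<alpha> \<beta> T P \<longleftrightarrow> (\<forall>F\<in>T. bidegree_le d1 d2 (P F)) \<and>
     (\<forall>k F G a b c. adj k F G a b c \<longrightarrow> smoothness_factor \<alpha> \<beta> k c dvd P F - P G)"
proof -
  have *: "(\<forall>F\<in>T. \<forall>G\<in>T. interior_edge T k a b c \<and> F \<noteq> G \<and> seg k a b c \<subseteq> F \<inter> G \<longrightarrow>
        smoothness_factor \<alpha> \<beta> k c dvd P F - P G) \<longleftrightarrow>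
     (\<forall>F G. adj k F G a b c \<longrightarrow> smoothness_factor \<alpha> \<beta> k c dvd P F - P G)" (is "?l \<longleftrightarrow> ?r") for k a b c
  proof
    assume ?l thus ?r using adjD adj_neq adj_seg_subset interior_edge_iff by meson
  next
    assume r: ?r
    show ?l
    proof (intro ballI impI)
      fix F G assume *: "F \<in> T" "G \<in> T" "interior_edge T k a b c \<and> F \<noteq> G \<and> seg k a b c \<subseteq> F \<inter> G"
      then obtain F' G' where adj: "adj k F' G' a b c" using interior_edge_iff by blast
      hence "F = F' \<and> G = G' \<or> F = G' \<and> G = F'"
        using adj_cells[OF adj *(1)] adj_cells[OF adj *(2)] * by auto
      with r adj show "smoothness_factor \<alpha> \<beta> k c dvd P F - P G"
        by (metis dvd_minus_iff minus_diff_eq)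
    qed
  qed
  show ?thesis unfolding spline_pieces_def * by auto
qed

section \<open>Edges on a line and their maximal runs\<close>

definition edge_ints :: "orientation \<Rightarrow> real \<Rightarrow> (real \<times> real) set" where
  "edge_ints k c = {(a, b). interior_edge T k a b c}"

lemma edge_ints_adj: "(a, b) \<in> edge_ints k c \<longleftrightarrow> (\<exists>F G. adj k F G a b c)"
  by (auto simp: edge_ints_def interior_edge_iff)

lemma edge_intsD:
  assumes "(a, b) \<in> edge_ints k c"
  shows "a < b" "pt k a c \<in> vertices T" "pt k b c \<in> vertices T"
    "\<And>t. a < t \<Longrightarrow> t < b \<Longrightarrow> pt k t c \<notin> vertices T"
proof -
  obtain F G where adj: "adj k F G a b c" using assms edge_ints_adj by blast
  show "a < b" "pt k a c \<in> vertices T" "pt k b c \<in> vertices T" using adjD(3) adj_vertices adj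
    by auto
  show "\<And>t. a < t \<Longrightarrow> t < b \<Longrightarrow> pt k t c \<notin> vertices T" using adj_no_vertex adj by auto
qed

lemma finite_edge_ints: "finite (edge_ints k c)"
proof (rule finite_subset)
  let ?S = "{t. pt k t c \<in> vertices T}"
  show "edge_ints k c \<subseteq> ?S \<times> ?S" using edge_intsD by auto
  have "finite ?S" using finite_vimageI[OF finite_vertices, of "\<lambda>t. pt k t c"]
    by (auto simp: inj_on_def vimage_def)
  thus "finite (?S \<times> ?S)" by blast
qed

text \<open>Continuation of a line at a point. With this predicate and the next one, covering and
  maximality become statements about single points instead of sets of edges.\<close>

definition edge_after :: "orientation \<Rightarrow> real \<Rightarrow> real \<Rightarrow> bool" where
  "edge_after k t c \<longleftrightarrow> (\<exists>(a, b)\<in>edge_ints k c. a \<le> t \<and> t < b)"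

definition edge_before :: "orientation \<Rightarrow> real \<Rightarrow> real \<Rightarrow> bool" where
  "edge_before k t c \<longleftrightarrow> (\<exists>(a, b)\<in>edge_ints k c. a < t \<and> t \<le> b)"

lemma edge_afterE: assumes "edge_after k t c" obtains a b where "(a, b) \<in> edge_ints k c" "a \<le> t"
  "t < b"
  using assms unfolding edge_after_def by blast

lemma edge_beforeE: assumes "edge_before k t c" obtains a b where "(a, b) \<in> edge_ints k c" "a < t"
  "t \<le> b"
  using assms unfolding edge_before_def by blast

lemma edge_afterI: "(a, b) \<in> edge_ints k c \<Longrightarrow> a \<le> t \<Longrightarrow> t < b \<Longrightarrow> edge_after k t c"
  unfolding edge_after_def by blast

lemma edge_beforeI: "(a, b) \<in> edge_ints k c \<Longrightarrow> a < t \<Longrightarrow> t \<le> b \<Longrightarrow> edge_before k t c"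
  unfolding edge_before_def by blast

text \<open>Only finitely many edges lie on a line. So there is a last edge end before
  \<open>b\<close>, unless none follows \<open>t0\<close>, and the edge present after it must reach
  \<open>b\<close>.\<close>

lemma last_edge:
  assumes "t0 < b" "\<And>t. t0 \<le> t \<Longrightarrow> t < b \<Longrightarrow> edge_after k t c"
  obtains s s' where "(s, s') \<in> edge_ints k c" "s < b" "b \<le> s'"
proof -
  let ?E = "{s'. s' \<in> snd ` edge_ints k c \<and> s' < b}"
  have fin: "finite (insert t0 ?E)" using finite_edge_ints by simp
  define t where "t = Max (insert t0 ?E)"
  have "t \<in> insert t0 ?E" unfolding t_def by (rule Max_in[OF fin]) simp
  moreover have "t0 \<le> t" unfolding t_def using fin by (intro Max_ge) auto
  ultimately have t: "t0 \<le> t" "t < b" using assms(1) by auto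
  then obtain s s' where s: "(s, s') \<in> edge_ints k c" "s \<le> t" "t < s'"
    using edge_afterE[OF assms(2)] by metis
  have "\<not> s' < b"
  proof
    assume "s' < b"
    then have "s' \<in> insert t0 ?E" using s(1) by force
    from Max_ge[OF fin this] show False using s(3) unfolding t_def by simp
  qed
  thus ?thesis using that[OF s(1)] s t by auto
qed

lemma edge_before_if_edges:
  assumes "t0 < b" "\<And>t. t0 \<le> t \<Longrightarrow> t < b \<Longrightarrow> edge_after k t c"
  shows "edge_before k b c"
  using last_edge[OF assms] edge_beforeI by metis

text \<open>Covering by a union of edges is turned into continuation at each point, the form in
  which telescoping and maximality are argued.\<close>

lemma composed_segment_iff:
  "composed_segment T k a b c \<longleftrightarrow> a < b \<and> pt k a c \<in> vertices T \<and> pt k b c \<in> vertices T \<and>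
     (\<forall>t. a \<le> t \<and> t < b \<longrightarrow> edge_after k t c)"
proof
  assume "composed_segment T k a b c"
  then obtain E where ab: "a < b" and E: "E \<subseteq> edge_ints k c" "seg k a b c
    = (\<Union>(s, t)\<in>E. seg k s t c)"
    unfolding composed_segment_def edge_ints_def by blast
  have cov: "a \<le> t \<and> t \<le> b \<longleftrightarrow> (\<exists>(s, s')\<in>E. s \<le> t \<and> t \<le> s')" for t
  proof -
    have "pt k t c \<in> seg k a b c \<longleftrightarrow> pt k t c \<in> (\<Union>(s, t)\<in>E. seg k s t c)" using E(2) by simp
    thus ?thesis by (auto simp: case_prod_unfold)
  qed
  have inE: "a \<le> s \<and> s' \<le> b \<and> s < s'" if "(s, s') \<in> E" for s s'
    using cov[of s] cov[of s'] edge_intsD(1)[of s s'] that E(1) by force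
  have fin: "finite E" using E(1) finite_edge_ints finite_subset by blast
  obtain s s' where "(s, s') \<in> E" "s \<le> a" "a \<le> s'" using cov[of a] ab by auto
  with inE have "(a, s') \<in> E" by force
  hence va: "pt k a c \<in> vertices T" using E(1) edge_intsD(2) by blast
  obtain u u' where "(u, u') \<in> E" "u \<le> b" "b \<le> u'" using cov[of b] ab by auto
  with inE have "(u, b) \<in> E" by force
  hence vb: "pt k b c \<in> vertices T" using E(1) edge_intsD(3) by blast
  have "edge_after k t c" if t: "a \<le> t" "t < b" for t
  proof -
    \<comment> \<open>\<open>m\<close> is the next edge start after \<open>t\<close>, or
      \<open>b\<close>. A point strictly between \<open>t\<close> and \<open>m\<close> is covered by
      an edge that must have started at \<open>t\<close> or before.\<close>
    let ?S = "insert b {s \<in> fst ` E. t < s}"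
    have finS: "finite ?S" using fin by simp
    define m where "m = Min ?S"
    have "m \<in> ?S" unfolding m_def by (rule Min_in[OF finS]) simp
      moreover have "m \<le> b" unfolding m_def using finS by (intro Min_le) auto
    ultimately have m: "t < m" "m \<le> b" using t by auto
    then obtain p where p: "t < p" "p < m" using dense by blast
    then obtain s s' where s: "(s, s') \<in> E" "s \<le> p" "p \<le> s'" using cov[of p] t m by auto
    have "\<not> t < s"
    proof
      assume "t < s"
      then have "s \<in> ?S" using s(1) by force
      from Min_le[OF finS this] show False using s(2) p unfolding m_def by simp
    qed
    thus ?thesis using s p E(1) by (intro edge_afterI[of s s']) auto
  qed
  thus "a < b \<and> pt k a c \<in> vertices T \<and> pt k b c \<in> vertices T
    \<and> (\<forall>t. a \<le> t \<and> t < b \<longrightarrow> edge_after k t c)"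
    using ab va vb by blast
next
  assume *: "a < b \<and> pt k a c \<in> vertices T \<and> pt k b c \<in> vertices T
    \<and> (\<forall>t. a \<le> t \<and> t < b \<longrightarrow> edge_after k t c)"
  define E where "E = {(s, s') \<in> edge_ints k c. a \<le> s \<and> s' \<le> b}"
  have *: "a < b" "pt k a c \<in> vertices T" "pt k b c \<in> vertices T" "\<And>t. a \<le> t \<Longrightarrow> t < b
    \<Longrightarrow> edge_after k t c"
    using * by auto
  have inside: "(s, s') \<in> E" if "(s, s') \<in> edge_ints k c" "s < b" "a < s'" for s s'
    using edge_intsD(4)[OF that(1), of a] edge_intsD(4)[OF that(1), of b] * that unfolding E_def
    by (auto simp: not_less[symmetric])
  have "\<exists>(s, s')\<in>E. s \<le> t \<and> t \<le> s'" if t: "a \<le> t" "t \<le> b" for t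
  proof (cases "t < b")
    case True
    from *(4)[OF t(1) True] show ?thesis
    proof (rule edge_afterE)
      fix s s' assume s: "(s, s') \<in> edge_ints k c" "s \<le> t" "t < s'"
      then have "(s, s') \<in> E" using t True by (intro inside) auto
      thus ?thesis using s by (intro bexI[of _ "(s, s')"]) auto
    qed
  next
    case False
    then have tb: "t = b" using t by simp
    obtain s s' where s: "(s, s') \<in> edge_ints k c" "s < b" "b \<le> s'" using last_edge[OF *(1,4)]
      by metis
    then have "(s, s') \<in> E" using *(1) by (intro inside) auto
    thus ?thesis using s tb by (intro bexI[of _ "(s, s')"]) auto
  qed
  hence "seg k a b c = (\<Union>(s, t)\<in>E. seg k s t c)"
    by (fastforce simp: seg_def E_def)
  moreover have "E \<subseteq> {(s, t). interior_edge T k s t c}" by (auto simp: E_def edge_ints_def)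
  ultimately show "composed_segment T k a b c" unfolding composed_segment_def using *(1) by blast
qed

text \<open>Maximality among all composed segments is local: a longer segment would continue across
  \<open>a\<close> or \<open>b\<close>, and conversely an edge just before \<open>a\<close> or just
  after \<open>b\<close> extends the segment.\<close>

lemma l_edge_iff:
  "l_edge T k a b c \<longleftrightarrow> a < b \<and> (\<forall>t. a \<le> t \<and> t < b \<longrightarrow> edge_after k t c) \<and> \<not> edge_before k a c
    \<and> \<not> edge_after k b c"
proof
  assume l: "l_edge T k a b c"
  then have cs: "composed_segment T k a b c" by (simp add: l_edge_def)
  note ab = cs[unfolded composed_segment_iff]
  have max: "a' = a \<and> b' = b" if "composed_segment T k a' b' c" "a' \<le> a" "b \<le> b'" for a' b'
    using l that ab seg_subset_iff[of a b k c a' b'] unfolding l_edge_def by simp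
  have "\<not> edge_before k a c"
  proof
    assume "edge_before k a c"
    then obtain s s' where s: "(s, s') \<in> edge_ints k c" "s < a" "a \<le> s'" by (rule edge_beforeE)
    have "s' = a" using edge_intsD(4)[OF s(1,2)] s(3) ab by fastforce
    have "composed_segment T k s b c" unfolding composed_segment_iff
    proof (intro conjI allI impI)
      fix t assume t: "s \<le> t \<and> t < b"
      show "edge_after k t c" using edge_afterI[OF s(1), of t] t ab \<open>s' = a\<close> by (cases "t < a") auto
    qed (use s ab edge_intsD[OF s(1)] in auto)
    from max[OF this] s show False by auto
  qed
  moreover have "\<not> edge_after k b c"
  proof
    assume "edge_after k b c"
    then obtain s s' where s: "(s, s') \<in> edge_ints k c" "s \<le> b" "b < s'" by (rule edge_afterE)
    have "s = b" using edge_intsD(4)[OF s(1) _ s(3)] s(2) ab by fastforce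
    have "composed_segment T k a s' c" unfolding composed_segment_iff
    proof (intro conjI allI impI)
      fix t assume t: "a \<le> t \<and> t < s'"
      show "edge_after k t c" using edge_afterI[OF s(1), of t] t ab \<open>s = b\<close> by (cases "t < b") auto
    qed (use s ab edge_intsD[OF s(1)] in auto)
    from max[OF this] s show False by auto
  qed
  ultimately show "a < b \<and> (\<forall>t. a \<le> t \<and> t < b \<longrightarrow> edge_after k t c) \<and> \<not> edge_before k a c
    \<and> \<not> edge_after k b c" using ab by blast
next
  assume *: "a < b \<and> (\<forall>t. a \<le> t \<and> t < b \<longrightarrow> edge_after k t c) \<and> \<not> edge_before k a c
    \<and> \<not> edge_after k b c"
  then have *: "a < b" "\<And>t. a \<le> t \<Longrightarrow> t < b \<Longrightarrow> edge_after k t c" "\<not> edge_before k a c"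
    "\<not> edge_after k b c" by auto
  have va: "pt k a c \<in> vertices T"
    using *(2)[OF order.refl *(1)]
  proof (rule edge_afterE)
    fix s s' assume s: "(s, s') \<in> edge_ints k c" "s \<le> a" "a < s'"
    have "s = a" using s *(3) edge_beforeI[OF s(1), of a] by force
    thus ?thesis using edge_intsD(2)[OF s(1)] by simp
  qed
  obtain s s' where s: "(s, s') \<in> edge_ints k c" "s < b" "b \<le> s'" using last_edge[OF *(1,2)]
    by metis
  have "s' = b" using s *(4) edge_afterI[OF s(1), of b] by force
  hence vb: "pt k b c \<in> vertices T" using edge_intsD(3)[OF s(1)] by simp
  have cs: "composed_segment T k a b c" using * va vb by (simp add: composed_segment_iff)
  show "l_edge T k a b c" unfolding l_edge_def
  proof (intro conjI allI impI cs)
    fix a' b' assume ab': "composed_segment T k a' b' c \<and> seg k a b c \<subseteq> seg k a' b' c"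
    then have sub: "a' \<le> a" "b \<le> b'" and R': "\<And>t. a' \<le> t \<Longrightarrow> t < b' \<Longrightarrow> edge_after k t c"
      using *(1) by (auto simp: seg_subset_iff composed_segment_iff)
    show "a' = a" using edge_before_if_edges[of a' a k c] R' sub *(1,3) by force
    show "b' = b" using R'[of b] sub *(1,4) by force
  qed
qed

lemma l_edge_vertices: "l_edge T k a b c \<Longrightarrow> pt k a c \<in> vertices T \<and> pt k b c \<in> vertices T"
  by (simp add: l_edge_def composed_segment_iff)

lemma l_edge_unique:
  assumes "l_edge T k a b c" "l_edge T k a' b' c" "a \<le> t" "t \<le> b" "a' \<le> t" "t \<le> b'"
  shows "a = a' \<and> b = b'"
proof -
  have le: "a' \<le> a" if "l_edge T k a b c" "l_edge T k a' b' c" "a \<le> t" "t \<le> b" "a' \<le> t" "t \<le> b'"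
    for a b a' b'
  proof (rule ccontr)
    assume "\<not> a' \<le> a"
    then have "edge_before k a' c" using that
      by (intro edge_before_if_edges[of a a']) (auto simp: l_edge_iff)
    thus False using that by (simp add: l_edge_iff)
  qed
  have aa: "a = a'" using le[OF assms] le[OF assms(2,1,5,6,3,4)] by simp
  have le2: "b \<le> b'" if "l_edge T k a b c" "l_edge T k a b' c" for b b'
    using that unfolding l_edge_iff by (metis less_imp_le not_less)
  show ?thesis using aa le2 assms by (metis antisym)
qed

text \<open>The run of edges through the point is bounded by the least edge start and the greatest
  edge end that are connected to it without interruption.\<close>

lemma l_edge_exists:
  assumes edge_after: "edge_after k t c"
  obtains a b where "l_edge T k a b c" "a \<le> t" "t < b"
proof -
  let ?A = "{s \<in> fst ` edge_ints k c. s \<le> t \<and> (\<forall>u. s \<le> u \<and> u \<le> t \<longrightarrow> edge_after k u c)}"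
  let ?B = "{s \<in> snd ` edge_ints k c. t < s \<and> (\<forall>u. t \<le> u \<and> u < s \<longrightarrow> edge_after k u c)}"
  have fin: "finite ?A" "finite ?B" using finite_edge_ints by simp_all
  obtain e e' where e: "(e, e') \<in> edge_ints k c" "e \<le> t" "t < e'" using edge_after
    by (rule edge_afterE)
  have eA: "e \<in> ?A" using e edge_afterI[OF e(1)] by force
  have eB: "e' \<in> ?B" using e edge_afterI[OF e(1)] by force
  define a where "a = Min ?A"
  define b where "b = Max ?B"
  have a: "a \<in> ?A" unfolding a_def using Min_in[OF fin(1)] eA by blast
  have b: "b \<in> ?B" unfolding b_def using Max_in[OF fin(2)] eB by blast
  have "\<not> edge_before k a c"
  proof
    assume "edge_before k a c"
    then obtain s s' where s: "(s, s') \<in> edge_ints k c" "s < a" "a \<le> s'" by (rule edge_beforeE)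
    have "edge_after k u c" if "s \<le> u" "u \<le> t" for u
      using edge_afterI[OF s(1), of u] a that s(3) by (cases "u < a") auto
    then have "s \<in> ?A" using s a by force
    from Min_le[OF fin(1) this] show False using s(2) unfolding a_def by simp
  qed
  moreover have "\<not> edge_after k b c"
  proof
    assume "edge_after k b c"
    then obtain s s' where s: "(s, s') \<in> edge_ints k c" "s \<le> b" "b < s'" by (rule edge_afterE)
    have "edge_after k u c" if "t \<le> u" "u < s'" for u
      using edge_afterI[OF s(1), of u] b that s(2) by (cases "u < b") auto
    then have "s' \<in> ?B" using s b by force
    from Max_ge[OF fin(2) this] show False using s(3) unfolding b_def by simp
  qed
  moreover have "edge_after k u c" if "a \<le> u" "u < b" for u
    using a b that by (cases "u \<le> t") auto
  ultimately have "l_edge T k a b c" unfolding l_edge_iff using a b by force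
  thus ?thesis using that a b by blast
qed

lemma l_edge_exists_before:
  assumes edge_before: "edge_before k t c"
  obtains a b where "l_edge T k a b c" "a < t" "t \<le> b"
proof -
  obtain e e' where e: "(e, e') \<in> edge_ints k c" "e < t" "t \<le> e'" using edge_before
    by (rule edge_beforeE)
  obtain a b where ab: "l_edge T k a b c" "a \<le> e" "e < b"
    using l_edge_exists[of k e c] edge_afterI[OF e(1)] edge_intsD(1)[OF e(1)] by blast
  have "t \<le> b"
  proof (rule ccontr)
    assume "\<not> t \<le> b"
    then have "edge_after k b c" using edge_afterI[OF e(1), of b] ab e by auto
    thus False using ab by (simp add: l_edge_iff)
  qed
  thus ?thesis using that[OF ab(1)] ab e by force
qed

lemma finite_l_edges: "finite {(a, b, c). l_edge T k a b c}"
proof (rule finite_subset)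
  let ?g = "\<lambda>(u, v). case k of Horizontal \<Rightarrow> (fst u, fst v, snd u) | Vertical \<Rightarrow>
    (snd u, snd v, fst u :: real)"
  show "{(a, b, c). l_edge T k a b c} \<subseteq> ?g ` (vertices T \<times> vertices T)"
  proof clarify
    fix a b c assume "l_edge T k a b c"
    from l_edge_vertices[OF this] have "(pt k a c, pt k b c) \<in> vertices T \<times> vertices T" by simp
    moreover have "(a, b, c) = ?g (pt k a c, pt k b c)" by (cases k) auto
    ultimately show "(a, b, c) \<in> ?g ` (vertices T \<times> vertices T)" by blast
  qed
  show "finite (?g ` (vertices T \<times> vertices T))" using finite_vertices by blast
qed

end

section \<open>Jumps and local connectivity\<close>

context mesh begin

lemma germ_edge_after:
  assumes "F \<in> T" "G \<in> T" "germ k True True t c F" "germ k True False t c G" "F \<noteq> G"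
  shows "edge_after k t c"
  using germ_adj[OF assms] edge_afterI edge_ints_adj by (metis side_simps(1))

lemma germ_edge_before:
  assumes "F \<in> T" "G \<in> T" "germ k False True t c F" "germ k False False t c G" "F \<noteq> G"
  shows "edge_before k t c"
  using germ_adj[OF assms] edge_beforeI edge_ints_adj by (metis side_simps(2))

lemma edges_interior:
  assumes "edge_after k t c" "edge_before k t c"
  shows "pt k t c \<in> interior (mesh_domain T)"
  unfolding interior_iff_germs
proof (intro allI)
  fix s r
  obtain a b where "(a, b) \<in> edge_ints k c" "side s a b t"
    using assms unfolding edge_after_def edge_before_def by (cases s) auto
  then obtain F G where adj: "adj k F G a b c" and s: "side s a b t" unfolding edge_ints_adj
    by blast
  show "\<exists>F\<in>T. germ k s r t c F"
    using adj_germ[OF adj s] adjD(1,2)[OF adj] by (cases r) auto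
qed

lemma edge_after_adjE: assumes "edge_after k t c" obtains F G a b where "adj k F G a b c" "a \<le> t"
  "t < b"
  using assms edge_afterE edge_ints_adj by metis

lemma edge_before_adjE: assumes "edge_before k t c" obtains F G a b where "adj k F G a b c"
  "a < t" "t \<le> b"
  using assms edge_beforeE edge_ints_adj by metis

lemma interior_vertex_domain: "v \<in> interior_vertices T \<Longrightarrow> v \<in> interior (mesh_domain T)"
proof -
  assume v: "v \<in> interior_vertices T"
  obtain t c where "v = pt Horizontal t c" by (rule pt_exhaust)
  thus ?thesis using v interior_vertices_iff[of Horizontal t c]
    interior_iff_germs[of Horizontal t c] by simp
qed

lemma interior_vertex_edge:
  assumes "pt k t c \<in> interior_vertices T"
  shows "edge_after k t c \<or> edge_before k t c"
proof (rule ccontr)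
  assume neg: "\<not> (edge_after k t c \<or> edge_before k t c)"
  have germs: "\<exists>F\<in>T. germ k s r t c F" for s r using assms interior_vertices_iff by blast
  obtain H where H: "H \<in> T" "t \<in> {lo k H, hi k H}" "c \<in> {lo (flip k) H, hi (flip k) H}"
    using assms interior_vertices_iff vertices_iff by blast
  obtain s r where sr: "germ k s r t c H"
    using H cell_box(2)[OF H(1), of k] cell_box(2)[OF H(1), of "flip k"] germ_exists[of H k t c]
    by (auto simp: pt_in_cell)
  obtain G where G: "G \<in> T" "germ k s (\<not> r) t c G" using germs by blast
  have "H = G"
  proof (rule ccontr)
    assume "H \<noteq> G"
    then have "edge_after k t c \<or> edge_before k t c"
      using germ_edge_after[of H G k t c] germ_edge_after[of G H k t c]
        germ_edge_before[of H G k t c] germ_edge_before[of G H k t c] H(1) G sr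
      by (cases s; cases r) auto
    thus False using neg by simp
  qed
  thus False using sr G(2) H(3) by (cases r) (auto simp: germ_def)
qed

text \<open>A line that stops at an interior point does so in a T-junction: on the side without an
  edge both quadrants belong to one cell, and the transverse line separates this cell from the two
  cells opposite.\<close>

lemma interior_end_crossing:
  assumes int: "pt k t c \<in> interior (mesh_domain T)" and RL: "edge_after k t c \<noteq> edge_before k t c"
  shows "edge_after (flip k) c t" "edge_before (flip k) c t"
proof -
  have "\<exists>F\<in>T. germ k s r t c F" for s r using int interior_iff_germs by blast
  then obtain Q where Q: "\<And>s r. Q s r \<in> T" "\<And>s r. germ k s r t c (Q s r)" by metis
  \<comment> \<open>\<open>s\<close> is the direction in which the edge leaves the point.\<close>
  obtain s where s: "Q (\<not> s) True = Q (\<not> s) False" "Q s True \<noteq> Q s False"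
  proof -
    have "Q True True = Q True False" if "\<not> edge_after k t c"
      using germ_edge_after[OF Q(1) Q(1) Q(2) Q(2)] that by blast
    moreover have "Q False True = Q False False" if "\<not> edge_before k t c"
      using germ_edge_before[OF Q(1) Q(1) Q(2) Q(2)] that by blast
    moreover have "Q True True \<noteq> Q True False" if edge_after: "edge_after k t c"
    proof -
      obtain F G a b where "adj k F G a b c" "side True a b t"
        using edge_after edge_after_adjE side_simps(1) by metis
      from adj_germ_cell[OF this Q(1) Q(2)] adj_neq[OF this(1)] show ?thesis by metis
    qed
    moreover have "Q False True \<noteq> Q False False" if edge_before: "edge_before k t c"
    proof -
      obtain F G a b where "adj k F G a b c" "side False a b t"
        using edge_before edge_before_adjE side_simps(2) by metis
      from adj_germ_cell[OF this Q(1) Q(2)] adj_neq[OF this(1)] show ?thesis by metis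
    qed
    ultimately show ?thesis using that[of True] that[of False] RL by auto
  qed
  have ne: "Q s r \<noteq> Q (\<not> s) r" for r
  proof
    \<comment> \<open>A cell holding two opposite quadrants holds the other two as well, because it
      is a box; then no edge could leave in direction \<open>s\<close>.\<close>
    assume eq: "Q s r = Q (\<not> s) r"
    have "germ k s r t c (Q s r)" "germ k (\<not> s) (\<not> r) t c (Q s r)"
      using Q(2)[of s r] Q(2)[of "\<not> s" "\<not> r"] eq s(1) by (cases r; simp)+
    then have "germ k s (\<not> r) t c (Q s r)" by (auto simp: germ_def)
    then have "Q s r = Q s (\<not> r)" using germ_unique[OF Q(1) Q(1) _ Q(2)] by blast
    thus False using s(2) by (cases r) auto
  qed
  have fl: "germ (flip k) r s c t (Q s r)" for s r using Q(2)[of s r] by simp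
  show "edge_after (flip k) c t"
    by (rule germ_edge_after[OF Q(1) Q(1) fl fl]) (use ne[of True] in \<open>cases s; auto\<close>)
  show "edge_before (flip k) c t"
    by (rule germ_edge_before[OF Q(1) Q(1) fl fl]) (use ne[of False] in \<open>cases s; auto\<close>)
qed

section \<open>Jumps across a line\<close>

text \<open>The sum has at most one term. It replaces a choice of cell because it is additive in
  \<open>P\<close> and yields 0 on quadrants outside the domain.\<close>

definition piece_at :: "(cell \<Rightarrow> 'a::ab_group_add) \<Rightarrow> orientation \<Rightarrow> bool \<Rightarrow> bool \<Rightarrow> real \<Rightarrow> real \<Rightarrow> 'a"
  where
  "piece_at P k s r t c = (\<Sum>F\<in>{F \<in> T. germ k s r t c F}. P F)"

definition jump_after :: "(cell \<Rightarrow> 'a::ab_group_add) \<Rightarrow> orientation \<Rightarrow> real \<Rightarrow> real \<Rightarrow> 'a" where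
  "jump_after P k t c = piece_at P k True True t c - piece_at P k True False t c"

definition jump_before :: "(cell \<Rightarrow> 'a::ab_group_add) \<Rightarrow> orientation \<Rightarrow> real \<Rightarrow> real \<Rightarrow> 'a" where
  "jump_before P k t c = piece_at P k False True t c - piece_at P k False False t c"

lemma piece_at_eq: "F \<in> T \<Longrightarrow> germ k s r t c F \<Longrightarrow> piece_at P k s r t c = P F"
proof -
  assume F: "F \<in> T" "germ k s r t c F"
  then have "{F \<in> T. germ k s r t c F} = {F}" using germ_unique by blast
  thus ?thesis by (simp add: piece_at_def)
qed

lemma piece_at_flip: "piece_at P (flip k) s r t c = piece_at P k r s c t"
  by (simp add: piece_at_def)

text \<open>Both sides equal the alternating sum of the four pieces around the point, which is
  symmetric in the two directions.\<close>

lemma jump_flip: "jump_after P (flip k) c t - jump_before P (flip k) c t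
  = jump_after P k t c - jump_before P k t c"
  by (simp add: jump_after_def jump_before_def piece_at_flip)

lemma jump_after_adj: "adj k F G a b c \<Longrightarrow> a \<le> t \<Longrightarrow> t < b \<Longrightarrow> jump_after P k t c = P F - P G"
  using adj_germ[of k F G a b c True t] adjD[of k F G a b c]
    by (simp add: jump_after_def piece_at_eq[of F] piece_at_eq[of G])

lemma jump_before_adj: "adj k F G a b c \<Longrightarrow> a < t \<Longrightarrow> t \<le> b \<Longrightarrow> jump_before P k t c = P F - P G"
  using adj_germ[of k F G a b c False t] adjD[of k F G a b c]
    by (simp add: jump_before_def piece_at_eq[of F] piece_at_eq[of G])

lemma jump_after_zero:
  assumes "pt k t c \<in> interior (mesh_domain T)" "\<not> edge_after k t c"
  shows "jump_after P k t c = 0"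
proof -
  obtain F G where FG: "F \<in> T" "G \<in> T" "germ k True True t c F" "germ k True False t c G"
    using assms(1) interior_iff_germs by blast
  then have "F = G" using germ_edge_after assms(2) by blast
  thus ?thesis using FG by (simp add: jump_after_def piece_at_eq)
qed

lemma jump_before_zero:
  assumes "pt k t c \<in> interior (mesh_domain T)" "\<not> edge_before k t c"
  shows "jump_before P k t c = 0"
proof -
  obtain F G where FG: "F \<in> T" "G \<in> T" "germ k False True t c F" "germ k False False t c G"
    using assms(1) interior_iff_germs by blast
  then have "F = G" using germ_edge_before assms(2) by blast
  thus ?thesis using FG by (simp add: jump_before_def piece_at_eq)
qed

lemma l_edge_inside:
  assumes "l_edge T k a b c" "a < t" "t < b"
  shows "edge_after k t c" "edge_before k t c" "pt k t c \<in> interior (mesh_domain T)"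
proof -
  show "edge_after k t c" using assms by (simp add: l_edge_iff)
  moreover show "edge_before k t c" using assms
    by (intro edge_before_if_edges[of a]) (auto simp: l_edge_iff)
  ultimately show "pt k t c \<in> interior (mesh_domain T)" by (rule edges_interior)
qed

lemma interior_vertexI:
  "pt k t c \<in> vertices T \<Longrightarrow> pt k t c \<in> interior (mesh_domain T) \<Longrightarrow> pt k t c \<in> interior_vertices T"
  by (simp add: interior_vertices_iff interior_iff_germs)

lemma finite_interior_vertices: "finite (interior_vertices T)"
  using finite_vertices by (auto simp: interior_vertices_def intro: finite_subset)

lemma finite_line_vertices: "finite {v. Q v \<and> pt k v c \<in> interior_vertices T}"
proof -
  have "finite ((\<lambda>v. pt k v c) -` interior_vertices T)"
    by (rule finite_vimageI[OF finite_interior_vertices]) (auto simp: inj_on_def)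
  thus ?thesis by (rule rev_finite_subset) auto
qed

text \<open>The jump is constant along an edge, so it changes only at vertices; these are interior,
  as edges of the line meet there from both sides. The induction runs on the number of interior
  vertices passed.\<close>

lemma jump_telescope:
  assumes "t1 < t2" "\<And>u. t1 \<le> u \<Longrightarrow> u < t2 \<Longrightarrow> edge_after k u c"
  shows "jump_before P k t2 c - jump_after P k t1 c =
    (\<Sum>v\<in>{v. t1 < v \<and> v < t2 \<and> pt k v c \<in> interior_vertices T}. jump_after P k v c - jump_before P
      k v c)"
  using assms
proof (induction "card {v. t1 < v \<and> v < t2 \<and> pt k v c \<in> interior_vertices T}" arbitrary: t2 rule:
  less_induct)
  case less
  let ?S = "\<lambda>t2. {v. t1 < v \<and> v < t2 \<and> pt k v c \<in> interior_vertices T}"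
  have fin: "finite (?S t2)" for t2
    using finite_line_vertices[of "\<lambda>v. t1 < v \<and> v < t2" k c] by (simp add: conj_assoc)
  \<comment> \<open>If no interior vertex lies in between, the edge leaving \<open>v\<close> reaches
    \<open>t2\<close>, and both jumps are the difference of its two pieces.\<close>
  have same: "jump_before P k t2 c = jump_after P k v c" if v: "t1 \<le> v" "v < t2" "\<And>u. v < u
    \<Longrightarrow> u < t2 \<Longrightarrow> u \<notin> ?S t2" for v
  proof -
    obtain a b where ab: "(a, b) \<in> edge_ints k c" "a \<le> v" "v < b"
      using edge_afterE less.prems(2) v by metis
    have "t2 \<le> b"
    proof (rule ccontr)
      assume "\<not> t2 \<le> b"
      then have b: "b < t2" by simp
      have "edge_after k b c" using less.prems(2) b v(1) ab by simp
      moreover have "edge_before k b c" using edge_beforeI[OF ab(1)] ab by simp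
      ultimately have "b \<in> ?S t2"
        using interior_vertexI[OF edge_intsD(3)[OF ab(1)] edges_interior] b ab v(1) by simp
      thus False using v(3)[of b] b ab by simp
    qed
    moreover obtain F G where "adj k F G a b c" using ab(1) edge_ints_adj by blast
    ultimately show ?thesis using jump_before_adj[of k F G a b c t2 P]
      jump_after_adj[of k F G a b c v P] ab v by simp
  qed
  show ?case
  proof (cases "?S t2 = {}")
    case True
    show ?thesis unfolding True using same[of t1] True less.prems(1) by simp
  next
    case False
    define v where "v = Max (?S t2)"
    have v: "v \<in> ?S t2" unfolding v_def using Max_in[OF fin False] .
    have vmax: "u \<le> v" if "u \<in> ?S t2" for u unfolding v_def using Max_ge[OF fin that] .
    have S: "?S t2 = insert v (?S v)" "v \<notin> ?S v" using v vmax by force+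
    have "card (?S v) < card (?S t2)" unfolding S(1) using S(2) fin[of v] by simp
    from less.hyps[OF this] have IH: "jump_before P k v c - jump_after P k t1 c
      = (\<Sum>v\<in>?S v. jump_after P k v c - jump_before P k v c)"
      using v less.prems(2) by auto
    have "u \<notin> ?S t2" if "v < u" for u using vmax[of u] that by auto
    then have "jump_before P k t2 c = jump_after P k v c" using v by (intro same) simp_all
    thus ?thesis unfolding S(1) sum.insert[OF fin S(2)] IH[symmetric] by simp
  qed
qed

section \<open>Connectivity of the cells at a point and in the large\<close>

text \<open>Only edges through \<open>z\<close> count: for spline pieces the jump across each link
  of a chain vanishes at \<open>z\<close>, so the pieces along the chain agree there.\<close>

definition adj_at :: "real \<times> real \<Rightarrow> (cell \<times> cell) set" where
  "adj_at z = {(F, G). \<exists>k a b c. (adj k F G a b c \<or> adj k G F a b c) \<and> z \<in> seg k a b c}"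

definition adj_rel :: "(cell \<times> cell) set" where
  "adj_rel = {(F, G). \<exists>k a b c. adj k F G a b c \<or> adj k G F a b c}"

lemma germ_step:
  assumes "F \<in> T" "G \<in> T" "germ k s r t c F" "germ k s r' t c G"
  shows "(F, G) \<in> (adj_at (pt k t c))\<^sup>*"
proof (cases "F = G")
  case False
  then have "r' \<noteq> r" using germ_unique[OF assms(1-3)] assms(4) by blast
  then have rr: "r' = (\<not> r)" by blast
  have "\<exists>a b. (adj k F G a b c \<or> adj k G F a b c) \<and> side s a b t"
    using germ_adj[of F G k s t c] germ_adj[of G F k s t c] assms False rr by (cases r) auto
  then obtain a b where "adj k F G a b c \<or> adj k G F a b c" "side s a b t" by blast
  moreover from this(2) have "pt k t c \<in> seg k a b c" by (cases s) auto
  ultimately have "(F, G) \<in> adj_at (pt k t c)" unfolding adj_at_def by blast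
  thus ?thesis by blast
qed simp

lemma germ_step_flip:
  assumes "F \<in> T" "G \<in> T" "germ k s r t c F" "germ k s' r t c G"
  shows "(F, G) \<in> (adj_at (pt k t c))\<^sup>*"
  using germ_step[of F G "flip k" r s c t s'] assms by simp

end

text \<open>Two cells that touch only in opposite quadrants at a corner, the configuration that regularity
  excludes.\<close>

lemma (in mesh) no_opposite_corner:
  assumes FG: "F \<in> T" "G \<in> T" and F: "lo k F = t" and G: "hi k G = t"
    and c: "hi (flip k) G \<le> lo (flip k) F \<or> hi (flip k) F \<le> lo (flip k) G"
  shows "\<not> connected (interior (F \<union> G))"
proof
  assume conn: "connected (interior (F \<union> G))"
  have "t_mesh {F, G}" using t_mesh FG unfolding t_mesh_def by auto
  then interpret M: mesh "{F, G}" by unfold_locales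
  \<comment> \<open>The line on which \<open>co\<close> equals \<open>t\<close> runs between the two
    cells. It misses the interior of their union, which has points on both sides of it.\<close>
  define co :: "real \<times> real \<Rightarrow> real" where "co = (case k of Horizontal \<Rightarrow> fst | Vertical \<Rightarrow> snd)"
  have co: "co (pt k x y) = x" for x y unfolding co_def by (cases k) auto
  have cont: "continuous_on UNIV co" unfolding co_def by (cases k) (auto intro!: continuous_intros)
  have op: "open {p. co p < t}" "open {p. t < co p}"
    by (intro open_Collect_less cont continuous_on_const)+
  have mid: "\<exists>x y. pt k x y \<in> interior (F \<union> G) \<and> lo k H < x \<and> x < hi k H" if "H \<in> {F, G}" for H
  proof -
    have HT: "H \<in> T" using that FG by auto
    obtain x where x: "lo k H < x" "x < hi k H" using cell_box(2)[OF HT] dense by blast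
    obtain y where y: "lo (flip k) H < y" "y < hi (flip k) H" using cell_box(2)[OF HT] dense
      by blast
    have "germ k s r x y H" for s r using x y by (cases s; cases r) (auto simp: germ_def)
    then have "pt k x y \<in> interior (mesh_domain {F, G})" unfolding M.interior_iff_germs using that
      by blast
    thus ?thesis using x by (auto simp: mesh_domain_def)
  qed
  have sub: "interior (F \<union> G) \<subseteq> {p. co p < t} \<union> {p. t < co p}"
  proof
    fix p assume p: "p \<in> interior (F \<union> G)"
    obtain x y where xy: "p = pt k x y" by (rule pt_exhaust)
    have "x \<noteq> t"
    proof
      assume x: "x = t"
      have "\<forall>s r. \<exists>H\<in>{F, G}. germ k s r x y H"
        using p unfolding xy M.interior_iff_germs[symmetric] by (simp add: mesh_domain_def)
      then have "germ k True r t y F \<and> germ k False r t y G" for r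
        using F G unfolding x germ_def by (metis insertE less_irrefl side_simps singletonD)
      from this[of True] this[of False] show False using c by (auto simp: germ_def)
    qed
    thus "p \<in> {p. co p < t} \<union> {p. t < co p}" by (auto simp: xy co)
  qed
  obtain x y x' y' where "pt k x y \<in> interior (F \<union> G)" "t < x" "pt k x' y' \<in> interior (F \<union> G)"
    "x' < t"
    using mid[of F] mid[of G] F G by auto
  then have "pt k x y \<in> {p. t < co p} \<inter> interior (F \<union> G)"
    "pt k x' y' \<in> {p. co p < t} \<inter> interior (F \<union> G)"
    by (simp_all add: co)
  moreover have "{p. co p < t} \<inter> {p. t < co p} \<inter> interior (F \<union> G) = {}" by auto
  ultimately show False using connectedD[OF conn op(1) op(2) _ sub] by blast
qed

locale reg_mesh = mesh +
  assumes regular: "regular_mesh T"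
begin

text \<open>Two cells at a point occupy equal or neighbouring quadrants, or are joined through a
  covered third quadrant. Otherwise they touch only at a corner and no other cell contains the
  point, which regularity forbids.\<close>

lemma local_connectivity:
  assumes FG: "F \<in> T" "G \<in> T" and z: "pt k t c \<in> F" "pt k t c \<in> G"
  shows "(F, G) \<in> (adj_at (pt k t c))\<^sup>*"
proof -
  obtain s r where F: "germ k s r t c F" using germ_exists[OF FG(1) z(1)] by blast
  obtain s' r' where G: "germ k s' r' t c G" using germ_exists[OF FG(2) z(2)] by blast
  consider "s = s'" | "r = r'" | H where "H \<in> T" "germ k s r' t c H" | H where "H \<in> T"
    "germ k s' r t c H"
    | "s' = (\<not> s)" "r' = (\<not> r)" "\<And>H. H \<in> T \<Longrightarrow> \<not> germ k s r' t c H" "\<And>H. H \<in> T \<Longrightarrow> \<not> germ k s' r t c H"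
    by (cases s; cases s'; cases r; cases r') blast+
  then show ?thesis
  proof cases
    case 1 thus ?thesis using germ_step[OF FG F, of r'] G by simp
  next
    case 2 thus ?thesis using germ_step_flip[OF FG F, of s'] G by simp
  next
    case 3
    have "(F, H) \<in> (adj_at (pt k t c))\<^sup>*" using germ_step[OF FG(1) 3(1) F 3(2)] .
    also have "(H, G) \<in> (adj_at (pt k t c))\<^sup>*" using germ_step_flip[OF 3(1) FG(2) 3(2) G] .
    finally show ?thesis .
  next
    case 4
    have "(F, H) \<in> (adj_at (pt k t c))\<^sup>*" using germ_step_flip[OF FG(1) 4(1) F 4(2)] .
    also have "(H, G) \<in> (adj_at (pt k t c))\<^sup>*" using germ_step[OF 4(1) FG(2) 4(2) G] .
    finally show ?thesis .
  next
    case 5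
    \<comment> \<open>If \<open>F\<close> extended beyond the point in either direction, it would
      cover one of the two quadrants assumed uncovered.\<close>
    have Fc: "if s then lo k F = t else hi k F = t" "if r then lo (flip k) F = c
      else hi (flip k) F = c"
      using F 5(1,2) 5(3)[OF FG(1)] 5(4)[OF FG(1)] by (cases s; cases r; auto simp: germ_def)+
    have Gc: "if s then hi k G = t else lo k G = t" "if r then hi (flip k) G = c
      else lo (flip k) G = c"
      using G 5(1,2) 5(3)[OF FG(2)] 5(4)[OF FG(2)] by (cases s; cases r; auto simp: germ_def)+
    have v: "pt k t c \<in> vertices T" unfolding vertices_iff using Fc FG(1)
      by (intro bexI[of _ F]) (auto split: if_splits)
    have un: "{H \<in> T. pt k t c \<in> H} = {F, G}"
    proof (intro set_eqI iffI)
      fix H assume "H \<in> {H \<in> T. pt k t c \<in> H}"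
      then have H: "H \<in> T" "pt k t c \<in> H" by auto
      then obtain u w where uw: "germ k u w t c H" using germ_exists by blast
      have "(u, w) = (s, r) \<or> (u, w) = (s', r')"
        using uw 5(1,2) 5(3)[OF H(1)] 5(4)[OF H(1)] by (cases u; cases w; cases s; cases r) auto
      thus "H \<in> {F, G}" using germ_unique[OF H(1) _ uw] FG F G by auto
    qed (use FG z in auto)
    have "connected (interior (\<Union>{H \<in> T. pt k t c \<in> H}))"
      using regular v unfolding regular_mesh_def by (rule bspec)
    then have "connected (interior (F \<union> G))" unfolding un by simp
    moreover have "\<not> connected (interior (F \<union> G))"
    proof (cases s)
      case True
      show ?thesis by (rule no_opposite_corner[OF FG, of k t])
        (use Fc Gc True in \<open>auto split: if_splits\<close>)
    next
      case False
      have "\<not> connected (interior (G \<union> F))"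
        by (rule no_opposite_corner[OF FG(2,1), of k t])
          (use Fc Gc False in \<open>auto split: if_splits\<close>)
      thus ?thesis by (simp add: Un_commute)
    qed
    ultimately show ?thesis by blast
  qed
qed

end

locale simple_mesh = reg_mesh +
  assumes no_holes: "without_holes T"
begin

text \<open>Touching cells are linked by edges, so the cells linked to \<open>F\<close> and the
  others have disjoint closed unions, against connectedness of the domain.\<close>

lemma cells_connected:
  assumes "F \<in> T" "G \<in> T"
  shows "(F, G) \<in> adj_rel\<^sup>*"
proof (rule ccontr)
  assume neg: "(F, G) \<notin> adj_rel\<^sup>*"
  let ?A = "{H \<in> T. (F, H) \<in> adj_rel\<^sup>*}" and ?B = "{H \<in> T. (F, H) \<notin> adj_rel\<^sup>*}"
  have cl: "closed (\<Union>?A)" "closed (\<Union>?B)" using finite_T closed_cell by (auto intro!: closed_Union)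
  have sub: "adj_at z \<subseteq> adj_rel" for z by (auto simp: adj_at_def adj_rel_def)
  have disj: "\<Union>?A \<inter> \<Union>?B = {}"
  proof (rule ccontr)
    assume "\<Union>?A \<inter> \<Union>?B \<noteq> {}"
    then obtain z H K where z: "H \<in> ?A" "K \<in> ?B" "z \<in> H" "z \<in> K" by blast
    obtain t c where "z = pt Horizontal t c" by (rule pt_exhaust)
    then have "(H, K) \<in> (adj_at z)\<^sup>*" using local_connectivity[of H K Horizontal t c] z by auto
    then have "(H, K) \<in> adj_rel\<^sup>*" using rtrancl_mono[OF sub] by blast
    thus False using z(1,2) by (auto intro: rtrancl_trans)
  qed
  have ne: "H \<noteq> {}" if "H \<in> T" for H using cell_box[OF that]
    by (metis Times_empty atLeastatMost_empty_iff less_le_not_le)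
  have "connected (mesh_domain T)" using no_holes by (simp add: without_holes_def)
  moreover have "mesh_domain T \<subseteq> \<Union>?A \<union> \<Union>?B" by (auto simp: mesh_domain_def)
  moreover have "\<Union>?A \<inter> mesh_domain T \<noteq> {}" using assms(1) ne[OF assms(1)]
    by (auto simp: mesh_domain_def)
  moreover have "\<Union>?B \<inter> mesh_domain T \<noteq> {}" using assms(2) ne[OF assms(2)] neg
    by (auto simp: mesh_domain_def)
  ultimately show False using cl disj unfolding connected_closed by blast
qed

end

section \<open>Closed systems of jumps are exact\<close>

locale grid =
  fixes fill :: "nat \<Rightarrow> nat \<Rightarrow> bool" and m n :: nat
begin

text \<open>The grid cell \<open>(i, j)\<close> has the lower left vertex \<open>(i, j)\<close>; \<open>hint i j\<close> and \<open>vint i j\<close> say that the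
  edge leaving this vertex to the right and upwards, respectively, separates two filled cells.\<close>

definition hint :: "nat \<Rightarrow> nat \<Rightarrow> bool" where
  "hint i j \<longleftrightarrow> 1 \<le> j \<and> fill i j \<and> fill i (j - 1)"

definition vint :: "nat \<Rightarrow> nat \<Rightarrow> bool" where
  "vint i j \<longleftrightarrow> 1 \<le> i \<and> fill i j \<and> fill (i - 1) j"

definition inner :: "nat \<Rightarrow> nat \<Rightarrow> bool" where
  "inner i j \<longleftrightarrow> 1 \<le> i \<and> i < m \<and> 1 \<le> j \<and> j < n"

text \<open>Vertices joined to the rim of the grid by edges on which jumps may be prescribed freely,
  as these do not separate two filled cells. Each kind of edge has one rule per way of
  traversal.\<close>

inductive reach :: "nat \<Rightarrow> nat \<Rightarrow> bool" where
  outside: "\<not> inner i j \<Longrightarrow> reach i j"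
| right: "reach (Suc i) j \<Longrightarrow> \<not> hint i j \<Longrightarrow> reach i j"
| left: "reach i j \<Longrightarrow> \<not> hint i j \<Longrightarrow> reach (Suc i) j"
| up: "reach i (Suc j) \<Longrightarrow> \<not> vint i j \<Longrightarrow> reach i j"
| down: "reach i j \<Longrightarrow> \<not> vint i j \<Longrightarrow> reach i (Suc j)"

text \<open>Paths may run along all four sides of an unfilled cell, so its corners are reached
  together. The lower left corner serves as the hub; the next lemma leads back from it.\<close>

lemma unfilled_reach_corner:
  assumes "\<not> fill i j" "reach a b" "a \<in> {i, Suc i}" "b \<in> {j, Suc j}"
  shows "reach i j"
proof -
  have nh: "\<not> hint i j" "\<not> hint i (Suc j)" and nv: "\<not> vint i j" "\<not> vint (Suc i) j"
    using assms(1) by (auto simp: hint_def vint_def)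
  have "reach a j" using assms(2-4) up[OF _ nv(1)] up[OF _ nv(2)] by auto
  thus ?thesis using assms(3) right[OF _ nh(1)] by auto
qed

lemma unfilled_corner_reach:
  assumes "\<not> fill i j" "reach i j" "a \<in> {i, Suc i}" "b \<in> {j, Suc j}"
  shows "reach a b"
proof -
  have nh: "\<not> hint i j" "\<not> hint i (Suc j)" and nv: "\<not> vint i j" "\<not> vint (Suc i) j"
    using assms(1) by (auto simp: hint_def vint_def)
  have "reach a j" using assms(2,3) left[OF _ nh(1)] by auto
  thus ?thesis using assms(3,4) down[OF _ nv(1)] down[OF _ nv(2)] by auto
qed

text \<open>The discrete circulation about a vertex: \<open>U i j\<close> is the jump across the
  edge going up from the vertex, \<open>W i j\<close> the jump across the edge going right. At inner
  vertices it vanishes if the jumps are differences of one function on the grid cells.\<close>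

definition curl :: "(nat \<Rightarrow> nat \<Rightarrow> 'a::ab_group_add) \<Rightarrow> (nat \<Rightarrow> nat \<Rightarrow> 'a) \<Rightarrow> nat \<Rightarrow> nat \<Rightarrow> 'a" where
  "curl U W i j = W i j - W (i - 1) j - U i j + U i (j - 1)"

lemma curl_add: "curl (\<lambda>i j. U i j + U' i j) (\<lambda>i j. W i j + W' i j) i j
  = curl U W i j + curl U' W' i j"
  by (simp add: curl_def)

lemma curl_sum: "curl (\<lambda>i j. \<Sum>p\<in>A. U p i j) (\<lambda>i j. \<Sum>p\<in>A. W p i j) i j
  = (\<Sum>p\<in>A. curl (U p) (W p) i j)"
  by (simp add: curl_def sum_subtractf sum.distrib)

text \<open>A source \<open>\<delta>\<close> at a vertex is carried off along edges that do not separate two filled cells.\<close>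

definition routable :: "'a::ab_group_add \<Rightarrow> nat \<Rightarrow> nat \<Rightarrow> bool" where
  "routable \<delta> i0 j0 \<longleftrightarrow> (\<exists>U W. (\<forall>i j. vint i j \<longrightarrow> U i j = 0) \<and> (\<forall>i j. hint i j \<longrightarrow> W i j = 0) \<and>
     (\<forall>i j. inner i j \<longrightarrow> curl U W i j = (if i = i0 \<and> j = j0 then \<delta> else 0)))"

text \<open>Circulation is additive, so a flow \<open>X\<close>, \<open>Y\<close> from one vertex to
  the other shifts the source.\<close>

lemma routable_move:
  fixes \<delta> :: "'a::ab_group_add"
  assumes "routable \<delta> i1 j1"
    and X: "\<And>i j. vint i j \<Longrightarrow> X i j = 0" "\<And>i j. hint i j \<Longrightarrow> Y i j = 0"
    and curl: "\<And>i j. inner i j \<Longrightarrow> curl X Y i j =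
       (if i = i0 \<and> j = j0 then \<delta> else 0) - (if i = i1 \<and> j = j1 then \<delta> else 0)"
  shows "routable \<delta> i0 j0"
proof -
  obtain U W where UW: "\<And>i j. vint i j \<Longrightarrow> U i j = 0" "\<And>i j. hint i j \<Longrightarrow> W i j = 0"
     "\<And>i j. inner i j \<Longrightarrow> curl U W i j = (if i = i1 \<and> j = j1 then \<delta> else 0)"
    using assms(1) unfolding routable_def by blast
  have "curl (\<lambda>i j. U i j + X i j) (\<lambda>i j. W i j + Y i j) i j = (if i = i0 \<and> j = j0 then \<delta> else 0)"
    if "inner i j" for i j unfolding curl_add UW(3)[OF that] curl[OF that] by simp
  then show ?thesis unfolding routable_def using UW(1,2) X
    by (intro exI[of _ "\<lambda>i j. U i j + X i j"] exI[of _ "\<lambda>i j. W i j + Y i j"] conjI) auto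
qed

lemma reach_routable: "reach i0 j0 \<Longrightarrow> routable (\<delta> :: 'a::ab_group_add) i0 j0"
proof (induction rule: reach.induct)
  case (outside i0 j0)
  then show ?case unfolding routable_def by (intro exI[of _ "\<lambda>_ _. 0"]) (auto simp: curl_def)
next
  case (right i0 j0)
  show ?case
    by (rule routable_move[OF right.IH, of "\<lambda>_ _. 0" "\<lambda>i j. if i = i0 \<and> j = j0 then \<delta> else 0"])
       (use right.hyps in \<open>auto simp: curl_def inner_def\<close>)
next
  case (left i0 j0)
  show ?case
    by (rule routable_move[OF left.IH, of "\<lambda>_ _. 0" "\<lambda>i j. if i = i0 \<and> j = j0 then - \<delta> else 0"])
       (use left.hyps in \<open>auto simp: curl_def inner_def\<close>)
next
  case (up i0 j0)
  show ?case
    by (rule routable_move[OF up.IH, of "\<lambda>i j. if i = i0 \<and> j = j0 then - \<delta> else 0" "\<lambda>_ _. 0"])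
       (use up.hyps in \<open>auto simp: curl_def inner_def\<close>)
next
  case (down i0 j0)
  show ?case
    by (rule routable_move[OF down.IH, of "\<lambda>i j. if i = i0 \<and> j = j0 then \<delta> else 0" "\<lambda>_ _. 0"])
       (use down.hyps in \<open>auto simp: curl_def inner_def\<close>)
qed

text \<open>The discrete Poincare lemma on a full rectangle.\<close>

lemma curl_free_exact:
  fixes U W :: "nat \<Rightarrow> nat \<Rightarrow> 'a::ab_group_add"
  assumes "\<And>i j. inner i j \<Longrightarrow> curl U W i j = 0"
  shows "\<exists>P. (\<forall>i j. P i (Suc j) - P i j = W i (Suc j)) \<and>
     (\<forall>i j. Suc i < m \<longrightarrow> j < n \<longrightarrow> P (Suc i) j - P i j = U (Suc i) j)"
proof -
  \<comment> \<open>Integration along the bottom row and then up the column. Differences within a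
    column are right by construction; those between columns are carried upwards by vanishing
    circulation.\<close>
  define P where "P i j = (\<Sum>k<i. U (Suc k) 0) + (\<Sum>l<j. W i (Suc l))" for i j
  have 1: "P i (Suc j) - P i j = W i (Suc j)" for i j by (simp add: P_def)
  have "P (Suc i) j - P i j = U (Suc i) j" if "Suc i < m" "j < n" for i j
    using that(2)
  proof (induction j)
    case (Suc j)
    have "P (Suc i) (Suc j) - P i (Suc j) = W (Suc i) (Suc j) - W i (Suc j) + (P (Suc i) j - P i j)"
      using 1[of "Suc i" j] 1[of i j] by (simp add: algebra_simps)
    also have "\<dots> = U (Suc i) (Suc j)"
      using Suc assms[of "Suc i" "Suc j"] that(1) by (simp add: curl_def inner_def algebra_simps)
    finally show ?case .
  qed (simp add: P_def)
  with 1 show ?thesis by blast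
qed

text \<open>Jumps on edges that do not separate two filled cells are first set to 0. The remaining
  circulation sits at reached vertices and is cancelled by routed sources. These leave the
  separating edges untouched, and the full rectangle admits a potential.\<close>

lemma locally_closed_exact:
  fixes u w :: "nat \<Rightarrow> nat \<Rightarrow> 'a::ab_group_add"
  assumes bound: "\<And>i j. fill i j \<Longrightarrow> i < m \<and> j < n"
    and closed: "\<And>i j. fill i j \<Longrightarrow> fill (Suc i) j \<Longrightarrow> fill i (Suc j) \<Longrightarrow> fill (Suc i) (Suc j) \<Longrightarrow>
       w (Suc i) (Suc j) - w i (Suc j) = u (Suc i) (Suc j) - u (Suc i) j"
    and reach: "\<And>i j. i < m \<Longrightarrow> j < n \<Longrightarrow> \<not> fill i j \<Longrightarrow> reach i j"
  shows "\<exists>P. (\<forall>i j. fill i j \<longrightarrow> fill i (Suc j) \<longrightarrow> P i (Suc j) - P i j = w i (Suc j)) \<and>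
     (\<forall>i j. fill i j \<longrightarrow> fill (Suc i) j \<longrightarrow> P (Suc i) j - P i j = u (Suc i) j)"
proof -
  define U where "U i j = (if vint i j then u i j else 0)" for i j
  define W where "W i j = (if hint i j then w i j else 0)" for i j
  define B where "B = {(i, j). inner i j \<and> reach i j}"
  have "B \<subseteq> {..m} \<times> {..n}" by (auto simp: B_def inner_def)
  hence finB: "finite B" by (rule finite_subset) simp
  have "\<forall>p. \<exists>UW. p \<in> B \<longrightarrow> (\<forall>i j. vint i j \<longrightarrow> fst UW i j = 0) \<and> (\<forall>i j. hint i j \<longrightarrow> snd UW i j = 0) \<and>
     (\<forall>i j. inner i j \<longrightarrow> curl (fst UW) (snd UW) i j = (if (i, j) = p then - curl U W i j else 0))"
  proof
    fix p :: "nat \<times> nat"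
    obtain i0 j0 where p: "p = (i0, j0)" by (cases p)
    show "\<exists>UW. p \<in> B \<longrightarrow> (\<forall>i j. vint i j \<longrightarrow> fst UW i j = 0) \<and> (\<forall>i j. hint i j \<longrightarrow> snd UW i j = 0) \<and>
     (\<forall>i j. inner i j \<longrightarrow> curl (fst UW) (snd UW) i j = (if (i, j) = p then - curl U W i j else 0))"
    proof (cases "p \<in> B")
      case True
      then have "reach i0 j0" by (simp add: p B_def)
      from reach_routable[OF this, of "- curl U W i0 j0", unfolded routable_def] obtain U' W' where
        "\<forall>i j. vint i j \<longrightarrow> U' i j = 0" "\<forall>i j. hint i j \<longrightarrow> W' i j = 0"
        "\<forall>i j. inner i j \<longrightarrow> curl U' W' i j = (if i = i0 \<and> j = j0 then - curl U W i0 j0 else 0)"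
        by (elim exE conjE)
      then show ?thesis by (intro exI[of _ "(U', W')"]) (simp add: p)
    qed simp
  qed
  from choice[OF this] obtain X where X: "\<And>p i j. p \<in> B \<Longrightarrow> vint i j \<Longrightarrow> fst (X p) i j = 0"
     "\<And>p i j. p \<in> B \<Longrightarrow> hint i j \<Longrightarrow> snd (X p) i j = 0"
     "\<And>p i j. p \<in> B \<Longrightarrow> inner i j \<Longrightarrow> curl (fst (X p)) (snd (X p)) i j
       = (if (i, j) = p then - curl U W i j else 0)"
    by blast
  define U' where "U' i j = U i j + (\<Sum>p\<in>B. fst (X p) i j)" for i j
  define W' where "W' i j = W i j + (\<Sum>p\<in>B. snd (X p) i j)" for i j
  have "curl U' W' i j = 0" if inn: "inner i j" for i j
  proof -
    have "curl U' W' i j = curl U W i j + (\<Sum>p\<in>B. curl (fst (X p)) (snd (X p)) i j)"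
      unfolding U'_def W'_def curl_add curl_sum ..
    also have "(\<Sum>p\<in>B. curl (fst (X p)) (snd (X p)) i j)
      = (\<Sum>p\<in>B. if (i, j) = p then - curl U W i j else 0)"
      using X(3) inn by (intro sum.cong) auto
    also have "\<dots> = (if (i, j) \<in> B then - curl U W i j else 0)" using finB by simp
    finally have eq: "curl U' W' i j = curl U W i j + (if (i, j) \<in> B then - curl U W i j else 0)" .
    show ?thesis
    proof (cases "reach i j")
      case True thus ?thesis using eq inn by (simp add: B_def)
    next
      case False
      obtain i' j' where ij: "i = Suc i'" "j = Suc j'" using inn
        by (auto simp: inner_def Suc_le_eq gr0_conv_Suc)
      \<comment> \<open>A missing cell at this vertex would be reached, and the vertex with
        it.\<close>
      have fl: "fill a b" if ab: "a \<in> {i', i}" "b \<in> {j', j}" for a b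
      proof (rule ccontr)
        assume nf: "\<not> fill a b"
        have "a < m" "b < n" using ab inn by (auto simp: ij inner_def)
        from unfilled_corner_reach[OF nf reach[OF this nf], of i j] ab False show False
          by (auto simp: ij)
      qed
      have "curl U W i j = 0"
        using closed[of i' j'] fl by (simp add: curl_def U_def W_def hint_def vint_def ij)
      thus ?thesis using eq by simp
    qed
  qed
  from curl_free_exact[of U' W', OF this] obtain P where
    P: "\<And>i j. P i (Suc j) - P i j = W' i (Suc j)"
       "\<And>i j. Suc i < m \<Longrightarrow> j < n \<Longrightarrow> P (Suc i) j - P i j = U' (Suc i) j" by blast
  have "P i (Suc j) - P i j = w i (Suc j)" if "fill i j" "fill i (Suc j)" for i j
  proof -
    have "hint i (Suc j)" using that by (simp add: hint_def)
    thus ?thesis using P(1) X(2) by (simp add: W'_def W_def)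
  qed
  moreover have "P (Suc i) j - P i j = u (Suc i) j" if "fill i j" "fill (Suc i) j" for i j
  proof -
    have "vint (Suc i) j" using that by (simp add: vint_def)
    thus ?thesis using P(2) X(1) bound[OF that(2)] by (simp add: U'_def U_def)
  qed
  ultimately show ?thesis by blast
qed

end

section \<open>The grid of all side coordinates\<close>

context mesh begin

definition coord :: "orientation \<Rightarrow> nat \<Rightarrow> real" where
  "coord k i = sorted_list_of_set (coords k) ! i"

text \<open>The number of gaps between consecutive coordinates, hence the index of the last one:
  grid lines are numbered up to \<open>ncoord k\<close> inclusive, grid cells strictly below
  it.\<close>

definition ncoord :: "orientation \<Rightarrow> nat" where
  "ncoord k = card (coords k) - 1"

lemma coords_nonempty: "coords k \<noteq> {}"
  using T_nonempty by (simp add: coords_def)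

lemma card_coords: "card (coords k) = Suc (ncoord k)"
  using coords_nonempty[of k] by (simp add: ncoord_def card_gt_0_iff Suc_diff_1)

lemma coord_less_iff: "i \<le> ncoord k \<Longrightarrow> j \<le> ncoord k \<Longrightarrow> coord k i < coord k j \<longleftrightarrow> i < j"
proof -
  have "coord k i < coord k j" if "i < j" "j \<le> ncoord k" for i j
    unfolding coord_def using that
    by (intro sorted_wrt_nth_less[OF strict_sorted_list_of_set]) (simp_all add: card_coords)
  moreover assume "i \<le> ncoord k" "j \<le> ncoord k"
  ultimately show ?thesis by (metis less_asym less_irrefl linorder_neqE_nat)
qed

lemma coord_coords: "coords k = coord k ` {..ncoord k}"
proof -
  have "coords k = set (sorted_list_of_set (coords k))" by simp
  also have "\<dots> = coord k ` {..ncoord k}" unfolding coord_def set_conv_nth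
    by (auto simp: card_coords less_Suc_eq_le)
  finally show ?thesis .
qed

lemma coords_gxE: assumes "z \<in> coords k" obtains i where "i \<le> ncoord k" "z = coord k i"
  using assms coord_coords by auto

lemma coord_gap: "z \<in> coords k \<Longrightarrow> i < ncoord k \<Longrightarrow> z < coord k (Suc i) \<longleftrightarrow> z \<le> coord k i"
  using coord_less_iff[of _ k "Suc i"] coord_less_iff[of i k]
    by (elim coords_gxE) (force simp: not_less[symmetric])

text \<open>No side coordinate lies strictly between consecutive grid lines, so being just left of
  one line is the same as being just right of the previous one. This lets every quadrant be named by
  the lower left corner of a grid cell.\<close>

lemma side_shift:
  assumes "a \<in> coords k" "b \<in> coords k" "i < ncoord k"
  shows "side False a b (coord k (Suc i)) \<longleftrightarrow> side True a b (coord k i)"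
  using coord_gap[OF assms(1,3)] coord_gap[OF assms(2,3)] by auto

lemma germ_shift:
  assumes "F \<in> T" "i < ncoord Horizontal" "j < ncoord Vertical"
  shows "germ Horizontal s r (coord Horizontal (Suc i)) (coord Vertical (Suc j)) F \<longleftrightarrow>
    germ Horizontal True True (coord Horizontal (if s then Suc i else i))
      (coord Vertical (if r then Suc j else j)) F"
  using side_shift[OF coordsI[OF assms(1)] assms(2)] side_shift[OF coordsI[OF assms(1)] assms(3)]
  by (cases s; cases r) (simp_all add: germ_def del: side_simps)

definition filled :: "nat \<Rightarrow> nat \<Rightarrow> bool" where
  "filled i j \<longleftrightarrow> i < ncoord Horizontal \<and> j < ncoord Vertical \<and>
     (\<exists>F\<in>T. germ Horizontal True True (coord Horizontal i) (coord Vertical j) F)"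

sublocale grid filled "ncoord Horizontal" "ncoord Vertical" .

definition gbox :: "nat \<Rightarrow> nat \<Rightarrow> (real \<times> real) set" where
  "gbox i j = {coord Horizontal i..coord Horizontal (Suc i)} \<times>
    {coord Vertical j..coord Vertical (Suc j)}"

lemma filled_gbox: "filled i j \<Longrightarrow> gbox i j \<subseteq> mesh_domain T"
proof
  fix z assume f: "filled i j" and z: "z \<in> gbox i j"
  obtain x y where xy: "z = pt Horizontal x y" by (rule pt_exhaust)
  obtain F where F: "F \<in> T" "germ Horizontal True True (coord Horizontal i) (coord Vertical j) F"
    using f unfolding filled_def by blast
  have "coord k (Suc i) \<le> hi k F" if "coord k i < hi k F" "i < ncoord k" for k i
    using coord_gap[OF coordsI(2)[OF F(1)] that(2)] that(1) by auto
  then have "z \<in> F" using F(2) f z unfolding xy pt_in_cell[OF F(1)]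
    by (auto simp: germ_def gbox_def filled_def intro: order.trans)
  thus "z \<in> mesh_domain T" using F(1) by (auto simp: mesh_domain_def)
qed

lemma unfilled_gbox_point:
  assumes "\<not> filled i j" "i < ncoord Horizontal" "j < ncoord Vertical"
  obtains z where "z \<in> gbox i j" "z \<notin> mesh_domain T"
proof -
  obtain x where x: "coord Horizontal i < x" "x < coord Horizontal (Suc i)"
    using coord_less_iff[of i Horizontal "Suc i"] assms dense by auto
  obtain y where y: "coord Vertical j < y" "y < coord Vertical (Suc j)"
    using coord_less_iff[of j Vertical "Suc j"] assms dense by auto
  have "pt Horizontal x y \<notin> mesh_domain T"
  proof
    assume "pt Horizontal x y \<in> mesh_domain T"
    then obtain F where F: "F \<in> T" "pt Horizontal x y \<in> F" by (auto simp: mesh_domain_def)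
    have "lo k F \<le> coord k i \<and> coord k i < hi k F" if "coord k i < t" "t < coord k (Suc i)"
      "lo k F \<le> t" "t \<le> hi k F" "i < ncoord k" for k i t
      using coord_gap[OF coordsI(1)[OF F(1)] that(5)] that by auto
    then have "germ Horizontal True True (coord Horizontal i) (coord Vertical j) F"
      using F(2) x y assms(2,3) unfolding pt_in_cell[OF F(1)] by (auto simp: germ_def)
    thus False using assms F(1) by (auto simp: filled_def)
  qed
  thus ?thesis using x y by (intro that[of "pt Horizontal x y"]) (auto simp: gbox_def)
qed

lemma coord_interval:
  assumes "coord k 0 < z" "z < coord k (ncoord k)"
  obtains i where "i < ncoord k" "coord k i \<le> z" "z \<le> coord k (Suc i)"
proof -
  have "\<exists>i<ncoord k. coord k i \<le> z \<and> z < coord k (Suc i)"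
  proof (rule ccontr)
    assume neg: "\<not> ?thesis"
    have "i \<le> ncoord k \<Longrightarrow> coord k i \<le> z" for i
      using assms(1) neg by (induction i) (auto simp: not_less)
    from this[of "ncoord k"] assms(2) show False by simp
  qed
  thus ?thesis using that by force
qed

lemma coord_common:
  assumes "coord k i \<le> z" "z \<le> coord k (Suc i)" "coord k i' \<le> z" "z \<le> coord k (Suc i')"
    "i < ncoord k" "i' < ncoord k"
  obtains a where "a \<in> {i, Suc i}" "a \<in> {i', Suc i'}"
proof -
  have "\<not> coord k (Suc i) < coord k i'" "\<not> coord k (Suc i') < coord k i" using assms by auto
  hence "i' \<le> Suc i" "i \<le> Suc i'" using coord_less_iff[of "Suc i" k i']
    coord_less_iff[of "Suc i'" k i] assms by auto
  thus ?thesis using that[of i] that[of i'] by (cases "i \<le> i'") force+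
qed

lemma compact_gbox: "compact (gbox i j)"
  unfolding gbox_def by (intro compact_Times compact_Icc)

text \<open>Unreached unfilled boxes form a compact set \<open>B\<close>. Boxes sharing a point
  share a corner, so \<open>B\<close> avoids the reached boxes and the outside of the grid. A
  component of the complement that meets \<open>B\<close> cannot leave it and would be a
  hole.\<close>

lemma unfilled_reach:
  assumes holes: "\<And>C. C \<in> components (- mesh_domain T) \<Longrightarrow> \<not> bounded C"
    and ij: "i < ncoord Horizontal" "j < ncoord Vertical" "\<not> filled i j"
  shows "reach i j"
proof (rule ccontr)
  assume nr: "\<not> reach i j"
  let ?h = "ncoord Horizontal" and ?v = "ncoord Vertical"
  let ?x = "coord Horizontal" and ?y = "coord Vertical"
  let ?I = "{(i, j). i < ?h \<and> j < ?v \<and> \<not> filled i j}"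
  let ?R = "{(i, j). (i, j) \<in> ?I \<and> reach i j}" and ?N = "{(i, j). (i, j) \<in> ?I \<and> \<not> reach i j}"
  have fin: "finite ?R" "finite ?N" by (rule finite_subset[of _ "{..<?h} \<times> {..<?v}"]; auto)+
  \<comment> \<open>The half-planes account for all points on the rim of the bounding box and
    beyond, so that \<open>A\<close> and \<open>B\<close> cover the complement of the
    domain.\<close>
  define A where "A = (\<Union>(i, j)\<in>?R. gbox i j) \<union> {z. fst z \<le> ?x 0} \<union> {z. ?x ?h \<le> fst z} \<union>
    {z. snd z \<le> ?y 0} \<union> {z. ?y ?v \<le> snd z}"
  define B where "B = (\<Union>(i, j)\<in>?N. gbox i j)"
  have clA: "closed A" unfolding A_def
    by (intro closed_Un closed_UN fin closed_Collect_le continuous_intros ballI)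
       (auto intro: compact_imp_closed compact_gbox)
  have compB: "compact B" unfolding B_def using fin compact_gbox by (intro compact_UN) auto
  have disj: "A \<inter> B = {}"
  proof (rule ccontr)
    assume "A \<inter> B \<noteq> {}"
    then obtain z i j where z: "z \<in> A" "z \<in> gbox i j" and ij: "i < ?h" "j < ?v" "\<not> filled i j"
      "\<not> reach i j"
      unfolding B_def by auto
    have zx: "?x i \<le> fst z" "fst z \<le> ?x (Suc i)" "?y j \<le> snd z" "snd z \<le> ?y (Suc j)"
      using z(2) by (auto simp: gbox_def)
    have key: "\<not> reach a b" if "a \<in> {i, Suc i}" "b \<in> {j, Suc j}" for a b
      using unfilled_reach_corner[OF ij(3) _ that] ij(4) by blast
    from z(1) consider i' j' where "(i', j') \<in> ?R" "z \<in> gbox i' j'" | "fst z \<le> ?x 0" |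
      "?x ?h \<le> fst z"
       | "snd z \<le> ?y 0" | "?y ?v \<le> snd z" unfolding A_def by blast
    then show False
    proof cases
      case 1
      then have zx': "?x i' \<le> fst z" "fst z \<le> ?x (Suc i')" "?y j' \<le> snd z" "snd z \<le> ?y (Suc j')"
        by (auto simp: gbox_def)
      obtain a where a: "a \<in> {i, Suc i}" "a \<in> {i', Suc i'}"
        using coord_common[OF zx(1,2) zx'(1,2)] ij 1 by auto
      obtain b where b: "b \<in> {j, Suc j}" "b \<in> {j', Suc j'}"
        using coord_common[OF zx(3,4) zx'(3,4)] ij 1 by auto
      have "reach a b" by (rule unfilled_corner_reach[OF _ _ a(2) b(2)]) (use 1 in auto)
      thus False using key a b by blast
    next
      case 2
      then have "\<not> ?x 0 < ?x i" using zx by simp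
      then have "i = 0" using coord_less_iff[of 0 Horizontal i] ij by simp
      thus False using key[of i j] outside[of i j] by (simp add: inner_def)
    next
      case 3
      then have "\<not> ?x (Suc i) < ?x ?h" using zx by simp
      then have "Suc i = ?h" using coord_less_iff[of "Suc i" Horizontal ?h] ij by simp
      thus False using key[of "Suc i" j] outside[of "Suc i" j] by (simp add: inner_def)
    next
      case 4
      then have "\<not> ?y 0 < ?y j" using zx by simp
      then have "j = 0" using coord_less_iff[of 0 Vertical j] ij by simp
      thus False using key[of i j] outside[of i j] by (simp add: inner_def)
    next
      case 5
      then have "\<not> ?y (Suc j) < ?y ?v" using zx by simp
      then have "Suc j = ?v" using coord_less_iff[of "Suc j" Vertical ?v] ij by simp
      thus False using key[of i "Suc j"] outside[of i "Suc j"] by (simp add: inner_def)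
    qed
  qed
  have cover: "- mesh_domain T \<subseteq> A \<union> B"
  proof
    fix z assume z: "z \<in> - mesh_domain T"
    show "z \<in> A \<union> B"
    proof (cases "?x 0 < fst z \<and> fst z < ?x ?h \<and> ?y 0 < snd z \<and> snd z < ?y ?v")
      case True
      obtain i where i: "i < ?h" "?x i \<le> fst z" "fst z \<le> ?x (Suc i)" using coord_interval True
        by metis
      obtain j where j: "j < ?v" "?y j \<le> snd z" "snd z \<le> ?y (Suc j)" using coord_interval True
        by metis
      have zb: "z \<in> gbox i j" using i j by (cases z) (auto simp: gbox_def)
      have "\<not> filled i j" using filled_gbox zb z by blast
      thus ?thesis using zb i j unfolding A_def B_def by blast
    next
      case False
      thus ?thesis unfolding A_def by auto
    qed
  qed
  obtain p where p: "p \<in> gbox i j" "p \<notin> mesh_domain T" using unfilled_gbox_point ij by metis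
  have pB: "p \<in> B" unfolding B_def using p ij nr by blast
  define C where "C = connected_component_set (- mesh_domain T) p"
  have "C \<in> components (- mesh_domain T)" unfolding C_def using p(2) by (auto simp: components_def)
  then have nb: "\<not> bounded C" by (rule holes)
  have conn: "connected C" and pC: "p \<in> C" and Csub: "C \<subseteq> - mesh_domain T"
    unfolding C_def using p(2) connected_component_subset by (auto simp: connected_component_refl)
  have "A \<inter> C = {}"
    using conn[unfolded connected_closed] clA compact_imp_closed[OF compB] cover Csub disj pB pC
      by blast
  then have "C \<subseteq> B" using cover Csub by blast
  then show False using nb bounded_subset[OF compact_imp_bounded[OF compB]] by blast
qed

end

section \<open>Exactness of jumps on the mesh\<close>

context simple_mesh begin

text \<open>\<open>rj k t c\<close> and \<open>lj k t c\<close> stand for the jumps across the line in direction \<open>k\<close> just after and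
  just before the point \<open>pt k t c\<close>.\<close>

lemma jumps_exact:
  fixes rj lj :: "orientation \<Rightarrow> real \<Rightarrow> real \<Rightarrow> 'a::ab_group_add"
  assumes shift: "\<And>k t t' c. t < t' \<Longrightarrow> (\<And>z. z \<in> coords k \<Longrightarrow> z < t' \<longleftrightarrow> z \<le> t) \<Longrightarrow> lj k t' c = rj k t c"
    and closed: "\<And>k t c. pt k t c \<in> interior (mesh_domain T) \<Longrightarrow>
        rj k t c - lj k t c = rj (flip k) c t - lj (flip k) c t"
    and zero: "\<And>k t c. \<not> edge_after k t c \<Longrightarrow> rj k t c = 0"
  shows "\<exists>P. \<forall>k F G a b c. adj k F G a b c \<longrightarrow> P F - P G = rj k a c"
proof -
  let ?h = "ncoord Horizontal" and ?v = "ncoord Vertical"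
  let ?x = "coord Horizontal" and ?y = "coord Vertical"
  let ?g = "\<lambda>i j F. germ Horizontal True True (?x i) (?y j) F"
  \<comment> \<open>The prescribed jumps across the grid edges leaving vertex \<open>(i, j)\<close>
    upwards and to the right, read off just after that vertex.\<close>
  define u where "u i j = rj Vertical (?y j) (?x i)" for i j
  define w where "w i j = rj Horizontal (?x i) (?y j)" for i j
  have lj: "lj k (coord k (Suc i)) c = rj k (coord k i) c" if "i < ncoord k" for k i c
    by (rule shift) (use coord_gap that coord_less_iff[of i k "Suc i"] in auto)
  have "\<exists>P. (\<forall>i j. filled i j \<longrightarrow> filled i (Suc j) \<longrightarrow> P i (Suc j) - P i j = w i (Suc j)) \<and>
     (\<forall>i j. filled i j \<longrightarrow> filled (Suc i) j \<longrightarrow> P (Suc i) j - P i j = u (Suc i) j)"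
  proof (rule locally_closed_exact)
    fix i j assume f: "filled i j" "filled (Suc i) j" "filled i (Suc j)" "filled (Suc i) (Suc j)"
    then have lt: "i < ?h" "j < ?v" by (auto simp: filled_def)
    have "pt Horizontal (?x (Suc i)) (?y (Suc j)) \<in> interior (mesh_domain T)"
      unfolding interior_iff_germs
    proof (intro allI)
      fix s r
      have "filled (if s then Suc i else i) (if r then Suc j else j)" using f by auto
      then show "\<exists>F\<in>T. germ Horizontal s r (?x (Suc i)) (?y (Suc j)) F"
        unfolding filled_def using germ_shift[OF _ lt] by blast
    qed
    from closed[OF this] show "w (Suc i) (Suc j) - w i (Suc j) = u (Suc i) (Suc j) - u (Suc i) j"
      unfolding u_def w_def using lj lt by simp
  next
    fix i j assume "i < ?h" "j < ?v" "\<not> filled i j"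
    then show "reach i j" using no_holes unfilled_reach unfolding without_holes_def by blast
  qed (auto simp: filled_def)
  then obtain Q where Q: "\<And>i j. filled i j \<Longrightarrow> filled i (Suc j) \<Longrightarrow> Q i (Suc j) - Q i j = w i (Suc j)"
     "\<And>i j. filled i j \<Longrightarrow> filled (Suc i) j \<Longrightarrow> Q (Suc i) j - Q i j = u (Suc i) j" by blast
  have g_filled: "filled i j" if "F \<in> T" "?g i j F" "i \<le> ?h" "j \<le> ?v" for i j F
  proof -
    have "i < ncoord k" if "coord k i < hi k F" "i \<le> ncoord k" for k i
    proof -
      obtain i' where "i' \<le> ncoord k" "hi k F = coord k i'"
        using coordsI(2)[OF \<open>F \<in> T\<close>] coords_gxE by metis
      thus ?thesis using that coord_less_iff[of i k i'] by auto
    qed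
    then show ?thesis using that by (auto simp: filled_def germ_def)
  qed
  have noR: "\<not> edge_after k t c" if "F \<in> T" "germ k True True t c F" "germ k True False t c F"
    for F k t c
  proof
    assume "edge_after k t c"
    then obtain F' G' a b where "adj k F' G' a b c" "side True a b t"
      using edge_after_adjE side_simps(1) by metis
    from adj_germ_cell[OF this that(1,2)] adj_germ_cell[OF this that(1,3)] adj_neq[OF this(1)]
    show False by simp
  qed
  \<comment> \<open>Inside one mesh cell no edge separates neighbouring grid cells, so
    \<open>Q\<close> does not change between them. The walk along a row and then a column stays in
    the cell because it is a box.\<close>
  have const: "Q i j = Q i' j'" if F: "F \<in> T" and g: "?g i j F" "?g i' j' F" and le: "i \<le> ?h"
    "i' \<le> ?h" "j \<le> ?v" "j' \<le> ?v"
    for F i j i' j'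
  proof -
    have mono: "coord k i \<le> coord k l" if "i \<le> l" "l \<le> ncoord k" for k i l
      using coord_less_iff[of l k i] that by (auto simp: not_less[symmetric])
    have A: "Q i j = Q i' j" if "i \<le> i'" "i' \<le> ?h" "?g i j F" "?g i' j F" "j \<le> ?v" for i i' j
      using that
    proof (induction rule: dec_induct)
      case (step l)
      have gl: "?g l j F" using step.prems step.hyps mono[of i l Horizontal]
        mono[of l "Suc l" Horizontal]
        by (auto simp: germ_def)
      have "filled l j" "filled (Suc l) j"
        using g_filled[OF F gl] g_filled[OF F step.prems(3)] step by auto
      from Q(2)[OF this] have "Q (Suc l) j - Q l j = rj Vertical (?y j) (?x (Suc l))"
        by (simp add: u_def)
      also have "\<dots> = 0"
      proof (intro zero noR[OF F])
        show "germ Vertical True True (?y j) (?x (Suc l)) F"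
          using step.prems(3) germ_flip[of Horizontal] by simp
        show "germ Vertical True False (?y j) (?x (Suc l)) F"
          using gl side_shift[OF coordsI[OF F], of l Horizontal] step.hyps step.prems
            by (simp add: germ_def)
      qed
      finally show ?case using step gl by simp
    qed simp
    have B: "Q i j = Q i j'" if "j \<le> j'" "j' \<le> ?v" "?g i j F" "?g i j' F" "i \<le> ?h" for i j j'
      using that
    proof (induction rule: dec_induct)
      case (step l)
      have gl: "?g i l F" using step.prems step.hyps mono[of j l Vertical]
        mono[of l "Suc l" Vertical]
        by (auto simp: germ_def)
      have "filled i l" "filled i (Suc l)"
        using g_filled[OF F gl] g_filled[OF F step.prems(3)] step by auto
      from Q(1)[OF this] have "Q i (Suc l) - Q i l = rj Horizontal (?x i) (?y (Suc l))"
        by (simp add: w_def)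
      also have "\<dots> = 0"
      proof (intro zero noR[OF F])
        show "germ Horizontal True True (?x i) (?y (Suc l)) F" using step.prems(3) by simp
        show "germ Horizontal True False (?x i) (?y (Suc l)) F"
          using gl side_shift[OF coordsI[OF F], of l Vertical] step.hyps step.prems
            by (simp add: germ_def)
      qed
      finally show ?case using step gl by simp
    qed simp
    have mid: "?g i' j F" using g by (auto simp: germ_def)
    have "Q i j = Q i' j"
    proof (cases "i \<le> i'")
      case True show ?thesis by (rule A[OF True le(2) g(1) mid le(3)])
    next
      case False show ?thesis by (rule A[symmetric, OF _ le(1) mid g(1) le(3)]) (use False in simp)
    qed
    also have "\<dots> = Q i' j'"
    proof (cases "j \<le> j'")
      case True show ?thesis by (rule B[OF True le(4) mid g(2) le(2)])
    next
      case False show ?thesis by (rule B[symmetric, OF _ le(3) g(2) mid le(2)]) (use False in simp)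
    qed
    finally show ?thesis .
  qed
  define P where "P F = (SOME q. \<exists>i j. ?g i j F \<and> i \<le> ?h \<and> j \<le> ?v \<and> q = Q i j)" for F
  have P: "P F = Q i j" if F: "F \<in> T" "?g i j F" "i \<le> ?h" "j \<le> ?v" for F i j
  proof -
    have "\<exists>i' j'. ?g i' j' F \<and> i' \<le> ?h \<and> j' \<le> ?v \<and> P F = Q i' j'"
      unfolding P_def by (rule someI[of _ "Q i j"]) (use that in blast)
    then obtain i' j' where "?g i' j' F" "i' \<le> ?h" "j' \<le> ?v" "P F = Q i' j'" by blast
    with const[OF F(1,2) this(1) F(3) this(2) F(4) this(3)] show ?thesis by simp
  qed
  have ix: "\<exists>i\<le>ncoord k. a = coord k i" if "a \<in> coords k" for a k using that coords_gxE by metis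
  \<comment> \<open>The upper bound of a cell is never the first coordinate, so a grid line precedes
    it.\<close>
  have ix1: "\<exists>j. c = coord k (Suc j) \<and> j < ncoord k" if HF: "F \<in> T" "hi k F = c" for F k c
  proof -
    obtain i where i: "i \<le> ncoord k" "c = coord k i" using ix coordsI(2)[OF HF(1)] HF(2) by metis
    obtain i' where i': "i' \<le> ncoord k" "lo k F = coord k i'" using ix coordsI(1)[OF HF(1)] by metis
    have "i' < i" using coord_less_iff[OF i'(1) i(1)] cell_box(2)[OF HF(1), of k] i i' HF(2) by simp
    then show ?thesis using i by (cases i) auto
  qed
  have ina: "a \<in> coords k" if "adj k F G a b c" for k F G a b c
    using that coordsI by (auto simp: adj_def max_def)
  have "P F - P G = rj k a c" if adj: "adj k F G a b c" for k F G a b c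
  proof (cases k)
    case Horizontal
    obtain i where i: "i \<le> ?h" "a = ?x i" using ix ina[OF adj] Horizontal by metis
    obtain j where j: "c = ?y (Suc j)" "j < ?v" using ix1[of G Vertical c] adj
      unfolding Horizontal by (auto simp: adj_def)
    have gF: "?g i (Suc j) F" "germ Horizontal True False (?x i) (?y (Suc j)) G"
      using adj_germ[OF adj, of True a] adjD(3)[OF adj]
        unfolding Horizontal i(2)[symmetric] j(1)[symmetric] by auto
    have gG: "?g i j G" using gF(2) side_shift[OF coordsI[OF adjD(2)[OF adj]] j(2)]
      by (simp add: germ_def)
    have "P F - P G = Q i (Suc j) - Q i j"
      using P[OF adjD(1)[OF adj] gF(1)] P[OF adjD(2)[OF adj] gG] i j by simp
    also have "\<dots> = w i (Suc j)"
      using g_filled[OF adjD(1)[OF adj] gF(1)] g_filled[OF adjD(2)[OF adj] gG] i j by (intro Q) auto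
    finally show ?thesis by (simp add: w_def i j Horizontal)
  next
    case Vertical
    obtain j where j: "j \<le> ?v" "a = ?y j" using ix ina[OF adj] Vertical by metis
    obtain i where i: "c = ?x (Suc i)" "i < ?h" using ix1[of G Horizontal c] adj
      unfolding Vertical by (auto simp: adj_def)
    have gF: "germ Vertical True True (?y j) (?x (Suc i)) F"
      "germ Vertical True False (?y j) (?x (Suc i)) G"
      using adj_germ[OF adj, of True a] adjD(3)[OF adj]
        unfolding Vertical j(2)[symmetric] i(1)[symmetric] by auto
    have gF1: "?g (Suc i) j F" using gF(1) by (simp add: germ_def)
    have gG: "?g i j G" using gF(2) side_shift[OF coordsI[OF adjD(2)[OF adj]] i(2)]
      by (simp add: germ_def)
    have "P F - P G = Q (Suc i) j - Q i j"
      using P[OF adjD(1)[OF adj] gF1] P[OF adjD(2)[OF adj] gG] i j by simp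
    also have "\<dots> = u (Suc i) j"
      using g_filled[OF adjD(1)[OF adj] gF1] g_filled[OF adjD(2)[OF adj] gG] i j by (intro Q) auto
    finally show ?thesis by (simp add: u_def i j Vertical)
  qed
  thus ?thesis by blast
qed

end

section \<open>Independence of the conditions on interior l-edges\<close>

lemma sum_fun_apply: "(\<Sum>i\<in>A. f i) j = (\<Sum>i\<in>A. f i j)"
  by (induction A rule: infinite_finite_induct) auto

section \<open>Jump data and the conditions on them\<close>

text \<open>Only cross-cuts carry an initial jump. On a ray or an interior l-edge the jump vanishes
  beyond an interior end, so the vertex jumps determine it.\<close>

datatype idx = Base | Cross orientation real real real | Vtx "real \<times> real"

locale spline_mesh = simple_mesh +
  fixes d1 d2 \<alpha> \<beta> :: nat
  assumes \<alpha>: "\<alpha> < d1" and \<beta>: "\<beta> < d2"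
begin

text \<open>Quantities along the line: on a horizontal line the free variable is \<open>x\<close>,
  and its vertices lie on vertical lines, where the smoothness is \<open>\<alpha>\<close>.\<close>

fun line_deg :: "orientation \<Rightarrow> nat" where "line_deg Horizontal = d1" | "line_deg Vertical = d2"
fun line_smooth :: "orientation \<Rightarrow> nat" where "line_smooth Horizontal = \<alpha>" | "line_smooth Vertical
  = \<beta>"

text \<open>Exponents across the line: a horizontal line carries a power of \<open>y - c\<close>, a
  vertical one a power of \<open>x - c\<close>.\<close>

fun vexp :: "orientation \<Rightarrow> nat" where "vexp Horizontal = 0" | "vexp Vertical = \<alpha> + 1"
fun hexp :: "orientation \<Rightarrow> nat" where "hexp Horizontal = \<beta> + 1" | "hexp Vertical = 0"

text \<open>\<open>c\<close> is passed for both coordinates so that one expression serves both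
  orientations; the exponents select the factor that is present.\<close>

definition line_space :: "orientation \<Rightarrow> real \<Rightarrow> real poly poly set" where
  "line_space k c = fac_space d1 d2 (vexp k) c (hexp k) c"

definition vertex_space :: "real \<times> real \<Rightarrow> real poly poly set" where
  "vertex_space v = fac_space d1 d2 (\<alpha> + 1) (fst v) (\<beta> + 1) (snd v)"

lemma line_space_iff: "p \<in> line_space k c \<longleftrightarrow> bidegree_le d1 d2 p \<and> smoothness_factor \<alpha> \<beta> k c dvd p"
  by (cases k) (simp_all add: line_space_def fac_space_def)

lemma vertex_space_sub: "p \<in> vertex_space (pt k t c) \<Longrightarrow> p \<in> line_space k c"
  unfolding vertex_space_def line_space_def fac_space_def
  by (cases k) (auto intro: dvd_mult_left dvd_mult_right simp del: power_Suc)

lemma vertex_spaceI: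
  assumes "p \<in> line_space k c" "p \<in> line_space (flip k) t"
  shows "p \<in> vertex_space (pt k t c)"
  using assms hfac_vfac_dvd unfolding line_space_iff vertex_space_def fac_space_def
  by (cases k) (auto simp del: power_Suc)

lemma line_space_zero [simp]: "0 \<in> line_space k c"
  by (simp add: line_space_def)

lemma line_space_add: "p \<in> line_space k c \<Longrightarrow> q \<in> line_space k c \<Longrightarrow> p + q \<in> line_space k c"
  and line_space_diff: "p \<in> line_space k c \<Longrightarrow> q \<in> line_space k c \<Longrightarrow> p - q \<in> line_space k c"
  unfolding line_space_def by (auto intro: subspace_fac_space)

lemma line_space_uminus: "p \<in> line_space k c \<Longrightarrow> - p \<in> line_space k c"
  using line_space_diff[of 0 k c p] by simp

lemma line_space_sum: "(\<And>i. i \<in> X \<Longrightarrow> p i \<in> line_space k c) \<Longrightarrow> (\<Sum>i\<in>X. p i) \<in> line_space k c"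
  unfolding line_space_def by (rule sum_in_fac_space)

text \<open>The source of the bound on mono-vertices: a vertex contributes
  \<open>line_deg k - line_smooth k\<close> dimensions in the variable along the line, and
  \<open>line_deg k + 1\<close> have to be spanned.\<close>

lemma line_space_split:
  assumes "finite S" "line_deg k + 1 \<le> card S * (line_deg k - line_smooth k)" "p \<in> line_space k c"
  shows "\<exists>r. (\<forall>t\<in>S. r t \<in> vertex_space (pt k t c)) \<and> p = (\<Sum>t\<in>S. r t)"
  using assms fac_space_split_x[of S d1 "\<alpha> + 1" "\<beta> + 1" d2 p c c]
    fac_space_split_y[of S d2 "\<beta> + 1" "\<alpha> + 1" d1 p c c] \<alpha> \<beta>
  by (cases k) (simp_all add: line_space_def vertex_space_def)

primrec idx_vexp :: "idx \<Rightarrow> nat" where "idx_vexp Base = 0" | "idx_vexp (Cross k a b c) = vexp k" |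
  "idx_vexp (Vtx v) = \<alpha> + 1"
primrec idx_hexp :: "idx \<Rightarrow> nat" where "idx_hexp Base = 0" | "idx_hexp (Cross k a b c) = hexp k" |
  "idx_hexp (Vtx v) = \<beta> + 1"
primrec idx_x :: "idx \<Rightarrow> real" where "idx_x Base = 0" | "idx_x (Cross k a b c) = c" |
  "idx_x (Vtx v) = fst v"
primrec idx_y :: "idx \<Rightarrow> real" where "idx_y Base = 0" | "idx_y (Cross k a b c) = c" |
  "idx_y (Vtx v) = snd v"

definition data_index :: "idx set" where
  "data_index = {Base} \<union> {Cross k a b c | k a b c. cross_cut T k a b c} \<union> Vtx ` interior_vertices T"

lemma data_index_simps [simp]: "Base \<in> data_index" "Cross k a b c \<in> data_index
  \<longleftrightarrow> cross_cut T k a b c"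
  "Vtx v \<in> data_index \<longleftrightarrow> v \<in> interior_vertices T"
  by (auto simp: data_index_def)

definition data_space :: "(idx \<Rightarrow> real poly poly) set" where
  "data_space = fam_space data_index
    (\<lambda>i. fac_space d1 d2 (idx_vexp i) (idx_x i) (idx_hexp i) (idx_y i))"

lemma data_space_iff: "\<phi> \<in> data_space \<longleftrightarrow> bidegree_le d1 d2 (\<phi> Base) \<and>
   (\<forall>k a b c. if cross_cut T k a b c then \<phi> (Cross k a b c) \<in> line_space k c
     else \<phi> (Cross k a b c) = 0) \<and>
   (\<forall>v. if v \<in> interior_vertices T then \<phi> (Vtx v) \<in> vertex_space v else \<phi> (Vtx v) = 0)"
     (is "_ \<longleftrightarrow> ?r")
proof -
  have B: "\<phi> Base \<in> fac_space d1 d2 (idx_vexp Base) (idx_x Base) (idx_hexp Base) (idx_y Base)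
    \<longleftrightarrow> bidegree_le d1 d2 (\<phi> Base)"
    by (simp add: fac_space_def)
  have "\<phi> \<in> data_space \<longleftrightarrow> (\<forall>i. if i \<in> data_index then \<phi> i \<in> fac_space d1 d2 (idx_vexp i) (idx_x i)
    (idx_hexp i) (idx_y i) else \<phi> i = 0)"
    by (auto simp: data_space_def fam_space_def)
  also have "\<dots> \<longleftrightarrow> ?r"
  proof
    assume *: "\<forall>i. if i \<in> data_index then \<phi> i \<in> fac_space d1 d2 (idx_vexp i) (idx_x i)
      (idx_hexp i) (idx_y i) else \<phi> i = 0"
    show ?r
    proof (intro conjI allI)
      show "bidegree_le d1 d2 (\<phi> Base)" using *[rule_format, of Base] B by simp
      show "if cross_cut T k a b c then \<phi> (Cross k a b c) \<in> line_space k c else \<phi> (Cross k a b c)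
        = 0" for k a b c
        using *[rule_format, of "Cross k a b c"] by (simp add: line_space_def split: if_splits)
      show "if v \<in> interior_vertices T then \<phi> (Vtx v) \<in> vertex_space v else \<phi> (Vtx v) = 0" for v
        using *[rule_format, of "Vtx v"] by (simp add: vertex_space_def split: if_splits)
    qed
  next
    assume r: ?r
    show "\<forall>i. if i \<in> data_index then \<phi> i \<in> fac_space d1 d2 (idx_vexp i) (idx_x i) (idx_hexp i)
      (idx_y i) else \<phi> i = 0"
    proof
      fix i show "if i \<in> data_index then \<phi> i \<in> fac_space d1 d2 (idx_vexp i) (idx_x i) (idx_hexp i)
        (idx_y i) else \<phi> i = 0"
      proof (cases i)
        case Base then show ?thesis using r B by simp
      next
        case (Cross k a b c)
        then show ?thesis using conjunct1[OF conjunct2[OF r], rule_format, of k a b c]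
          by (simp add: line_space_def split: if_splits)
      next
        case (Vtx v)
        then show ?thesis using conjunct2[OF conjunct2[OF r], rule_format, of v]
          by (simp add: vertex_space_def split: if_splits)
      qed
    qed
  qed
  finally show ?thesis .
qed

lemma data_space_vtx: "\<phi> \<in> data_space \<Longrightarrow> v \<in> interior_vertices T \<Longrightarrow> \<phi> (Vtx v) \<in> vertex_space v"
  using data_space_iff[of \<phi>] by metis

definition constraint_index :: "(orientation \<times> real \<times> real \<times> real) set" where
  "constraint_index = {(k, a, b, c). interior_l_edge T k a b c}"

definition constraint_space :: "(orientation \<times> real \<times> real \<times> real \<Rightarrow> real poly poly) set" where
  "constraint_space = fam_space constraint_index
    (\<lambda>i. fac_space d1 d2 (vexp (fst i)) (snd (snd (snd i))) (hexp (fst i)) (snd (snd (snd i))))"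

lemma constraint_space_iff: "\<psi> \<in> constraint_space \<longleftrightarrow>
   (\<forall>k a b c. if interior_l_edge T k a b c then \<psi> (k, a, b, c) \<in> line_space k c
     else \<psi> (k, a, b, c) = 0)"
  unfolding constraint_space_def fam_space_def constraint_index_def line_space_def by auto

text \<open>The jump along an interior l-edge vanishes before its lower and beyond its upper end, so
  the changes at its vertices must sum to 0. The admissible data form the kernel.\<close>

definition constraint_map :: "(idx \<Rightarrow> real poly poly) \<Rightarrow>
  (orientation \<times> real \<times> real \<times> real \<Rightarrow> real poly poly)" where
  "constraint_map \<phi> = (\<lambda>(k, a, b, c). if interior_l_edge T k a b c
     then (\<Sum>v\<in>{v \<in> interior_vertices T. v \<in> seg k a b c}. \<phi> (Vtx v)) else 0)"

lemma interior_l_edge_iff: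
  "interior_l_edge T k a b c \<longleftrightarrow> l_edge T k a b c \<and> pt k a c \<in> interior_vertices T
    \<and> pt k b c \<in> interior_vertices T"
  by (simp add: interior_l_edge_def)

lemma cross_cut_iff:
  "cross_cut T k a b c \<longleftrightarrow> l_edge T k a b c \<and> pt k a c \<notin> interior_vertices T
    \<and> pt k b c \<notin> interior_vertices T"
  using not_interior_vertex_iff l_edge_vertices unfolding cross_cut_def by blast

lemma ray_edge_iff:
  "ray_edge T k a b c \<longleftrightarrow> l_edge T k a b c
    \<and> (pt k a c \<in> interior_vertices T) \<noteq> (pt k b c \<in> interior_vertices T)"
  using not_interior_vertex_iff l_edge_vertices unfolding ray_edge_def by blast

lemma finite_all_l_edges: "finite {(k, a, b, c). l_edge T k a b c}"
proof -
  have "{(k, a, b, c). l_edge T k a b c} \<subseteq>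
    (\<Union>k\<in>{Horizontal, Vertical}. Pair k ` {(a, b, c). l_edge T k a b c})"
  proof clarify
    fix k a b c assume "l_edge T k a b c"
    then show "(k, a, b, c) \<in> (\<Union>k\<in>{Horizontal, Vertical}. Pair k ` {(a, b, c). l_edge T k a b c})"
      by (cases k) auto
  qed
  thus ?thesis by (rule finite_subset) (use finite_l_edges in simp)
qed

lemma finite_constraint_index: "finite constraint_index"
  by (rule finite_subset[OF _ finite_all_l_edges])
    (auto simp: constraint_index_def interior_l_edge_iff)

lemma finite_data_index: "finite data_index"
proof -
  have "{Cross k a b c | k a b c. cross_cut T k a b c} \<subseteq> (\<lambda>(k, a, b, c). Cross k a b c) `
    {(k, a, b, c). l_edge T k a b c}"
    by (force simp: cross_cut_iff)
  hence "finite {Cross k a b c | k a b c. cross_cut T k a b c}"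
    using finite_surj finite_all_l_edges by blast
  thus ?thesis using finite_interior_vertices by (simp add: data_index_def)
qed

lemma sum_seg:
  "(\<Sum>v\<in>{v \<in> interior_vertices T. v \<in> seg k a b c}. f v) =
   (\<Sum>t\<in>{t. a \<le> t \<and> t \<le> b \<and> pt k t c \<in> interior_vertices T}. f (pt k t c))"
proof -
  have "{v \<in> interior_vertices T. v \<in> seg k a b c} =
    (\<lambda>t. pt k t c) ` {t. a \<le> t \<and> t \<le> b \<and> pt k t c \<in> interior_vertices T}"
    by (auto simp: seg_def)
  thus ?thesis by (simp add: sum.reindex inj_on_def)
qed

lemma smult_sum_right: "smult a (\<Sum>i\<in>X. p i) = (\<Sum>i\<in>X. smult a (p i))"
  by (induction X rule: infinite_finite_induct) (simp_all add: smult_add_right)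

lemma linear_constraint_map: "Vector_Spaces.linear (\<lambda>r \<phi> i. smult [:r:] (\<phi> i))
  (\<lambda>r \<psi> i. smult [:r:] (\<psi> i)) constraint_map"
  unfolding Vector_Spaces.linear_iff
  by (intro conjI allI pf.vector_space_axioms ext)
    (auto simp: constraint_map_def sum.distrib smult_sum_right)

lemma constraint_map_in_constraint_space: "\<phi> \<in> data_space \<Longrightarrow> constraint_map \<phi> \<in> constraint_space"
  unfolding constraint_space_iff
proof (intro allI)
  fix k a b c assume D: "\<phi> \<in> data_space"
  have "(\<Sum>v\<in>{v \<in> interior_vertices T. v \<in> seg k a b c}. \<phi> (Vtx v)) \<in> line_space k c"
    unfolding sum_seg
  proof (rule line_space_sum)
    fix t assume "t \<in> {t. a \<le> t \<and> t \<le> b \<and> pt k t c \<in> interior_vertices T}"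
    then have "\<phi> (Vtx (pt k t c)) \<in> vertex_space (pt k t c)" using data_space_vtx[OF D] by simp
    thus "\<phi> (Vtx (pt k t c)) \<in> line_space k c" by (rule vertex_space_sub)
  qed
  thus "if interior_l_edge T k a b c then constraint_map \<phi> (k, a, b, c) \<in> line_space k c
    else constraint_map \<phi> (k, a, b, c) = 0"
    by (simp add: constraint_map_def)
qed

text \<open>At most one l-edge of each direction passes through a point, and at a mono-vertex one of
  the two is a cross-cut or a ray.\<close>

lemma no_interior_l_edge_at_mono:
  assumes le: "interior_l_edge T k a b c" and v: "pt k t c \<in> inner_mono_vertices T k a b c"
    and K: "interior_l_edge T k' a' b' c'" "pt k t c \<in> seg k' a' b' c'"
  shows "k' = k \<and> a' = a \<and> b' = b \<and> c' = c"
proof -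
  have t: "a \<le> t" "t \<le> b" and mono: "mono_vertex T (pt k t c)"
    using v by (auto simp: inner_mono_vertices_def)
  have uniq: "p = p' \<and> q = q'" if "l_edge T K p q r" "l_edge T K p' q' r" "pt K u r \<in> seg K p q r"
    "pt K u r \<in> seg K p' q' r"
    for K p q r p' q' u
    using l_edge_unique[OF that(1,2), of u] that(3,4) by simp
  obtain k1 a1 b1 c1 k2 a2 b2 c2 where 1: "interior_l_edge T k1 a1 b1 c1"
     and 2: "cross_cut T k2 a2 b2 c2 \<or> ray_edge T k2 a2 b2 c2"
     and 12: "seg k1 a1 b1 c1 \<inter> seg k2 a2 b2 c2 = {pt k t c}"
    using mono unfolding mono_vertex_def by blast
  have l2: "l_edge T k2 a2 b2 c2" "\<not> interior_l_edge T k2 a2 b2 c2"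
    using 2 unfolding cross_cut_iff ray_edge_iff interior_l_edge_iff by auto
  have in2: "pt k t c \<in> seg k2 a2 b2 c2" using 12 by auto
  \<comment> \<open>Otherwise the cross-cut or ray would coincide with the given interior
    l-edge.\<close>
  have "k2 \<noteq> k"
  proof
    assume k2: "k2 = k"
    then have "c2 = c" using in2 by simp
    then have "a2 = a \<and> b2 = b" using uniq[of k a b c a2 b2 t] l2(1) le in2 t k2
      by (auto simp: interior_l_edge_iff)
    thus False using l2(2) le k2 \<open>c2 = c\<close> by simp
  qed
  then have k2: "k2 = flip k" by (simp add: neq_iff_flip)
  have c2: "c2 = t" using in2 k2 pt_flip[of k c t] by (metis pt_in_seg)
  show ?thesis
  proof (cases "k' = k")
    case True
    then have "c' = c" using K(2) by simp
    then show ?thesis using uniq[of k a b c a' b' t] K le t True by (auto simp: interior_l_edge_iff)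
  next
    case False
    then have k': "k' = flip k" by (simp add: neq_iff_flip)
    have c': "c' = t" using K(2) k' pt_flip[of k c t] by (metis pt_in_seg)
    have "a' = a2 \<and> b' = b2"
      using uniq[of "flip k" a' b' t a2 b2 c] K l2(1) in2
        by (simp add: k' k2 c' c2 interior_l_edge_iff)
    thus ?thesis using K(1) l2(2) by (simp add: k' k2 c' c2)
  qed
qed

definition single :: "'i \<Rightarrow> real poly poly \<Rightarrow> 'i \<Rightarrow> real poly poly" where
  "single i p = (\<lambda>j. if j = i then p else 0)"

end

section \<open>Solving the conditions\<close>

text \<open>The \<open>+ 1\<close> counts the upper end, which joins the inner mono-vertices as a
  place where jumps are put.\<close>

locale mono_mesh = spline_mesh +
  assumes enough: "interior_l_edge T k a b c \<Longrightarrow>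
    line_deg k + 1 \<le> (card (inner_mono_vertices T k a b c) + 1) * (line_deg k - line_smooth k)"
begin

text \<open>Each interior l-edge is solved using its own mono-vertices and its upper end; the latter affects
  at most one other interior l-edge, whose upper end has a larger coordinate sum.\<close>

lemma single_in_range:
  assumes "interior_l_edge T k a b c" "p \<in> line_space k c"
  shows "single (k, a, b, c) p \<in> constraint_map ` data_space"
  using assms
proof (induction "card {(k', a', b', c'). interior_l_edge T k' a' b' c' \<and> b + c < b' + c'}"
  arbitrary: k a b c p rule: less_induct)
  case less
  note le = less.prems(1)
  have l: "l_edge T k a b c" and ends: "pt k a c \<in> interior_vertices T"
    "pt k b c \<in> interior_vertices T"
    using le by (auto simp: interior_l_edge_iff)
  have ab: "a < b" using l by (simp add: l_edge_iff)
  let ?M = "{t. pt k t c \<in> inner_mono_vertices T k a b c}"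
  have M: "a < t \<and> t < b \<and> pt k t c \<in> interior_vertices T" if "t \<in> ?M" for t
  proof -
    have "a \<le> t \<and> t \<le> b \<and> t \<noteq> a \<and> t \<noteq> b \<and> pt k t c \<in> vertices T"
      using that by (auto simp: inner_mono_vertices_def mono_vertex_def)
    then show ?thesis using l_edge_inside(3)[OF l, of t] interior_vertexI by auto
  qed
  have Mimg: "inner_mono_vertices T k a b c = (\<lambda>t. pt k t c) ` ?M"
    by (auto simp: inner_mono_vertices_def seg_def)
  have finM: "finite ?M"
    using finite_line_vertices[of "\<lambda>_. True" k c] M by (auto intro: rev_finite_subset)
  \<comment> \<open>The upper end is taken and not the lower one: a change at the lower end could
    spread to an l-edge whose coordinate sum is not larger.\<close>
  define S where "S = insert b ?M"
  have finS: "finite S" and cardS: "card S = card (inner_mono_vertices T k a b c) + 1"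
  proof -
    have "b \<notin> ?M" using M by blast
    moreover have "card ((\<lambda>t. pt k t c) ` ?M) = card ?M" by (rule card_image) (simp add: inj_on_def)
    ultimately show "card S = card (inner_mono_vertices T k a b c) + 1"
      unfolding S_def Mimg[symmetric] using finM by simp
  qed (simp add: S_def finM)
  have Siv: "a \<le> t \<and> t \<le> b \<and> pt k t c \<in> interior_vertices T" if "t \<in> S" for t
    using that M[of t] ends ab unfolding S_def by auto
  have "line_deg k + 1 \<le> card S * (line_deg k - line_smooth k)" unfolding cardS
    by (rule enough[OF le])
  from line_space_split[OF finS this less.prems(2)]
  obtain r where "(\<forall>t\<in>S. r t \<in> vertex_space (pt k t c)) \<and> p = (\<Sum>t\<in>S. r t)" by (elim exE)
  then have r: "\<And>t. t \<in> S \<Longrightarrow> r t \<in> vertex_space (pt k t c)" "p = (\<Sum>t\<in>S. r t)" by auto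
  define \<phi> where "\<phi> i = (case i of Vtx v \<Rightarrow> (\<Sum>t\<in>S. if v = pt k t c then r t else 0) | _ \<Rightarrow> 0)" for i
  have \<phi>v: "\<phi> (Vtx (pt k t c)) = r t" if "t \<in> S" for t
    using that finS by (simp add: \<phi>_def sum.delta)
  have \<phi>0: "\<phi> (Vtx v) = 0" if "v \<notin> (\<lambda>t. pt k t c) ` S" for v
    using that unfolding \<phi>_def by (auto intro!: sum.neutral)
  have \<phi>D: "\<phi> \<in> data_space" unfolding data_space_iff
  proof (intro conjI allI)
    show "bidegree_le d1 d2 (\<phi> Base)" by (simp add: \<phi>_def bidegree_le_def)
    show "if cross_cut T k' a' b' c' then \<phi> (Cross k' a' b' c') \<in> line_space k' c'
      else \<phi> (Cross k' a' b' c') = 0"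
      for k' a' b' c' by (simp add: \<phi>_def)
    show "if v \<in> interior_vertices T then \<phi> (Vtx v) \<in> vertex_space v else \<phi> (Vtx v) = 0" for v
    proof (cases "v \<in> (\<lambda>t. pt k t c) ` S")
      case True
      then show ?thesis using \<phi>v r(1) Siv by auto
    next
      case False
      then show ?thesis using \<phi>0 by (simp add: vertex_space_def)
    qed
  qed
  have cm: "constraint_map \<phi> (k', a', b', c') = (\<Sum>t\<in>{t \<in> S. pt k t c \<in> seg k' a' b' c'}. r t)"
    if "interior_l_edge T k' a' b' c'" for k' a' b' c'
  proof -
    have "constraint_map \<phi> (k', a', b', c')
      = (\<Sum>v\<in>{v \<in> interior_vertices T. v \<in> seg k' a' b' c'}. \<phi> (Vtx v))"
      using that by (simp add: constraint_map_def)
    also have "\<dots> = (\<Sum>v\<in>(\<lambda>t. pt k t c) ` {t \<in> S. pt k t c \<in> seg k' a' b' c'}. \<phi> (Vtx v))"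
    proof (rule sum.mono_neutral_right)
      show "finite {v \<in> interior_vertices T. v \<in> seg k' a' b' c'}" using finite_interior_vertices
        by simp
      show "(\<lambda>t. pt k t c) ` {t \<in> S. pt k t c \<in> seg k' a' b' c'} \<subseteq>
        {v \<in> interior_vertices T. v \<in> seg k' a' b' c'}"
        using Siv by auto
      show "\<forall>v\<in>{v \<in> interior_vertices T. v \<in> seg k' a' b' c'} - (\<lambda>t. pt k t c) `
        {t \<in> S. pt k t c \<in> seg k' a' b' c'}.
         \<phi> (Vtx v) = 0"
        by (intro ballI \<phi>0) blast
    qed
    also have "\<dots> = (\<Sum>t\<in>{t \<in> S. pt k t c \<in> seg k' a' b' c'}. \<phi> (Vtx (pt k t c)))"
      by (subst sum.reindex) (auto simp: inj_on_def)
    also have "\<dots> = (\<Sum>t\<in>{t \<in> S. pt k t c \<in> seg k' a' b' c'}. r t)"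
      by (intro sum.cong) (auto simp: \<phi>v)
    finally show ?thesis .
  qed
  have cm_self: "constraint_map \<phi> (k, a, b, c) = p"
  proof -
    have "{t \<in> S. pt k t c \<in> seg k a b c} = S" using Siv by auto
    thus ?thesis using cm[OF le] r(2) by simp
  qed
  \<comment> \<open>Mono-vertices lie on no other interior l-edge, so the change spreads through the
    upper end alone, and only to an l-edge of the other direction.\<close>
  have other: "{t \<in> S. pt k t c \<in> seg k' a' b' c'} \<subseteq> {b} \<and>
       (pt k b c \<in> seg k' a' b' c' \<longrightarrow> k' = flip k \<and> c' = b \<and> c < b')"
    if K: "interior_l_edge T k' a' b' c'" and ne: "(k', a', b', c') \<noteq> (k, a, b, c)" for k' a' b' c'
  proof
    show "{t \<in> S. pt k t c \<in> seg k' a' b' c'} \<subseteq> {b}"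
      using no_interior_l_edge_at_mono[OF le _ K] ne by (auto simp: S_def)
    show "pt k b c \<in> seg k' a' b' c' \<longrightarrow> k' = flip k \<and> c' = b \<and> c < b'"
    proof
      assume in': "pt k b c \<in> seg k' a' b' c'"
      have "k' \<noteq> k"
      proof
        assume "k' = k"
        then show False using in' ne l_edge_unique[OF l, of a' b' b] K ab
          by (auto simp: interior_l_edge_iff)
      qed
      then have k': "k' = flip k" by (simp add: neq_iff_flip)
      have "pt (flip k) c b \<in> seg (flip k) a' b' c'" using in' k' by simp
      then have c': "c' = b" "a' \<le> c" "c \<le> b'" by (auto simp del: pt_flip)
      have nR: "\<not> edge_after k b c" using l by (simp add: l_edge_iff)
      \<comment> \<open>The l-edge stops at its upper end, so the crossing line continues there and
        has its own upper end strictly beyond \<open>c\<close>.\<close>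
      have "edge_after k b c \<noteq> edge_before k b c" using interior_vertex_edge[OF ends(2)] nR by auto
      from interior_end_crossing(1)[OF interior_vertex_domain[OF ends(2)] this]
      have "edge_after (flip k) c b" .
      moreover have "\<not> edge_after (flip k) b' b" using K k' c'
        by (simp add: interior_l_edge_iff l_edge_iff)
      ultimately have "c \<noteq> b'" by metis
      thus "k' = flip k \<and> c' = b \<and> c < b'" using k' c' by simp
    qed
  qed
  interpret constraint_map: Vector_Spaces.linear "\<lambda>r \<phi> i. smult [:r:] (\<phi> i)"
    "\<lambda>r \<psi> i. smult [:r:] (\<psi> i)" constraint_map
    by (rule linear_constraint_map)
  have subD: "pf.subspace data_space" unfolding data_space_def by (rule subspace_fam_space)
  have subC: "pf.subspace (constraint_map ` data_space)"
    using constraint_map.subspace_image[OF subD] .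
  show ?case
  proof (cases "\<exists>k' a' b' c'. interior_l_edge T k' a' b' c' \<and> (k', a', b', c') \<noteq> (k, a, b, c)
    \<and> pt k b c \<in> seg k' a' b' c'")
    case False
    have "constraint_map \<phi> = single (k, a, b, c) p"
    proof (rule ext)
      fix i :: "orientation \<times> real \<times> real \<times> real"
      obtain k' a' b' c' where i: "i = (k', a', b', c')" by (cases i)
      show "constraint_map \<phi> i = single (k, a, b, c) p i"
      proof (cases "interior_l_edge T k' a' b' c' \<and> i \<noteq> (k, a, b, c)")
        case True
        then have eq: "{t \<in> S. pt k t c \<in> seg k' a' b' c'} = {}"
          using False other[of k' a' b' c'] i by blast
        have "constraint_map \<phi> i = 0" unfolding i cm[OF conjunct1[OF True]] eq by simp
        then show ?thesis using True by (simp add: single_def)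
      next
        case f: False
        show ?thesis
        proof (cases "i = (k, a, b, c)")
          case True
          then show ?thesis using cm_self by (simp add: single_def)
        next
          case False
          then have "\<not> interior_l_edge T k' a' b' c'" using f by blast
          then have "constraint_map \<phi> i = 0" by (simp add: i constraint_map_def)
          then show ?thesis using False by (simp add: single_def)
        qed
      qed
    qed
    then show ?thesis using \<phi>D by (metis imageI)
  next
    case True
    then obtain k1 a1 b1 c1 where K: "interior_l_edge T k1 a1 b1 c1"
      "(k1, a1, b1, c1) \<noteq> (k, a, b, c)"
      "pt k b c \<in> seg k1 a1 b1 c1" by blast
    have kk: "k1 = flip k" "c1 = b" "c < b1" using other[OF K(1,2)] K(3) by auto
    have "constraint_map \<phi> = single (k, a, b, c) p + single (k1, a1, b1, c1) (r b)"
    proof (rule ext)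
      fix i :: "orientation \<times> real \<times> real \<times> real"
      obtain k' a' b' c' where i: "i = (k', a', b', c')" by (cases i)
      show "constraint_map \<phi> i = (single (k, a, b, c) p + single (k1, a1, b1, c1) (r b)) i"
      proof (cases "interior_l_edge T k' a' b' c' \<and> i \<noteq> (k, a, b, c)")
        case t: True
        show ?thesis
        proof (cases "pt k b c \<in> seg k' a' b' c'")
          case True
          then have k': "k' = flip k" "c' = b" using other[of k' a' b' c'] t i by auto
          have "pt (flip k) c b \<in> seg (flip k) a' b' b" "pt (flip k) c b \<in> seg (flip k) a1 b1 b"
            using True K(3) k' kk by simp_all
          then have "a' = a1 \<and> b' = b1"
            using l_edge_unique[of "flip k" a' b' b a1 b1 c] t K(1) k' kk
            by (auto simp: interior_l_edge_iff simp del: pt_flip)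
          then have ii: "i = (k1, a1, b1, c1)" using i k' kk by simp
          have eq: "{t \<in> S. pt k t c \<in> seg k' a' b' c'} = {b}"
            using other[of k' a' b' c'] t i True by (auto simp: S_def)
          have "constraint_map \<phi> i = r b" unfolding i cm[OF conjunct1[OF t]] eq by simp
          then show ?thesis using ii K(2) by (auto simp add: single_def)
        next
          case False
          then have eq: "{t \<in> S. pt k t c \<in> seg k' a' b' c'} = {}" using other[of k' a' b' c'] t i
            by blast
          have "constraint_map \<phi> i = 0" unfolding i cm[OF conjunct1[OF t]] eq by simp
          moreover have "i \<noteq> (k1, a1, b1, c1)" using False K(3) i by auto
          ultimately show ?thesis using t by (simp add: single_def)
        qed
      next
        case f: False
        show ?thesis
        proof (cases "i = (k, a, b, c)")
          case True
          then show ?thesis using cm_self K(2) by (auto simp add: single_def)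
        next
          case False
          then have ni: "\<not> interior_l_edge T k' a' b' c'" using f by blast
          then have "constraint_map \<phi> i = 0" by (simp add: i constraint_map_def)
          moreover have "i \<noteq> (k1, a1, b1, c1)" using ni K(1) i by auto
          ultimately show ?thesis using False by (simp add: single_def)
        qed
      qed
    qed
    \<comment> \<open>The side effect \<open>r b\<close> sits on an l-edge with larger coordinate
      sum \<open>b1 + c1\<close>, where the induction hypothesis removes it.\<close>
    then have eq: "single (k, a, b, c) p = constraint_map \<phi> - single (k1, a1, b1, c1) (r b)" by simp
    have "single (k1, a1, b1, c1) (r b) \<in> constraint_map ` data_space"
    proof (rule less.hyps[OF _ K(1)])
      have "r b \<in> vertex_space (pt (flip k) c b)" using r(1)[of b] by (simp add: S_def)
      then show "r b \<in> line_space k1 c1" unfolding kk by (rule vertex_space_sub)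
      let ?X = "\<lambda>b c. {(k', a', b', c'). interior_l_edge T k' a' b' c' \<and> b + c < b' + c'}"
      have "?X b1 c1 \<subset> ?X b c"
      proof
        show "?X b1 c1 \<subseteq> ?X b c" using kk by auto
        have "(k1, a1, b1, c1) \<in> ?X b c" "(k1, a1, b1, c1) \<notin> ?X b1 c1" using K(1) kk by auto
        then show "?X b1 c1 \<noteq> ?X b c" by blast
      qed
      moreover have "finite (?X b c)"
        by (rule finite_subset[OF _ finite_constraint_index]) (auto simp: constraint_index_def)
      ultimately show "card (?X b1 c1) < card (?X b c)" by (rule psubset_card_mono[rotated])
    qed
    then show ?thesis unfolding eq using \<phi>D by (intro pf.subspace_diff[OF subC]) auto
  qed
qed

text \<open>Surjectivity is what independence of the conditions means; a general right-hand side is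
  the finite sum of its single entries.\<close>

lemma constraint_map_image: "constraint_map ` data_space = constraint_space"
proof
  show "constraint_map ` data_space \<subseteq> constraint_space" using constraint_map_in_constraint_space
    by blast
  interpret constraint_map: Vector_Spaces.linear "\<lambda>r \<phi> i. smult [:r:] (\<phi> i)"
    "\<lambda>r \<psi> i. smult [:r:] (\<psi> i)" constraint_map
    by (rule linear_constraint_map)
  have subD: "pf.subspace data_space" unfolding data_space_def by (rule subspace_fam_space)
  have subC: "pf.subspace (constraint_map ` data_space)"
    using constraint_map.subspace_image[OF subD] .
  show "constraint_space \<subseteq> constraint_map ` data_space"
  proof
    fix \<psi> assume elem: "\<psi> \<in> constraint_space"
    have "\<psi> = (\<Sum>i\<in>constraint_index. single i (\<psi> i))"
    proof (rule ext)
      fix j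
      have "(\<Sum>i\<in>constraint_index. single i (\<psi> i)) j = (\<Sum>i\<in>constraint_index. single i (\<psi> i) j)"
        by (rule sum_fun_apply)
      also have "\<dots> = (if j \<in> constraint_index then \<psi> j else 0)" using finite_constraint_index
        by (simp add: single_def)
      also have "\<dots> = \<psi> j" using elem by (cases j) (simp add: constraint_space_def fam_space_def)
      finally show "\<psi> j = (\<Sum>i\<in>constraint_index. single i (\<psi> i)) j" by simp
    qed
    also have "\<dots> \<in> constraint_map ` data_space"
    proof (rule pf.subspace_sum[OF subC])
      fix i assume "i \<in> constraint_index"
      then obtain k a b c where i: "i = (k, a, b, c)" "interior_l_edge T k a b c"
        by (auto simp: constraint_index_def)
      have "\<psi> (k, a, b, c) \<in> line_space k c" using elem[unfolded constraint_space_iff] i(2) by metis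
      then show "single i (\<psi> i) \<in> constraint_map ` data_space" unfolding i(1)
        by (rule single_in_range[OF i(2)])
    qed
    finally show "\<psi> \<in> constraint_map ` data_space" .
  qed
qed

lemma dim_constrained: "pf.dim data_space
  = pf.dim {\<phi> \<in> data_space. constraint_map \<phi> = 0} + pf.dim constraint_space"
proof -
  interpret pp: vector_space_pair "\<lambda>r (\<phi> :: idx \<Rightarrow> real poly poly) i. smult [:r:] (\<phi> i)"
    "\<lambda>r (\<psi> :: orientation \<times> real \<times> real \<times> real \<Rightarrow> real poly poly) i. smult [:r:] (\<psi> i)" ..
  have "vexp k \<le> d1" "hexp k \<le> d2" for k using \<alpha> \<beta> by (cases k; simp)+
  then have "idx_vexp i \<le> d1" "idx_hexp i \<le> d2" for i using \<alpha> \<beta> by (cases i; simp)+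
  then obtain X where "finite X" "data_space \<subseteq> pf.span X"
    using dim_fam_space(2)[OF finite_data_index, of idx_vexp d1 idx_hexp d2 idx_x idx_y]
      unfolding data_space_def by blast
  from pp.rank_nullity[OF linear_constraint_map
    subspace_fam_space[of data_index d1 d2 idx_vexp idx_x idx_hexp idx_y, folded data_space_def]
      this] constraint_map_image
  show ?thesis by simp
qed

end

section \<open>Splines and jump data\<close>

context spline_mesh begin

text \<open>Vanishing off \<open>T\<close> makes a system of pieces determined by its values on the
  cells, so that the passage to functions can be injective.\<close>

definition piece_space :: "(cell \<Rightarrow> real poly poly) set" where
  "piece_space = {P. (\<forall>F. F \<notin> T \<longrightarrow> P F = 0) \<and> spline_pieces d1 d2 \<alpha> \<beta> T P}"

lemma piece_space_iff: "P \<in> piece_space \<longleftrightarrow> (\<forall>F. F \<notin> T \<longrightarrow> P F = 0) \<and> (\<forall>F\<in>T. bidegree_le d1 d2 (P F)) \<and>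
   (\<forall>k F G a b c. adj k F G a b c \<longrightarrow> P F - P G \<in> line_space k c)"
proof -
  have "bidegree_le d1 d2 (P F - P G)" if "\<forall>F\<in>T. bidegree_le d1 d2 (P F)" "adj k F G a b c"
    for k F G a b c
    using that(1) adjD(1,2)[OF that(2)] by (auto simp: bidegree_le_def intro: degree_diff_le)
  then show ?thesis unfolding piece_space_def mem_Collect_eq spline_pieces_iff line_space_iff
    by auto
qed

text \<open>Measured along the horizontal line; \<open>vjump_pt\<close> shows that the vertical line
  gives the same value.\<close>

definition vjump :: "(cell \<Rightarrow> real poly poly) \<Rightarrow> real \<times> real \<Rightarrow> real poly poly" where
  "vjump P v = jump_after P Horizontal (fst v) (snd v) - jump_before P Horizontal (fst v) (snd v)"

lemma vjump_pt: "vjump P (pt k t c) = jump_after P k t c - jump_before P k t c"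
  using jump_flip[of P Horizontal t c] by (cases k) (simp_all add: vjump_def)

definition base_cell :: cell where "base_cell = (SOME F. F \<in> T)"

lemma base_cell: "base_cell \<in> T"
  unfolding base_cell_def using T_nonempty by (simp add: some_in_eq)

definition jump_data :: "(cell \<Rightarrow> real poly poly) \<Rightarrow> idx \<Rightarrow> real poly poly" where
  "jump_data P i = (case i of Base \<Rightarrow> P base_cell
     | Cross k a b c \<Rightarrow> if cross_cut T k a b c then jump_after P k a c else 0
     | Vtx v \<Rightarrow> if v \<in> interior_vertices T then vjump P v else 0)"

lemma jump_data_simps [simp]: "jump_data P Base = P base_cell"
  "jump_data P (Cross k a b c) = (if cross_cut T k a b c then jump_after P k a c else 0)"
  "jump_data P (Vtx v) = (if v \<in> interior_vertices T then vjump P v else 0)"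
  by (simp_all add: jump_data_def)

lemma piece_at_add: "piece_at (P + Q) k s r t c = piece_at P k s r t c + piece_at Q k s r t c"
  by (simp add: piece_at_def sum.distrib)

lemma piece_at_smult: "piece_at (\<lambda>F. smult [:r:] (P F)) k s r' t c
  = smult [:r:] (piece_at P k s r' t c)"
  by (simp add: piece_at_def smult_sum_right)

lemma linear_jump_data: "Vector_Spaces.linear (\<lambda>r P F. smult [:r:] (P F))
  (\<lambda>r \<phi> i. smult [:r:] (\<phi> i)) jump_data"
  unfolding Vector_Spaces.linear_iff
proof (intro conjI allI pf.vector_space_axioms ext)
  fix P Q i show "jump_data (P + Q) i = (jump_data P + jump_data Q) i"
    by (cases i) (auto simp: jump_after_def jump_before_def vjump_def piece_at_add)
next
  fix r P i show "jump_data (\<lambda>F. smult [:r:] (P F)) i = smult [:r:] (jump_data P i)"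
    by (cases i) (auto simp: jump_after_def jump_before_def vjump_def piece_at_smult
      smult_diff_right)
qed

lemma subspace_piece_space: "pf.subspace piece_space"
proof (rule pf.subspaceI)
  show "0 \<in> piece_space" by (simp add: piece_space_def
    spline_pieces_zero[unfolded zero_fun_def[symmetric]])
next
  fix P Q assume "P \<in> piece_space" "Q \<in> piece_space"
  then show "P + Q \<in> piece_space" using spline_pieces_add[of d1 d2 \<alpha> \<beta> T P Q]
    by (simp add: piece_space_def plus_fun_def)
next
  fix r P assume "P \<in> piece_space"
  then show "(\<lambda>F. smult [:r:] (P F)) \<in> piece_space" using spline_pieces_smult[of d1 d2 \<alpha> \<beta> T P r]
    by (simp add: piece_space_def)
qed

lemma jump_after_line_space: "P \<in> piece_space \<Longrightarrow> edge_after k t c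
  \<Longrightarrow> jump_after P k t c \<in> line_space k c"
  using edge_after_adjE jump_after_adj piece_space_iff by metis

lemma jump_before_line_space: "P \<in> piece_space \<Longrightarrow> edge_before k t c
  \<Longrightarrow> jump_before P k t c \<in> line_space k c"
  using edge_before_adjE jump_before_adj piece_space_iff by metis

text \<open>A side without an edge has jump 0, so both one-sided jumps lie in the line space. Used
  in both directions, this puts the vertex jump into the vertex space.\<close>

lemma vjump_line_space:
  assumes "P \<in> piece_space" "pt k t c \<in> interior (mesh_domain T)"
  shows "vjump P (pt k t c) \<in> line_space k c"
proof -
  have "jump_after P k t c \<in> line_space k c" using assms
    by (cases "edge_after k t c") (simp_all add: jump_after_line_space jump_after_zero)
  moreover have "jump_before P k t c \<in> line_space k c" using assms
    by (cases "edge_before k t c") (simp_all add: jump_before_line_space jump_before_zero)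
  ultimately show ?thesis unfolding vjump_pt by (rule line_space_diff)
qed

lemma jump_data_in_data_space: "P \<in> piece_space \<Longrightarrow> jump_data P \<in> data_space"
  unfolding data_space_iff
proof (intro conjI allI)
  assume P: "P \<in> piece_space"
  show "bidegree_le d1 d2 (jump_data P Base)" using P base_cell by (simp add: piece_space_iff)
  show "if cross_cut T k a b c then jump_data P (Cross k a b c) \<in> line_space k c
    else jump_data P (Cross k a b c) = 0" for k a b c
  proof (cases "cross_cut T k a b c")
    case True
    then have "edge_after k a c" by (simp add: cross_cut_iff l_edge_iff)
    with True show ?thesis using jump_after_line_space[OF P] by simp
  qed simp
  fix v
  show "if v \<in> interior_vertices T then jump_data P (Vtx v) \<in> vertex_space v
    else jump_data P (Vtx v) = 0"
  proof (cases "v \<in> interior_vertices T")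
    case True
    obtain t c where v: "v = pt Horizontal t c" by (rule pt_exhaust)
    have int: "pt Horizontal t c \<in> interior (mesh_domain T)" using interior_vertex_domain True v
      by simp
    have "vjump P v \<in> line_space Horizontal c" unfolding v by (rule vjump_line_space[OF P int])
    moreover have "vjump P v \<in> line_space (flip Horizontal) t"
      using vjump_line_space[OF P, of "flip Horizontal" c t] int v by (simp del: flip.simps)
    ultimately have "vjump P v \<in> vertex_space v" unfolding v by (rule vertex_spaceI)
    then show ?thesis using True by simp
  qed simp
qed

lemma line_telescope:
  assumes "l_edge T k a b c"
  shows "jump_before P k b c - jump_after P k a c
    = (\<Sum>t\<in>{t. a < t \<and> t < b \<and> pt k t c \<in> interior_vertices T}. vjump P (pt k t c))"
  unfolding vjump_pt using jump_telescope[of a b k c P] assms by (simp add: l_edge_iff)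

text \<open>Telescoping along the l-edge. Outside its ends the jumps are 0, so the end vertices
  contribute exactly the first jump and minus the last one.\<close>

lemma constraint_map_jump_data: "constraint_map (jump_data P) = 0"
proof (rule ext)
  fix i :: "orientation \<times> real \<times> real \<times> real"
  obtain k a b c where i: "i = (k, a, b, c)" by (cases i)
  show "constraint_map (jump_data P) i = 0 i"
  proof (cases "interior_l_edge T k a b c")
    case True
    then have l: "l_edge T k a b c" and ends: "pt k a c \<in> interior_vertices T"
      "pt k b c \<in> interior_vertices T"
      by (auto simp: interior_l_edge_iff)
    have ab: "a < b" using l by (simp add: l_edge_iff)
    let ?S = "{t. a < t \<and> t < b \<and> pt k t c \<in> interior_vertices T}"
    have S: "{t. a \<le> t \<and> t \<le> b \<and> pt k t c \<in> interior_vertices T} = insert a (insert b ?S)"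
      using ends ab by auto
    have fin: "finite ?S" using finite_line_vertices[of "\<lambda>t. a < t \<and> t < b" k c]
      by (simp add: conj_assoc)
    have "constraint_map (jump_data P) i
      = (\<Sum>v\<in>{v \<in> interior_vertices T. v \<in> seg k a b c}. jump_data P (Vtx v))"
      using True by (simp add: i constraint_map_def)
    also have "\<dots> = (\<Sum>t\<in>{t. a \<le> t \<and> t \<le> b \<and> pt k t c \<in> interior_vertices T}. jump_data P
      (Vtx (pt k t c)))"
      by (rule sum_seg)
    also have "\<dots> = (\<Sum>t\<in>{t. a \<le> t \<and> t \<le> b \<and> pt k t c \<in> interior_vertices T}. vjump P (pt k t c))"
      by (intro sum.cong) auto
    also have "\<dots> = vjump P (pt k a c) + (vjump P (pt k b c) + (\<Sum>t\<in>?S. vjump P (pt k t c)))"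
      unfolding S using fin ab by simp
    also have "(\<Sum>t\<in>?S. vjump P (pt k t c)) = jump_before P k b c - jump_after P k a c"
      using line_telescope[OF l] by simp
    also have "vjump P (pt k a c) = jump_after P k a c"
      using jump_before_zero[OF interior_vertex_domain[OF ends(1)]] l
        by (simp add: vjump_pt l_edge_iff)
    also have "vjump P (pt k b c) = - jump_before P k b c"
      using jump_after_zero[OF interior_vertex_domain[OF ends(2)]] l
        by (simp add: vjump_pt l_edge_iff)
    finally show ?thesis by simp
  qed (simp add: i constraint_map_def)
qed

text \<open>With vanishing vertex jumps the jump is constant along an l-edge; it is 0 at an interior
  end, and on a cross-cut by its own datum. Hence all cells linked by edges carry the base piece,
  which is 0.\<close>

lemma jump_data_eq_0:
  assumes P: "P \<in> piece_space" and 0: "jump_data P = 0"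
  shows "P = 0"
proof -
  have vj: "vjump P v = 0" if "v \<in> interior_vertices T" for v
    using fun_cong[OF 0, of "Vtx v"] that by simp
  have JR0: "jump_after P k t c = 0" if edge_after: "edge_after k t c" for k t c
  proof -
    obtain a b where l: "l_edge T k a b c" and t: "a \<le> t" "t < b"
      using l_edge_exists[OF edge_after] .
    have "jump_before P k b c - jump_after P k a c = 0" unfolding line_telescope[OF l]
      by (intro sum.neutral) (simp add: vj)
    moreover have "jump_after P k a c = 0" if a: "pt k a c \<in> interior_vertices T"
      using vj[OF a] jump_before_zero[OF interior_vertex_domain[OF a], of P] l
        by (simp add: vjump_pt l_edge_iff)
    moreover have "jump_before P k b c = 0" if b: "pt k b c \<in> interior_vertices T"
      using vj[OF b] jump_after_zero[OF interior_vertex_domain[OF b], of P] l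
        by (simp add: vjump_pt l_edge_iff)
    moreover have "jump_after P k a c = 0" if "pt k a c \<notin> interior_vertices T"
      "pt k b c \<notin> interior_vertices T"
      using fun_cong[OF 0, of "Cross k a b c"] that l by (simp add: cross_cut_iff)
    ultimately have a0: "jump_after P k a c = 0" by auto
    show ?thesis
    proof (cases "a = t")
      case False
      then have at: "a < t" using t by simp
      have "jump_before P k t c - jump_after P k a c =
        (\<Sum>v\<in>{v. a < v \<and> v < t \<and> pt k v c \<in> interior_vertices T}. jump_after P k v c - jump_before
          P k v c)"
        by (rule jump_telescope[OF at]) (use l t in \<open>simp add: l_edge_iff\<close>)
      also have "\<dots> = 0" by (intro sum.neutral) (use vj in \<open>auto simp: vjump_pt[symmetric]\<close>)
      finally have "jump_before P k t c = 0" using a0 by simp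
      moreover have "jump_after P k t c - jump_before P k t c = 0"
      proof (cases "pt k t c \<in> vertices T")
        case True
        then have "pt k t c \<in> interior_vertices T"
          using l_edge_inside(3)[OF l at t(2)] by (rule interior_vertexI)
        then show ?thesis using vj by (simp add: vjump_pt[symmetric])
      next
        case False
        obtain F G a' b' where adj: "adj k F G a' b' c" "a' \<le> t" "t < b'"
          using edge_after_adjE[OF edge_after] .
        \<comment> \<open>Away from vertices the point lies strictly inside one edge, so the jumps
          before and after it agree.\<close>
        have "a' \<noteq> t" using adj_vertices(1)[OF adj(1)] False by auto
        then show ?thesis using jump_after_adj[OF adj] jump_before_adj[OF adj(1), of t P] adj(2,3)
          by simp
      qed
      ultimately show ?thesis by simp
    qed (use a0 in simp)
  qed
  have step: "P F = P G" if "(F, G) \<in> adj_rel" for F G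
  proof -
    have "P F = P G" if adj: "adj k F G a b c" for k F G a b c
    proof -
      have "edge_after k a c" using edge_afterI[of a b k c a] edge_ints_adj adj adjD(3)[OF adj]
        by blast
      then show ?thesis using JR0[of k a c] jump_after_adj[OF adj, of a P] adjD(3)[OF adj] by simp
    qed
    then show ?thesis using that unfolding adj_rel_def by force
  qed
  have "P base_cell = P F" if "F \<in> T" for F
    using cells_connected[OF base_cell that] by (induction rule: rtrancl_induct) (use step in auto)
  moreover have "P base_cell = 0" using fun_cong[OF 0, of Base] by simp
  ultimately show ?thesis using P by (auto simp: piece_space_iff fun_eq_iff)
qed

lemma inj_jump_data: "inj_on jump_data piece_space"
proof (rule inj_onI)
  interpret jump_data: Vector_Spaces.linear "\<lambda>r P F. smult [:r:] (P F)"
    "\<lambda>r \<phi> i. smult [:r:] (\<phi> i)" jump_data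
    by (rule linear_jump_data)
  fix P Q assume PQ: "P \<in> piece_space" "Q \<in> piece_space" "jump_data P = jump_data Q"
  have "P - Q \<in> piece_space" using pf.subspace_diff[OF subspace_piece_space PQ(1,2)] .
  moreover have "jump_data (P - Q) = 0" unfolding jump_data.diff PQ(3) by simp
  ultimately have "P - Q = 0" by (rule jump_data_eq_0)
  thus "P = Q" by simp
qed

end

lemma bidegree_le_diff:
  "bidegree_le m n p \<Longrightarrow> bidegree_le m n q \<Longrightarrow> bidegree_le m n (p - q)"
  by (simp add: bidegree_le_def degree_diff_le)

section \<open>Reconstruction of a spline from jump data\<close>

context spline_mesh begin

definition l_edge_ends :: "orientation \<Rightarrow> real \<Rightarrow> real \<Rightarrow> real \<times> real" where
  "l_edge_ends k t c = (SOME p. l_edge T k (fst p) (snd p) c \<and> fst p \<le> t \<and> t \<le> snd p)"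

lemma l_edge_ends_eq:
  assumes "l_edge T k a b c" "a \<le> t" "t \<le> b"
  shows "l_edge_ends k t c = (a, b)"
proof -
  have "l_edge T k (fst (l_edge_ends k t c)) (snd (l_edge_ends k t c)) c
    \<and> fst (l_edge_ends k t c) \<le> t \<and> t \<le> snd (l_edge_ends k t c)"
    unfolding l_edge_ends_def by (rule someI[of _ "(a, b)"]) (use assms in simp)
  then show ?thesis using l_edge_unique[OF assms(1) _ assms(2,3)] by (metis prod.collapse)
qed

text \<open>The initial jump on a ray that starts on the boundary is the one for which the jump vanishes
  beyond the interior end.\<close>

definition start :: "(idx \<Rightarrow> real poly poly) \<Rightarrow> orientation \<Rightarrow> real \<Rightarrow> real \<Rightarrow> real \<Rightarrow> real poly poly"
  where
  "start \<phi> k a b c = (if pt k a c \<in> interior_vertices T then 0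
     else if pt k b c \<in> interior_vertices T
       then - (\<Sum>t\<in>{t. a \<le> t \<and> t \<le> b \<and> pt k t c \<in> interior_vertices T}. \<phi> (Vtx (pt k t c)))
     else \<phi> (Cross k a b c))"

text \<open>The jump is integrated along the l-edge from its lower end. The vertex at
  \<open>t\<close> is included here and excluded in \<open>left_jump\<close>, so that the difference
  recovers its datum.\<close>

definition right_jump :: "(idx \<Rightarrow> real poly poly) \<Rightarrow> orientation \<Rightarrow> real \<Rightarrow> real \<Rightarrow> real poly poly" where
  "right_jump \<phi> k t c = (if edge_after k t c then start \<phi> k (fst (l_edge_ends k t c))
    (snd (l_edge_ends k t c)) c +
     (\<Sum>s\<in>{s. fst (l_edge_ends k t c) \<le> s \<and> s \<le> t \<and> pt k s c \<in> interior_vertices T}. \<phi>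
       (Vtx (pt k s c))) else 0)"

definition left_jump :: "(idx \<Rightarrow> real poly poly) \<Rightarrow> orientation \<Rightarrow> real \<Rightarrow> real \<Rightarrow> real poly poly" where
  "left_jump \<phi> k t c = (if edge_before k t c then start \<phi> k (fst (l_edge_ends k t c))
    (snd (l_edge_ends k t c)) c +
     (\<Sum>s\<in>{s. fst (l_edge_ends k t c) \<le> s \<and> s < t \<and> pt k s c \<in> interior_vertices T}. \<phi>
       (Vtx (pt k s c))) else 0)"

lemma right_jump_eq:
  assumes "l_edge T k a b c" "a \<le> t" "t < b"
  shows "right_jump \<phi> k t c = start \<phi> k a b c +
     (\<Sum>s\<in>{s. a \<le> s \<and> s \<le> t \<and> pt k s c \<in> interior_vertices T}. \<phi> (Vtx (pt k s c)))"
  using assms l_edge_ends_eq[OF assms(1,2)] unfolding right_jump_def by (simp add: l_edge_iff)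

lemma left_jump_eq:
  assumes "l_edge T k a b c" "a < t" "t \<le> b"
  shows "left_jump \<phi> k t c = start \<phi> k a b c +
     (\<Sum>s\<in>{s. a \<le> s \<and> s < t \<and> pt k s c \<in> interior_vertices T}. \<phi> (Vtx (pt k s c)))"
proof -
  have "edge_before k t c" using assms by (intro edge_before_if_edges[of a]) (auto simp: l_edge_iff)
  then show ?thesis using assms l_edge_ends_eq[OF assms(1), of t] unfolding left_jump_def by simp
qed

lemma sum_upto_insert:
  assumes "a \<le> t" "pt k t c \<in> interior_vertices T"
  shows "(\<Sum>s\<in>{s. a \<le> s \<and> s \<le> t \<and> pt k s c \<in> interior_vertices T}. f s) =
     f t + (\<Sum>s\<in>{s. a \<le> s \<and> s < t \<and> pt k s c \<in> interior_vertices T}. (f s :: real poly poly))"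
proof -
  have "{s. a \<le> s \<and> s \<le> t \<and> pt k s c \<in> interior_vertices T} =
    insert t {s. a \<le> s \<and> s < t \<and> pt k s c \<in> interior_vertices T}" using assms by auto
  moreover have "finite {s. a \<le> s \<and> s < t \<and> pt k s c \<in> interior_vertices T}"
    using finite_line_vertices[of "\<lambda>s. a \<le> s \<and> s < t" k c] by (simp add: conj_assoc)
  ultimately show ?thesis by simp
qed

text \<open>The right side does not depend on the direction, which is the closedness required for
  exactness. At the upper end of an l-edge the claim says that initial jump and vertex jumps sum to
  0.\<close>

lemma jump_at_interior:
  assumes c0: "constraint_map \<phi> = 0" and int: "pt k t c \<in> interior (mesh_domain T)"
  shows "right_jump \<phi> k t c - left_jump \<phi> k t c
    = (if pt k t c \<in> interior_vertices T then \<phi> (Vtx (pt k t c)) else 0)"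
proof (cases "edge_after k t c")
  case Rt: True
  obtain a b where l: "l_edge T k a b c" and t: "a \<le> t" "t < b" using l_edge_exists[OF Rt] .
  note right_jump = right_jump_eq[OF l t, of \<phi>]
  show ?thesis
  proof (cases "a = t")
    case True
    then have nL: "\<not> edge_before k t c" using l by (simp add: l_edge_iff)
    then have left_jump: "left_jump \<phi> k t c = 0" by (simp add: left_jump_def)
    have iv: "pt k t c \<in> interior_vertices T"
      using l_edge_vertices[OF l] int True interior_vertexI by simp
    have e: "{s. a \<le> s \<and> s \<le> t \<and> pt k s c \<in> interior_vertices T} = {t}" using True iv by auto
    show ?thesis unfolding right_jump e left_jump using iv True by (simp add: start_def)
  next
    case False
    then have at: "a < t" using t by simp
    note left_jump = left_jump_eq[OF l at, of \<phi>]
    show ?thesis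
    proof (cases "pt k t c \<in> interior_vertices T")
      case True
      then show ?thesis using right_jump left_jump t
        sum_upto_insert[OF t(1) True, of "\<lambda>s. \<phi> (Vtx (pt k s c))"] by simp
    next
      case False
      then have "{s. a \<le> s \<and> s \<le> t \<and> pt k s c \<in> interior_vertices T}
        = {s. a \<le> s \<and> s < t \<and> pt k s c \<in> interior_vertices T}"
        by (auto simp: order.order_iff_strict)
      then show ?thesis using right_jump left_jump t False by simp
    qed
  qed
next
  case nR: False
  then have right_jump: "right_jump \<phi> k t c = 0" by (simp add: right_jump_def)
  show ?thesis
  proof (cases "edge_before k t c")
    case False
    then show ?thesis using right_jump nR interior_vertex_edge[of k t c]
      by (auto simp: left_jump_def)
  next
    case True
    then obtain a b where l: "l_edge T k a b c" and t: "a < t" "t \<le> b" using l_edge_exists_before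
      by metis
    have tb: "t = b"
    proof (rule ccontr)
      assume "t \<noteq> b"
      with nR l t show False by (simp add: l_edge_iff)
    qed
    have iv: "pt k t c \<in> interior_vertices T"
      using l_edge_vertices[OF l] int tb interior_vertexI by simp
    note left_jump = left_jump_eq[OF l t, of \<phi>]
    let ?S = "\<Sum>s\<in>{s. a \<le> s \<and> s < t \<and> pt k s c \<in> interior_vertices T}. \<phi> (Vtx (pt k s c))"
    have tot: "(\<Sum>s\<in>{s. a \<le> s \<and> s \<le> b \<and> pt k s c \<in> interior_vertices T}. \<phi> (Vtx (pt k s c)))
      = \<phi> (Vtx (pt k t c)) + ?S"
      unfolding tb[symmetric] using t(1) iv by (intro sum_upto_insert) auto
    \<comment> \<open>For an interior l-edge this is its condition, for a ray it is the choice of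
      \<open>start\<close>.\<close>
    have "start \<phi> k a b c + (\<phi> (Vtx (pt k t c)) + ?S) = 0"
    proof (cases "pt k a c \<in> interior_vertices T")
      case True
      then have il: "interior_l_edge T k a b c" using l iv tb by (simp add: interior_l_edge_iff)
      have "constraint_map \<phi> (k, a, b, c)
        = (\<Sum>v\<in>{v \<in> interior_vertices T. v \<in> seg k a b c}. \<phi> (Vtx v))"
        using il by (simp add: constraint_map_def)
      also have "\<dots> = \<phi> (Vtx (pt k t c)) + ?S" unfolding tot[symmetric] by (rule sum_seg)
      finally show ?thesis using c0 True by (simp add: start_def)
    next
      case False
      then show ?thesis using iv tb tot by (simp add: start_def)
    qed
    then have "left_jump \<phi> k t c = - \<phi> (Vtx (pt k t c))" using left_jump
      by (simp add: eq_neg_iff_add_eq_0 ac_simps)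
    then show ?thesis using right_jump iv by simp
  qed
qed

lemma right_jump_line_space:
  assumes D: "\<phi> \<in> data_space"
  shows "right_jump \<phi> k t c \<in> line_space k c"
proof (cases "edge_after k t c")
  case True
  obtain a b where l: "l_edge T k a b c" and t: "a \<le> t" "t < b" using l_edge_exists[OF True] .
  have vs: "\<phi> (Vtx (pt k s c)) \<in> line_space k c" if "pt k s c \<in> interior_vertices T" for s
    using data_space_vtx[OF D that] by (rule vertex_space_sub)
  have "\<phi> (Cross k a b c) \<in> line_space k c" using D[unfolded data_space_iff]
    by (metis line_space_zero)
  then have "start \<phi> k a b c \<in> line_space k c"
    unfolding start_def using vs by (auto intro!: line_space_uminus line_space_sum)
  then show ?thesis unfolding right_jump_eq[OF l t] using vs
    by (auto intro!: line_space_add line_space_sum)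
qed (simp add: right_jump_def)

lemma vertex_coords: "pt k t c \<in> vertices T \<Longrightarrow> t \<in> coords k"
  unfolding vertices_iff using coordsI by blast

text \<open>Vertices and edge ends have side coordinates, so none lies strictly between
  \<open>t\<close> and \<open>t'\<close> and nothing changes there.\<close>

lemma left_jump_shift:
  assumes t: "t < t'" and gap: "\<And>z. z \<in> coords k \<Longrightarrow> z < t' \<longleftrightarrow> z \<le> t"
  shows "left_jump \<phi> k t' c = right_jump \<phi> k t c"
proof -
  have "t' \<le> z \<longleftrightarrow> t < z" if "z \<in> coords k" for z using gap[OF that] by auto
  moreover have "a \<in> coords k \<and> b \<in> coords k" if "(a, b) \<in> edge_ints k c" for a b
    using edge_intsD(2,3)[OF that] vertex_coords by simp
  ultimately have "(a < t' \<and> t' \<le> b) \<longleftrightarrow> (a \<le> t \<and> t < b)" if "(a, b) \<in> edge_ints k c" for a b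
    using gap that by simp
  then have LR: "edge_before k t' c \<longleftrightarrow> edge_after k t c"
    unfolding edge_before_def edge_after_def by (intro bex_cong refl) auto
  show ?thesis
  proof (cases "edge_after k t c")
    case True
    obtain a b where l: "l_edge T k a b c" and ab: "a \<le> t" "t < b" using l_edge_exists[OF True] .
    have "b \<in> coords k" using l_edge_vertices[OF l] vertex_coords by blast
    then have t': "a < t'" "t' \<le> b" using gap[of b] ab t by auto
    have "{s. a \<le> s \<and> s < t' \<and> pt k s c \<in> interior_vertices T}
      = {s. a \<le> s \<and> s \<le> t \<and> pt k s c \<in> interior_vertices T}"
      using gap vertex_coords by (auto simp: interior_vertices_def)
    then show ?thesis unfolding left_jump_eq[OF l t'] right_jump_eq[OF l ab] by simp
  qed (use LR in \<open>simp add: left_jump_def right_jump_def\<close>)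
qed

lemma right_jump_edge:
  assumes adj: "adj k F G a' b' c" and t: "a' \<le> t" "t < b'"
  shows "right_jump \<phi> k t c = right_jump \<phi> k a' c"
proof -
  have edge_after: "edge_after k u c" if "a' \<le> u" "u < b'" for u
    using edge_afterI[of a' b' k c u] edge_ints_adj adj that by blast
  obtain a b where l: "l_edge T k a b c" and ab: "a \<le> a'" "a' < b"
    using l_edge_exists[OF edge_after[of a']] adjD(3)[OF adj] by blast
  have "t < b"
  proof (rule ccontr)
    assume "\<not> t < b"
    then have "edge_after k b c" using ab t by (intro edge_after) auto
    then show False using l by (simp add: l_edge_iff)
  qed
  moreover have "{s. a \<le> s \<and> s \<le> t \<and> pt k s c \<in> interior_vertices T}
    = {s. a \<le> s \<and> s \<le> a' \<and> pt k s c \<in> interior_vertices T}"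
  proof -
    have "s \<le> a'" if "s \<le> t" "pt k s c \<in> interior_vertices T" for s
      using adj_no_vertex[OF adj, of s] that t by (force simp: interior_vertices_def)
    then show ?thesis using t by auto
  qed
  ultimately show ?thesis using right_jump_eq[OF l, of t \<phi>] right_jump_eq[OF l ab, of \<phi>] t ab
    by simp
qed

lemma left_jump_edge:
  assumes adj: "adj k F G a' b' c" and t: "a' < t" "t \<le> b'"
  shows "left_jump \<phi> k t c = right_jump \<phi> k a' c"
proof -
  have edge_after: "edge_after k u c" if "a' \<le> u" "u < b'" for u
    using edge_afterI[of a' b' k c u] edge_ints_adj adj that by blast
  obtain a b where l: "l_edge T k a b c" and ab: "a \<le> a'" "a' < b"
    using l_edge_exists[OF edge_after[of a']] adjD(3)[OF adj] by blast
  have "t \<le> b"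
  proof (rule ccontr)
    assume "\<not> t \<le> b"
    then have "edge_after k b c" using ab t by (intro edge_after) auto
    then show False using l by (simp add: l_edge_iff)
  qed
  moreover have "{s. a \<le> s \<and> s < t \<and> pt k s c \<in> interior_vertices T}
    = {s. a \<le> s \<and> s \<le> a' \<and> pt k s c \<in> interior_vertices T}"
  proof -
    have "s \<le> a'" if "s < t" "pt k s c \<in> interior_vertices T" for s
      using adj_no_vertex[OF adj, of s] that t by (force simp: interior_vertices_def)
    then show ?thesis using t by auto
  qed
  ultimately show ?thesis using left_jump_eq[OF l, of t \<phi>] right_jump_eq[OF l ab, of \<phi>] t ab by simp
qed

lemma jump_data_surj:
  assumes D: "\<phi> \<in> data_space" and c0: "constraint_map \<phi> = 0"
  shows "\<exists>P\<in>piece_space. jump_data P = \<phi>"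
proof -
  have closed: "right_jump \<phi> k t c - left_jump \<phi> k t c
    = right_jump \<phi> (flip k) c t - left_jump \<phi> (flip k) c t"
    if "pt k t c \<in> interior (mesh_domain T)" for k t c
    using jump_at_interior[OF c0 that] jump_at_interior[OF c0, of "flip k" c t] that by simp
  have "\<exists>P. \<forall>k F G a b c. adj k F G a b c \<longrightarrow> P F - P G = right_jump \<phi> k a c"
  proof (rule jumps_exact[where lj = "left_jump \<phi>"])
    show "left_jump \<phi> k t' c = right_jump \<phi> k t c" if "t < t'" "\<And>z. z \<in> coords k \<Longrightarrow> z < t' \<longleftrightarrow> z \<le> t"
      for k t t' c
      using that by (rule left_jump_shift)
    show "right_jump \<phi> k t c = 0" if "\<not> edge_after k t c" for k t c using that
      by (simp add: right_jump_def)
  qed (rule closed)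
  then obtain P0 where P0: "\<And>k F G a b c. adj k F G a b c \<Longrightarrow> P0 F - P0 G = right_jump \<phi> k a c"
    by blast
  \<comment> \<open>A potential is fixed only up to a constant, chosen here so that the base cell
    receives \<open>\<phi> Base\<close>.\<close>
  define P where "P F = (if F \<in> T then P0 F - P0 base_cell + \<phi> Base else 0)" for F
  have Padj: "P F - P G = right_jump \<phi> k a c" if "adj k F G a b c" for k F G a b c
    using P0[OF that] adjD(1,2)[OF that] by (simp add: P_def)
  have bd0: "bidegree_le d1 d2 (\<phi> Base)" using D by (simp add: data_space_iff)
  \<comment> \<open>The potential was built among all bivariate polynomials. The bound is regained
    by walking from the base cell, every jump on the way being of bounded bidegree.\<close>
  have "bidegree_le d1 d2 (P F)" if "F \<in> T" for F
    using cells_connected[OF base_cell that]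
  proof (induction rule: rtrancl_induct)
    case base show ?case using base_cell bd0 by (simp add: P_def)
  next
    case (step F G)
    then obtain k a b c where "adj k F G a b c \<or> adj k G F a b c" unfolding adj_rel_def by blast
    then have "P G = P F - right_jump \<phi> k a c \<or> P G = P F + right_jump \<phi> k a c" using Padj
      by (force simp: algebra_simps)
    moreover have "bidegree_le d1 d2 (right_jump \<phi> k a c)"
      using right_jump_line_space[OF D] line_space_iff by blast
    ultimately show ?case using step.IH bidegree_le_add bidegree_le_diff by metis
  qed
  then have PSP: "P \<in> piece_space" unfolding piece_space_iff
    using Padj right_jump_line_space[OF D] by (auto simp: P_def)
  have jump_after: "jump_after P k t c = right_jump \<phi> k t c" if edge_after: "edge_after k t c"
    for k t c
  proof -
    obtain F G a b where adj: "adj k F G a b c" "a \<le> t" "t < b"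
      using edge_after_adjE[OF edge_after] .
    show ?thesis using jump_after_adj[OF adj, of P] right_jump_edge[OF adj, of \<phi>] Padj[OF adj(1)]
      by simp
  qed
  have jump_before: "jump_before P k t c = left_jump \<phi> k t c" if edge_before: "edge_before k t c"
    for k t c
  proof -
    obtain F G a b where adj: "adj k F G a b c" "a < t" "t \<le> b"
      using edge_before_adjE[OF edge_before] .
    show ?thesis using jump_before_adj[OF adj, of P] left_jump_edge[OF adj, of \<phi>] Padj[OF adj(1)]
      by simp
  qed
  have "jump_data P i = \<phi> i" for i
  proof (cases i)
    case Base
    then show ?thesis using base_cell by (simp add: P_def)
  next
    case (Cross k a b c)
    show ?thesis
    proof (cases "cross_cut T k a b c")
      case True
      then have l: "l_edge T k a b c" and ni: "pt k a c \<notin> interior_vertices T"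
        "pt k b c \<notin> interior_vertices T"
        by (auto simp: cross_cut_iff)
      have ab: "a < b" and edge_after: "edge_after k a c" using l by (auto simp: l_edge_iff)
      have e: "{s. a \<le> s \<and> s \<le> a \<and> pt k s c \<in> interior_vertices T} = {}" using ni by auto
      have "right_jump \<phi> k a c = \<phi> (Cross k a b c)"
        unfolding right_jump_eq[OF l order.refl ab] e using ni by (simp add: start_def)
      then show ?thesis using jump_after[OF edge_after] True Cross by simp
    next
      case False
      then have "\<phi> (Cross k a b c) = 0" using D[unfolded data_space_iff] by metis
      then show ?thesis using False Cross by simp
    qed
  next
    case (Vtx v)
    show ?thesis
    proof (cases "v \<in> interior_vertices T")
      case True
      obtain t c where v: "v = pt Horizontal t c" by (rule pt_exhaust)
      have int: "pt Horizontal t c \<in> interior (mesh_domain T)" using True v interior_vertex_domain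
        by blast
      have "jump_after P Horizontal t c = right_jump \<phi> Horizontal t c"
        using jump_after jump_after_zero[OF int]
          by (cases "edge_after Horizontal t c") (auto simp: right_jump_def)
      moreover have "jump_before P Horizontal t c = left_jump \<phi> Horizontal t c"
        using jump_before jump_before_zero[OF int]
          by (cases "edge_before Horizontal t c") (auto simp: left_jump_def)
      ultimately have "vjump P v = \<phi> (Vtx v)"
        unfolding v vjump_pt using jump_at_interior[OF c0 int] True v by simp
      then show ?thesis using True Vtx by simp
    next
      case False
      then have "\<phi> (Vtx v) = 0" using D[unfolded data_space_iff] by metis
      then show ?thesis using False Vtx by simp
    qed
  qed
  then have "jump_data P = \<phi>" by (rule ext)
  with PSP show ?thesis by blast
qed

lemma jump_data_image: "jump_data ` piece_space = {\<phi> \<in> data_space. constraint_map \<phi> = 0}"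
  using jump_data_in_data_space constraint_map_jump_data jump_data_surj by blast

lemma dim_piece_space: "pf.dim piece_space = pf.dim {\<phi> \<in> data_space. constraint_map \<phi> = 0}"
proof -
  interpret pp: vector_space_pair "\<lambda>r (P :: cell \<Rightarrow> real poly poly) F. smult [:r:] (P F)"
    "\<lambda>r (\<phi> :: idx \<Rightarrow> real poly poly) i. smult [:r:] (\<phi> i)" ..
  show ?thesis using pp.dim_image_eq_inj_on[OF linear_jump_data subspace_piece_space
    inj_jump_data] jump_data_image by simp
qed

end

section \<open>The dimension of the spline space\<close>

lemma eval2_add: "eval2 (P + Q) x y = eval2 P x y + eval2 Q x y"
  and eval2_diff: "eval2 (P - Q) x y = eval2 P x y - eval2 Q x y"
  and eval2_mult: "eval2 (P * Q) x y = eval2 P x y * eval2 Q x y"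
  and eval2_smult: "eval2 (smult [:r:] P) x y = r * eval2 P x y"
  by (simp_all add: eval2_def)

text \<open>Infinitely many roots, twice: in \<open>x\<close> for each fixed \<open>y\<close>, and
  then for \<open>P\<close> itself at the constants \<open>[:y:]\<close>.\<close>

lemma eval2_eq_0_on_box:
  assumes ab: "a < b" "c < d" and 0: "\<And>x y. x \<in> {a..b} \<Longrightarrow> y \<in> {c..d} \<Longrightarrow> eval2 P x y = 0"
  shows "P = 0"
proof -
  have "poly P [:y:] = 0" if y: "y \<in> {c..d}" for y
  proof (rule ccontr)
    assume "poly P [:y:] \<noteq> 0"
    then have "finite {x. poly (poly P [:y:]) x = 0}" by (rule poly_roots_finite)
    moreover have "{a..b} \<subseteq> {x. poly (poly P [:y:]) x = 0}" using 0 y by (auto simp: eval2_def)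
    ultimately have "finite {a..b}" by (rule rev_finite_subset)
    thus False using ab(1) infinite_Icc by blast
  qed
  then have sub: "(\<lambda>y. [:y:]) ` {c..d} \<subseteq> {q. poly P q = 0}" by auto
  show ?thesis
  proof (rule ccontr)
    assume "P \<noteq> 0"
    then have "finite {q. poly P q = 0}" by (rule poly_roots_finite)
    with sub have "finite ((\<lambda>y. [:y:]) ` {c..d})" by (rule finite_subset)
    then have "finite {c..d}" by (rule finite_imageD) (simp add: inj_on_def)
    thus False using ab(2) infinite_Icc by blast
  qed
qed

section \<open>From pieces to functions\<close>

context spline_mesh begin

lemma eval2_line_space:
  assumes "p \<in> line_space k c"
  shows "eval2 p (fst (pt k t c)) (snd (pt k t c)) = 0"
proof -
  obtain q where "p = smoothness_factor \<alpha> \<beta> k c * q" using assms unfolding line_space_iff dvd_def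
    by blast
  moreover have "eval2 (smoothness_factor \<alpha> \<beta> k c) (fst (pt k t c)) (snd (pt k t c)) = 0"
    by (cases k) (simp_all add: eval2_def)
  ultimately show ?thesis by (simp add: eval2_mult)
qed

text \<open>The two cells are linked by edges through the point, where all jumps across these edges
  vanish. Regularity enters the passage to functions here.\<close>

lemma piece_space_consistent:
  assumes P: "P \<in> piece_space" and FG: "F \<in> T" "G \<in> T" "(x, y) \<in> F" "(x, y) \<in> G"
  shows "eval2 (P F) x y = eval2 (P G) x y"
proof -
  have "(F, G) \<in> (adj_at (x, y))\<^sup>*" using local_connectivity[of F G Horizontal x y] FG by simp
  then show ?thesis
  proof (induction rule: rtrancl_induct)
    case (step G H)
    then obtain k a b c where adj: "adj k G H a b c \<or> adj k H G a b c" and z: "(x, y) \<in> seg k a b c"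
      unfolding adj_at_def by blast
    obtain t where t: "(x, y) = pt k t c" using z by (auto simp: seg_def)
    have e0: "eval2 p x y = 0" if "p \<in> line_space k c" for p
      using eval2_line_space[OF that, of t] unfolding t[symmetric] by simp
    have "P G - P H \<in> line_space k c \<or> P H - P G \<in> line_space k c" using P adj piece_space_iff
      by blast
    then have "eval2 (P G) x y = eval2 (P H) x y" using e0 eval2_diff by force
    with step.IH show ?case by simp
  qed simp
qed

definition to_fun :: "(cell \<Rightarrow> real poly poly) \<Rightarrow> real \<times> real \<Rightarrow> real" where
  "to_fun P z = (if z \<in> mesh_domain T then eval2 (P (SOME F. F \<in> T \<and> z \<in> F)) (fst z) (snd z)
    else 0)"

lemma to_fun_eq:
  assumes "P \<in> piece_space" "F \<in> T" "(x, y) \<in> F"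
  shows "to_fun P (x, y) = eval2 (P F) x y"
proof -
  define G where "G = (SOME F. F \<in> T \<and> (x, y) \<in> F)"
  have "G \<in> T \<and> (x, y) \<in> G" unfolding G_def by (rule someI[of _ F]) (use assms in simp)
  then have "eval2 (P G) x y = eval2 (P F) x y" using piece_space_consistent assms by blast
  then show ?thesis using assms(2,3) by (auto simp: to_fun_def G_def mesh_domain_def)
qed

lemma linear_to_fun: "Vector_Spaces.linear (\<lambda>r P F. smult [:r:] (P F)) (\<lambda>r f z. r * f z) to_fun"
  unfolding Vector_Spaces.linear_iff
  by (intro conjI allI pf.vector_space_axioms fun_vs.vector_space_axioms ext)
     (simp_all add: to_fun_def eval2_add eval2_smult)

lemma to_fun_image: "to_fun ` piece_space = spline_space d1 d2 \<alpha> \<beta> T"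
proof
  show "to_fun ` piece_space \<subseteq> spline_space d1 d2 \<alpha> \<beta> T"
  proof
    fix f assume "f \<in> to_fun ` piece_space"
    then obtain P where P: "P \<in> piece_space" "f = to_fun P" by blast
    show "f \<in> spline_space d1 d2 \<alpha> \<beta> T"
      by (rule spline_spaceI[of T f d1 d2 \<alpha> \<beta> P])
        (use P to_fun_eq in \<open>auto simp: piece_space_def to_fun_def\<close>)
  qed
  show "spline_space d1 d2 \<alpha> \<beta> T \<subseteq> to_fun ` piece_space"
  proof
    fix f assume "f \<in> spline_space d1 d2 \<alpha> \<beta> T"
    then obtain P where P: "\<And>z. z \<notin> mesh_domain T \<Longrightarrow> f z = 0" "spline_pieces d1 d2 \<alpha> \<beta> T P"
      "\<And>F x y. F \<in> T \<Longrightarrow> (x, y) \<in> F \<Longrightarrow> f (x, y) = eval2 (P F) x y"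
      by (rule spline_spaceE) blast
    define Q where "Q F = (if F \<in> T then P F else 0)" for F
    have Q: "Q \<in> piece_space" using P(2) unfolding piece_space_def spline_pieces_iff Q_def
      by (auto simp: adjD)
    have "f z = to_fun Q z" for z
    proof (cases "z \<in> mesh_domain T")
      case True
      then obtain F where F: "F \<in> T" "z \<in> F" by (auto simp: mesh_domain_def)
      then show ?thesis using P(3)[of F "fst z" "snd z"] to_fun_eq[OF Q, of F "fst z" "snd z"]
        by (simp add: Q_def)
    qed (simp add: P(1) to_fun_def)
    then show "f \<in> to_fun ` piece_space" using Q by blast
  qed
qed

lemma inj_to_fun: "inj_on to_fun piece_space"
proof (rule inj_onI)
  fix P Q assume PQ: "P \<in> piece_space" "Q \<in> piece_space" "to_fun P = to_fun Q"
  have "P F = Q F" for F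
  proof (cases "F \<in> T")
    case True
    have "P F - Q F = 0"
    proof (rule eval2_eq_0_on_box[OF cell_box(2)[OF True] cell_box(2)[OF True]])
      fix x y assume "x \<in> {lo Horizontal F..hi Horizontal F}" "y \<in> {lo Vertical F..hi Vertical F}"
      then have "(x, y) \<in> F" using pt_in_cell[OF True, of Horizontal x y] by simp
      then show "eval2 (P F - Q F) x y = 0"
        using to_fun_eq[OF PQ(1) True] to_fun_eq[OF PQ(2) True] PQ(3) by (simp add: eval2_diff)
    qed
    then show ?thesis by simp
  qed (use PQ in \<open>simp add: piece_space_def\<close>)
  then show "P = Q" by (rule ext)
qed

lemma dim_spline_space: "fun_vs.dim (spline_space d1 d2 \<alpha> \<beta> T) = pf.dim piece_space"
proof -
  interpret pp: vector_space_pair "\<lambda>r (P :: cell \<Rightarrow> real poly poly) F. smult [:r:] (P F)"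
    "\<lambda>(r :: real) (f :: real \<times> real \<Rightarrow> real) z. r * f z" ..
  show ?thesis using pp.dim_image_eq_inj_on[OF linear_to_fun subspace_piece_space inj_to_fun]
    to_fun_image by simp
qed

section \<open>Counting dimensions\<close>

lemma finite_cross_cuts: "finite {(a, b, c). cross_cut T k a b c}"
  by (rule finite_subset[OF _ finite_l_edges[of k]]) (auto simp: cross_cut_iff)

lemma finite_interior_l_edges: "finite {(a, b, c). interior_l_edge T k a b c}"
  by (rule finite_subset[OF _ finite_l_edges[of k]]) (auto simp: interior_l_edge_iff)

lemma exponent_le: "vexp k \<le> d1" "hexp k \<le> d2"
  using \<alpha> \<beta> by (cases k; simp)+

lemma dim_data_space: "pf.dim data_space = (d1 + 1) * (d2 + 1)
    + num_cross_cuts T Horizontal * ((d1 + 1) * (d2 - \<beta>))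
    + num_cross_cuts T Vertical * ((d1 - \<alpha>) * (d2 + 1))
    + card (interior_vertices T) * ((d1 - \<alpha>) * (d2 - \<beta>))"
proof -
  let ?w = "\<lambda>i. (d1 + 1 - idx_vexp i) * (d2 + 1 - idx_hexp i)"
  let ?C = "\<lambda>k. (\<lambda>(a, b, c). Cross k a b c) ` {(a, b, c). cross_cut T k a b c}"
  have C: "(\<Sum>i\<in>?C k. ?w i) = num_cross_cuts T k * ((d1 + 1 - vexp k) * (d2 + 1 - hexp k))" for k
    by (subst sum.reindex) (auto simp: inj_on_def num_cross_cuts_def case_prod_unfold)
  have Vt: "(\<Sum>i\<in>Vtx ` interior_vertices T. ?w i)
    = card (interior_vertices T) * ((d1 - \<alpha>) * (d2 - \<beta>))"
    by (subst sum.reindex) (auto simp: inj_on_def)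
  have "idx_vexp i \<le> d1" "idx_hexp i \<le> d2" for i using \<alpha> \<beta> exponent_le by (cases i; simp)+
  then have "pf.dim data_space = (\<Sum>i\<in>data_index. ?w i)" unfolding data_space_def
    by (intro dim_fam_space finite_data_index)
  also have "data_index = insert Base (?C Horizontal \<union> (?C Vertical \<union> Vtx ` interior_vertices T))"
  proof (intro set_eqI)
    fix i show "i \<in> data_index \<longleftrightarrow> i \<in> insert Base
      (?C Horizontal \<union> (?C Vertical \<union> Vtx ` interior_vertices T))"
    proof (cases i)
      case (Cross k a b c)
      then show ?thesis by (cases k) (auto simp: image_iff)
    qed auto
  qed
  also have "(\<Sum>i\<in>\<dots>. ?w i) = ?w Base +
    ((\<Sum>i\<in>?C Horizontal. ?w i) + ((\<Sum>i\<in>?C Vertical. ?w i) + (\<Sum>i\<in>Vtx ` interior_vertices T. ?w i)))"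
    using finite_cross_cuts finite_interior_vertices
      by (subst sum.insert, simp, force, subst sum.union_disjoint) (auto intro!: sum.union_disjoint)
  finally show ?thesis unfolding C Vt by simp
qed

lemma dim_constraint_space: "pf.dim constraint_space
  = num_interior_l_edges T Horizontal * ((d1 + 1) * (d2 - \<beta>))
    + num_interior_l_edges T Vertical * ((d1 - \<alpha>) * (d2 + 1))"
proof -
  let ?w = "\<lambda>k. (d1 + 1 - vexp k) * (d2 + 1 - hexp k)"
  let ?C = "\<lambda>k. Pair k ` {(a, b, c). interior_l_edge T k a b c}"
  have C: "(\<Sum>i\<in>?C k. ?w (fst i)) = num_interior_l_edges T k * ?w k" for k
    by (subst sum.reindex) (auto simp: inj_on_def num_interior_l_edges_def)
  have "pf.dim constraint_space = (\<Sum>i\<in>constraint_index. ?w (fst i))"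
    unfolding constraint_space_def by (intro dim_fam_space finite_constraint_index exponent_le)
  also have "constraint_index = ?C Horizontal \<union> ?C Vertical"
  proof (intro set_eqI)
    fix i :: "orientation \<times> real \<times> real \<times> real"
    obtain k a b c where "i = (k, a, b, c)" by (cases i)
    then show "i \<in> constraint_index \<longleftrightarrow> i \<in> ?C Horizontal \<union> ?C Vertical"
      by (cases k) (auto simp: constraint_index_def)
  qed
  also have "(\<Sum>i\<in>\<dots>. ?w (fst i)) = (\<Sum>i\<in>?C Horizontal. ?w (fst i)) + (\<Sum>i\<in>?C Vertical. ?w (fst i))"
    using finite_interior_l_edges by (intro sum.union_disjoint) auto
  finally show ?thesis unfolding C by simp
qed

end

text \<open>The upper end makes up for the 1 subtracted from the ceiling; clearing the denominator
  gives an inequality of natural numbers.\<close>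

lemma mono_bound:
  assumes "a < d" and "int m \<ge> \<lceil>(real d + 1) / (real d - real a)\<rceil> - 1"
  shows "d + 1 \<le> (m + 1) * (d - a)"
proof -
  have "(real d + 1) / (real d - real a) \<le> real m + 1"
    using assms(2) by linarith
  then have "real d + 1 \<le> (real m + 1) * (real d - real a)" using assms(1)
    by (simp add: pos_divide_le_eq)
  also have "\<dots> = real ((m + 1) * (d - a))"
    unfolding of_nat_mult of_nat_diff[OF less_imp_le[OF assms(1)]] by simp
  finally have "real (d + 1) \<le> real ((m + 1) * (d - a))" by (simp only: of_nat_add of_nat_1)
  then show ?thesis by (simp only: of_nat_le_iff)
qed

theorem theorem5p1:
  fixes d1 d2 \<alpha> \<beta> :: nat and T :: "cell set"
  assumes "\<alpha> < d1" and "\<beta> < d2"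
    and "t_mesh T" and "regular_mesh T" and "without_holes T"
    and "\<And>a b c. interior_l_edge T Horizontal a b c \<Longrightarrow>
           int (card (inner_mono_vertices T Horizontal a b c))
             \<ge> \<lceil>(real d1 + 1) / (real d1 - real \<alpha>)\<rceil> - 1"
    and "\<And>a b c. interior_l_edge T Vertical a b c \<Longrightarrow>
           int (card (inner_mono_vertices T Vertical a b c))
             \<ge> \<lceil>(real d2 + 1) / (real d2 - real \<beta>)\<rceil> - 1"
  shows "int (fun_vs.dim (spline_space d1 d2 \<alpha> \<beta> T)) =
           (int d1 + 1) * (int d2 + 1)
           + (int (num_cross_cuts T Horizontal) - int (num_interior_l_edges T Horizontal))
               * (int d1 + 1) * (int d2 - int \<beta>)
           + (int (num_cross_cuts T Vertical) - int (num_interior_l_edges T Vertical))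
               * (int d2 + 1) * (int d1 - int \<alpha>)
           + int (card (interior_vertices T)) * (int d1 - int \<alpha>) * (int d2 - int \<beta>)"
proof -
  interpret spline_mesh T d1 d2 \<alpha> \<beta>
    by unfold_locales (use assms in auto)
  interpret mono_mesh T d1 d2 \<alpha> \<beta>
  proof
    fix k a b c assume il: "interior_l_edge T k a b c"
    show "line_deg k + 1 \<le> (card (inner_mono_vertices T k a b c) + 1) *
      (line_deg k - line_smooth k)"
    proof (cases k)
      case Horizontal
      show ?thesis using mono_bound[OF assms(1) assms(6)] il unfolding Horizontal by simp
    next
      case Vertical
      show ?thesis using mono_bound[OF assms(2) assms(7)] il unfolding Vertical by simp
    qed
  qed
  \<comment> \<open>Stated as a sum of natural numbers and moved to the integers before subtracting,
    so that nothing is truncated.\<close>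
  have "pf.dim data_space = fun_vs.dim (spline_space d1 d2 \<alpha> \<beta> T) + pf.dim constraint_space"
    using dim_constrained dim_spline_space dim_piece_space by simp
  then have "int (fun_vs.dim (spline_space d1 d2 \<alpha> \<beta> T))
    = int (pf.dim data_space) - int (pf.dim constraint_space)" by simp
  also have "\<dots> = (int d1 + 1) * (int d2 + 1)
           + (int (num_cross_cuts T Horizontal) - int (num_interior_l_edges T Horizontal))
               * (int d1 + 1) * (int d2 - int \<beta>)
           + (int (num_cross_cuts T Vertical) - int (num_interior_l_edges T Vertical))
               * (int d2 + 1) * (int d1 - int \<alpha>)
           + int (card (interior_vertices T)) * (int d1 - int \<alpha>) * (int d2 - int \<beta>)"
  proof -
    have "int (d1 - \<alpha>) = int d1 - int \<alpha>" "int (d2 - \<beta>) = int d2 - int \<beta>"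
      using assms(1,2) by (simp_all add: of_nat_diff)
    then show ?thesis unfolding dim_data_space dim_constraint_space of_nat_add of_nat_mult
      of_nat_1 by algebra
  qed
  finally show ?thesis .
qed

end
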